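(* Game $\widetilde{\mathscr{G}}$ always admits a Nash equilibrium, for any set of channel matrices and transmit powers of the users. Furthermore, suppose that $$\rho(\mathbf{S})<1 .$$ Then the Nash equilibrium of $\widetilde{\mathscr{G}}$ is unique and, as the number of iterations tends to infinity, the asynchronous iterative algorithm based on the mappings $\widetilde{\mathbf{WF}}_q$ converges to the unique Nash equilibrium of $\widetilde{\mathscr{G}}$, for any set of feasible initial conditions and any updating schedule.
   Context: Setting. $\Omega=\{1,\ldots,Q\}$. For $r,q\in\Omega$, the channel matrices $\mathbf{H}_{rq}\in\mathbb{C}^{n_{R_q}\times n_{T_r}}$ are arbitrary (square, tall or fat, possibly rank deficient), with $\mathbf{H}_{qq}\neq\mathbf{0}$; $\mathbf{R}_{n_q}\in\mathbb{C}^{n_{R_q}\times n_{R_q}}$ is Hermitian positive definite, and $P_q>0$ is the transmit power of user $q$. $\rho$ is the spectral radius, $(\cdot)^\sharp$ the Moore-Penrose pseudoinverse, $\mathbf{A}^{\sharp H}=(\mathbf{A}^\sharp)^H$, and $\|\cdot\|_F$ the Frobenius norm. Reduction to full column rank. Let $r_q=\mathrm{rank}(\mathbf{H}_{qq})$ and let $\mathbf{V}_q\in\mathbb{C}^{n_{T_q}\times r_q}$ have orthonormal columns spanning the orthogonal complement of the null space of $\mathbf{H}_{qq}$, with $\mathbf{V}_q=\mathbf{I}$ if $\mathbf{H}_{qq}$ has full column rank. User $q$ transmits with covariance matrix $\mathbf{V}_q\mathbf{Q}_q\mathbf{V}_q^H$. Put $\overline{\mathbf{H}}_{rq}=\mathbf{H}_{rq}\mathbf{V}_r$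 for all $r,q$; every $\overline{\mathbf{H}}_{qq}$ then has full column rank. If all $\mathbf{H}_{qq}$ have full column rank, then $\overline{\mathbf{H}}_{rq}=\mathbf{H}_{rq}$ and $r_q=n_{T_q}$ throughout. The strategy sets are $\mathscr{Q}_q=\{\mathbf{Q}\in\mathbb{C}^{r_q\times r_q}:\mathbf{Q}\succeq\mathbf{0},\ \mathrm{Tr}(\mathbf{Q})=P_q\}$; for $\mathbf{Q}_{-q}=(\mathbf{Q}_r)_{r\neq q}\in\prod_{r\ne q}\mathscr{Q}_r$, $\mathbf{R}_{-q}(\mathbf{Q}_{-q})=\mathbf{R}_{n_q}+\sum_{r\neq q}\overline{\mathbf{H}}_{rq}\mathbf{Q}_r\overline{\mathbf{H}}_{rq}^H$; and $[\mathbf{X}]_{\mathscr{Q}_q}=\operatorname{argmin}_{\mathbf{Z}\in\mathscr{Q}_q}\|\mathbf{Z}-\mathbf{X}\|_F$. Game $\widetilde{\mathscr{G}}$: player $q\in\Omega$ chooses $\mathbf{Q}_q\in\mathscr{Q}_q$ to maximize $$\widetilde{R}_q(\mathbf{Q}_q,\mathbf{Q}_{-q})=\log\det\Big(\mathbf{I}+\big(\overline{\mathbf{H}}_{qq}^{\sharp}\mathbf{R}_{-q}(\mathbf{Q}_{-q})\overline{\mathbf{H}}_{qq}^{\sharp H}\big)^{-1}\mathbf{Q}_q\Big).$$ The corresponding best response of player $q$ is $\widetilde{\mathbf{WF}}_q(\mathbf{Q}_{-q})=\big[-\overline{\mathbf{H}}_{qq}^{\sharp}\mathbf{R}_{-q}(\mathbf{Q}_{-q})\overline{\mathbf{H}}_{qq}^{\sharp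 H}\big]_{\mathscr{Q}_q}$. A Nash equilibrium is $(\mathbf{Q}_q^\star)_{q\in\Omega}$ with $\mathbf{Q}_q^\star\in\mathscr{Q}_q$ and $\widetilde{R}_q(\mathbf{Q}_q^\star,\mathbf{Q}_{-q}^\star)\ge\widetilde{R}_q(\mathbf{Q}_q,\mathbf{Q}_{-q}^\star)$ for all $\mathbf{Q}_q\in\mathscr{Q}_q$ and all $q$. Matrix $\mathbf{S}\in\mathbb{R}_+^{Q\times Q}$ (in terms of the original channels): $[\mathbf{S}]_{qr}=\rho\big(\mathbf{H}_{rq}^H\mathbf{H}_{qq}^{\sharp H}\mathbf{H}_{qq}^{\sharp}\mathbf{H}_{rq}\big)$ if $r\neq q$ and $[\mathbf{S}]_{qq}=0$. Asynchronous algorithm. An updating schedule consists of sets $\mathcal{T}_q\subseteq\{0,1,2,\ldots\}$ (times at which user $q$ updates) and integers $\tau_r^q(n)$ (the most recent time at which the interference from user $r$ is perceived by user $q$ at iteration $n$) satisfying the standard totally asynchronous conditions: $0\le\tau_r^q(n)\le n$; each $\mathcal{T}_q$ is infinite; and for every sequence $\{n_k\}\subseteq\mathcal{T}_q$ tending to infinity, $\lim_{k\to\infty}\tau_r^q(n_k)=\infty$. Starting from feasible initial conditions $\mathbf{Q}_q^{(0)}\in\mathscr{Q}_q$, for $n=0,1,2,\ldots$ and all $q\in\Omega$, $$\mathbf{Q}_q^{(n+1)}=\begin{cases}\widetilde{\mathbf{WF}}_q\big((\mathbf{Q}_r^{(\tau_r^q(n))})_{r\neq q}\big), & n\in\mathcal{T}_q,\\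 \mathbf{Q}_q^{(n)}, & \text{otherwise.}\end{cases}$$ *)

theory Defs
  imports
    Complex_Main
    "Jordan_Normal_Form.Spectral_Radius"
    "Jordan_Normal_Form.Schur_Decomposition"
    "Jordan_Normal_Form.Matrix_Kernel"
    "Jordan_Normal_Form.DL_Rank"
begin

text \<open>
  The \<open>Q\<close> users are numbered \<open>0, \<dots>, Q - 1\<close>. \<open>H r q\<close> is the channel from the transmitter
  of user \<open>r\<close> to the receiver of user \<open>q\<close>. A strategy profile is a function from users to
  matrices; profiles of the opponents of \<open>q\<close> are represented by full profiles whose \<open>q\<close>-th
  component is never inspected.
\<close>

definition hermitian_mat :: "nat \<Rightarrow> complex mat \<Rightarrow> bool" where
  "hermitian_mat n A \<longleftrightarrow> A \<in> carrier_mat n n \<and> mat_adjoint A = A"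

text \<open>For Hermitian \<open>A\<close> the number \<open>(A *\<^sub>v v) \<bullet>c v\<close> is real, so \<open>Re\<close> loses nothing.\<close>

definition pos_semidef :: "nat \<Rightarrow> complex mat \<Rightarrow> bool" where
  "pos_semidef n A \<longleftrightarrow> hermitian_mat n A \<and>
     (\<forall>v \<in> carrier_vec n. 0 \<le> Re ((A *\<^sub>v v) \<bullet>c v))"

definition pos_def :: "nat \<Rightarrow> complex mat \<Rightarrow> bool" where
  "pos_def n A \<longleftrightarrow> hermitian_mat n A \<and>
     (\<forall>v \<in> carrier_vec n. v \<noteq> 0\<^sub>v n \<longrightarrow> 0 < Re ((A *\<^sub>v v) \<bullet>c v))"

definition mat_tr :: "complex mat \<Rightarrow> complex" where
  "mat_tr A = (\<Sum>i<dim_row A. A $$ (i, i))"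

definition frob_norm :: "complex mat \<Rightarrow> real" where
  "frob_norm A = sqrt (\<Sum>i<dim_row A. \<Sum>j<dim_col A. (cmod (A $$ (i, j)))\<^sup>2)"

text \<open>The four Penrose conditions.\<close>

definition is_pinv :: "complex mat \<Rightarrow> complex mat \<Rightarrow> bool" where
  "is_pinv A B \<longleftrightarrow> B \<in> carrier_mat (dim_col A) (dim_row A) \<and>
     A * B * A = A \<and> B * A * B = B \<and>
     mat_adjoint (A * B) = A * B \<and> mat_adjoint (B * A) = B * A"

definition pinv :: "complex mat \<Rightarrow> complex mat" where
  "pinv A = (THE B. is_pinv A B)"

definition mat_rank :: "complex mat \<Rightarrow> nat" where
  "mat_rank A = vec_space.rank (dim_row A) A"

text \<open>
  \<open>V\<close> has orthonormal columns that span the orthogonal complement of the null space of \<open>A\<close>,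
  and \<open>V\<close> is the identity when \<open>A\<close> has full column rank.
\<close>

definition reduction_basis :: "complex mat \<Rightarrow> complex mat \<Rightarrow> bool" where
  "reduction_basis A V \<longleftrightarrow>
     V \<in> carrier_mat (dim_col A) (mat_rank A) \<and>
     mat_adjoint V * V = 1\<^sub>m (mat_rank A) \<and>
     vec_space.col_space (dim_col A) V =
       {v \<in> carrier_vec (dim_col A). \<forall>u \<in> mat_kernel A. v \<bullet>c u = 0} \<and>
     (mat_rank A = dim_col A \<longrightarrow> V = 1\<^sub>m (dim_col A))"

definition reduced_channel ::
  "(nat \<Rightarrow> nat \<Rightarrow> complex mat) \<Rightarrow> (nat \<Rightarrow> complex mat) \<Rightarrow> nat \<Rightarrow> nat \<Rightarrow> complex mat" where
  "reduced_channel H V r q = H r q * V r"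

text \<open>
  In the definitions of the game, \<open>Hb\<close> is a family of reduced channels; the strategies of user
  \<open>q\<close> are square matrices of size \<open>dim_col (Hb q q)\<close>, i.e. the rank of the original \<open>H q q\<close>.
\<close>

definition strategy_set ::
  "(nat \<Rightarrow> nat \<Rightarrow> complex mat) \<Rightarrow> (nat \<Rightarrow> real) \<Rightarrow> nat \<Rightarrow> complex mat set" where
  "strategy_set Hb P q =
     {X. pos_semidef (dim_col (Hb q q)) X \<and> mat_tr X = complex_of_real (P q)}"

text \<open>
  The sum over the interferers is taken entrywise, because matrices with explicit carriers have
  no zero element over which \<open>sum\<close> could range.
\<close>

definition interference_cov ::
  "nat \<Rightarrow> (nat \<Rightarrow> nat \<Rightarrow> complex mat) \<Rightarrow> (nat \<Rightarrow> complex mat) \<Rightarrow> nat \<Rightarrow> (nat \<Rightarrow> complex mat)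
     \<Rightarrow> complex mat" where
  "interference_cov Q Hb Rn q X =
     mat (dim_row (Rn q)) (dim_col (Rn q)) (\<lambda>(i, j).
       Rn q $$ (i, j) +
       (\<Sum>r \<in> {..<Q} - {q}. (Hb r q * X r * mat_adjoint (Hb r q)) $$ (i, j)))"

definition effective_cov ::
  "nat \<Rightarrow> (nat \<Rightarrow> nat \<Rightarrow> complex mat) \<Rightarrow> (nat \<Rightarrow> complex mat) \<Rightarrow> nat \<Rightarrow> (nat \<Rightarrow> complex mat)
     \<Rightarrow> complex mat" where
  "effective_cov Q Hb Rn q X =
     pinv (Hb q q) * interference_cov Q Hb Rn q X * mat_adjoint (pinv (Hb q q))"

text \<open>
  On feasible strategies \<open>effective_cov\<close> is invertible and the determinant is real and positive,
  so \<open>the\<close>, \<open>Re\<close> and \<open>ln\<close> are applied only where they are meaningful.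
\<close>

definition rate ::
  "nat \<Rightarrow> (nat \<Rightarrow> nat \<Rightarrow> complex mat) \<Rightarrow> (nat \<Rightarrow> complex mat) \<Rightarrow> nat \<Rightarrow> complex mat
     \<Rightarrow> (nat \<Rightarrow> complex mat) \<Rightarrow> real" where
  "rate Q Hb Rn q Z X =
     ln (Re (det (1\<^sub>m (dim_col (Hb q q)) + the (mat_inverse (effective_cov Q Hb Rn q X)) * Z)))"

text \<open>Profiles are extensional, so that equality of profiles is equality for every user.\<close>

definition nash_equilibrium ::
  "nat \<Rightarrow> (nat \<Rightarrow> nat \<Rightarrow> complex mat) \<Rightarrow> (nat \<Rightarrow> complex mat) \<Rightarrow> (nat \<Rightarrow> real)
     \<Rightarrow> (nat \<Rightarrow> complex mat) \<Rightarrow> bool" where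
  "nash_equilibrium Q Hb Rn P X \<longleftrightarrow>
     X \<in> (\<Pi>\<^sub>E q \<in> {..<Q}. strategy_set Hb P q) \<and>
     (\<forall>q < Q. \<forall>Z \<in> strategy_set Hb P q. rate Q Hb Rn q (X q) X \<ge> rate Q Hb Rn q Z X)"

definition frob_proj :: "complex mat set \<Rightarrow> complex mat \<Rightarrow> complex mat" where
  "frob_proj K X = arg_min_on (\<lambda>Z. frob_norm (Z - X)) K"

definition best_response ::
  "nat \<Rightarrow> (nat \<Rightarrow> nat \<Rightarrow> complex mat) \<Rightarrow> (nat \<Rightarrow> complex mat) \<Rightarrow> (nat \<Rightarrow> real) \<Rightarrow> nat
     \<Rightarrow> (nat \<Rightarrow> complex mat) \<Rightarrow> complex mat" where
  "best_response Q Hb Rn P q X = frob_proj (strategy_set Hb P q) (- effective_cov Q Hb Rn q X)"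

definition interference_matrix :: "nat \<Rightarrow> (nat \<Rightarrow> nat \<Rightarrow> complex mat) \<Rightarrow> real mat" where
  "interference_matrix Q H = mat Q Q (\<lambda>(q, r). if r = q then 0 else
     spectral_radius (mat_adjoint (H r q) * mat_adjoint (pinv (H q q)) * pinv (H q q) * H r q))"

text \<open>
  \<open>T q\<close> is the set of update times of user \<open>q\<close>; \<open>\<tau> q r n\<close> is the time at which user \<open>q\<close>
  perceived the interference from user \<open>r\<close> that it uses at iteration \<open>n\<close>.
\<close>

definition updating_schedule ::
  "nat \<Rightarrow> (nat \<Rightarrow> nat set) \<Rightarrow> (nat \<Rightarrow> nat \<Rightarrow> nat \<Rightarrow> nat) \<Rightarrow> bool" where
  "updating_schedule Q T \<tau> \<longleftrightarrow>
     (\<forall>q < Q. infinite (T q)) \<and>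
     (\<forall>q < Q. \<forall>r < Q. r \<noteq> q \<longrightarrow>
        (\<forall>n. \<tau> q r n \<le> n) \<and>
        (\<forall>s. (\<forall>k. s k \<in> T q) \<and> filterlim s at_top sequentially \<longrightarrow>
             filterlim (\<lambda>k. \<tau> q r (s k)) at_top sequentially))"

definition async_run ::
  "nat \<Rightarrow> (nat \<Rightarrow> nat \<Rightarrow> complex mat) \<Rightarrow> (nat \<Rightarrow> complex mat) \<Rightarrow> (nat \<Rightarrow> real)
     \<Rightarrow> (nat \<Rightarrow> nat set) \<Rightarrow> (nat \<Rightarrow> nat \<Rightarrow> nat \<Rightarrow> nat) \<Rightarrow> (nat \<Rightarrow> nat \<Rightarrow> complex mat) \<Rightarrow> bool" where
  "async_run Q Hb Rn P T \<tau> X \<longleftrightarrow>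
     (\<forall>q < Q. X 0 q \<in> strategy_set Hb P q) \<and>
     (\<forall>n. \<forall>q < Q. X (Suc n) q =
        (if n \<in> T q then best_response Q Hb Rn P q (\<lambda>r. X (\<tau> q r n) r) else X n q))"

end

theory Submission
  imports "HOL-Analysis.Brouwer_Fixpoint" Defs
begin

text \<open>
  By the spectral theorem, the projection of \<open>- M\<close> onto the strategy set is water-filling in an
  eigenbasis of \<open>M\<close>, and it is the unique maximizer of \<open>det (M + Z)\<close>, because
  \<open>\<Sum> ln \<lambda> \<le> \<Sum> (\<lambda> - 1)\<close> for the eigenvalues of \<open>M + Z\<close> relative to the water-filling
  solution. Hence the equilibria are the fixed points of the best response. Projections are
  nonexpansive and \<open>\<parallel>A D A\<^sup>H\<parallel> \<le> \<rho>(A\<^sup>H A) \<parallel>D\<parallel>\<close>, so the best response of user \<open>q\<close> is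
  Lipschitz in the strategy of user \<open>r\<close> with constant \<open>S\<^sub>q\<^sub>r\<close>. Continuity alone gives an
  equilibrium by Brouwer's theorem. If \<open>\<rho>(S) < 1\<close>, then \<open>w = \<Sum>\<^sub>k S\<^sup>k 1\<close> (cut off at a large
  \<open>k\<close>) satisfies \<open>S w < w\<close>, and the best response contracts the maximum norm weighted by \<open>w\<close>,
  which is what totally asynchronous iterations need in order to converge.
\<close>

text \<open>\<open>S\<close> is built from the original channels, while the game is played on the
  reduced ones. The bridge is \<open>pinv (H V) = V\<^sup>H pinv H\<close>: what user
  \<open>q\<close> sees of user \<open>r\<close> is
  \<open>pinv H\<^sub>q\<^sub>q * H\<^sub>r\<^sub>q\<close>, multiplied by an isometry on the right
  and by the adjoint of one on the left, and neither increases norms. Rates enter through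
  \<open>det (1 + M\<^sup>-\<^sup>1 Z) = det (M + Z) / det M\<close>, whose denominator does not
  depend on the player's own strategy. A Perron eigenvector of \<open>S\<close> would not serve as
  weight vector, because it may have zero entries when \<open>S\<close> is reducible. The Neumann
  series is positive from its first term on, and its truncation telescopes to
  \<open>S w = w - 1 + S\<^sup>N 1\<close>, which is below \<open>w\<close> once all entries of
  \<open>S\<^sup>N 1\<close> are below 1. That decay comes from scaling \<open>S\<close> by some
  \<open>\<theta> > 1\<close> with \<open>\<theta> * \<rho>(S) < 1\<close>: the powers of the scaled
  matrix are still bounded. Existence is independent of all this, since the Lipschitz constants are
  finite whatever the spectral radius of \<open>S\<close> is.\<close>

section \<open>Spectral theorem for Hermitian matrices\<close>

text \<open>
  The general rules have an inner dimension that does not occur in their conclusions, so the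
  simplifier cannot discharge their premises; in these instances it can.
\<close>

lemma square_mult_carrier:
  fixes A B :: "'a::semiring_0 mat"
  shows "A \<in> carrier_mat n n \<Longrightarrow> B \<in> carrier_mat n n \<Longrightarrow> A * B \<in> carrier_mat n n"
  by simp

lemma square_mult_assoc:
  fixes A B C :: "'a::semiring_0 mat"
  shows "A \<in> carrier_mat n n \<Longrightarrow> B \<in> carrier_mat n n \<Longrightarrow> C \<in> carrier_mat n n \<Longrightarrow>
    A * B * C = A * (B * C)"
  by simp

lemma square_inverse_cancel:
  fixes A B X :: "'a::semiring_1 mat"
  assumes "A * B = 1\<^sub>m n" "A \<in> carrier_mat n n" "B \<in> carrier_mat n n" "X \<in> carrier_mat n n"
  shows "A * (B * X) = X"
  using assms by (simp flip: square_mult_assoc[of A n B X])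

lemma mat_adjoint_dims [simp]:
  "dim_row (mat_adjoint A) = dim_col A" "dim_col (mat_adjoint A) = dim_row A"
  by (auto simp: mat_adjoint_def)

lemma mat_adjoint_index [simp]:
  fixes A :: "complex mat"
  shows "i < dim_col A \<Longrightarrow> j < dim_row A \<Longrightarrow> mat_adjoint A $$ (i, j) = cnj (A $$ (j, i))"
  by (simp add: mat_adjoint_def mat_of_rows_def)

lemma mat_adjoint_carrier [simp, intro]:
  "A \<in> carrier_mat n m \<Longrightarrow> mat_adjoint A \<in> carrier_mat m n"
  by (metis carrier_matD carrier_matI mat_adjoint_dims)

lemma mat_adjoint_adjoint [simp]:
  fixes A :: "complex mat" shows "mat_adjoint (mat_adjoint A) = A"
  by (rule eq_matI) auto

lemma mat_adjoint_mult:
  fixes A B :: "complex mat"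
  assumes "A \<in> carrier_mat n m" "B \<in> carrier_mat m k"
  shows "mat_adjoint (A * B) = mat_adjoint B * mat_adjoint A"
  using assms by (intro eq_matI) (auto simp: scalar_prod_def mult.commute)

lemma mat_adjoint_add:
  fixes A B :: "complex mat"
  assumes "A \<in> carrier_mat n m" "B \<in> carrier_mat n m"
  shows "mat_adjoint (A + B) = mat_adjoint A + mat_adjoint B"
  using assms by (intro eq_matI) auto

lemma mat_adjoint_uminus:
  fixes A :: "complex mat" shows "mat_adjoint (- A) = - mat_adjoint A"
  by (intro eq_matI) auto

lemma mat_adjoint_one [simp]: "mat_adjoint (1\<^sub>m n :: complex mat) = 1\<^sub>m n"
  by (intro eq_matI) auto

lemma cscalar_prod_mult_mat_vec:
  fixes A :: "complex mat"
  assumes "A \<in> carrier_mat n m" "v \<in> carrier_vec m" "w \<in> carrier_vec n"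
  shows "(A *\<^sub>v v) \<bullet>c w = v \<bullet>c (mat_adjoint A *\<^sub>v w)"
  using assms
  by (auto simp: scalar_prod_def sum_distrib_left sum_distrib_right mult_ac sum.swap[of _ "{0..<n}"])

lemma hermitian_matD:
  assumes "hermitian_mat n A"
  shows "A \<in> carrier_mat n n" "mat_adjoint A = A"
  using assms unfolding hermitian_mat_def by auto

lemma hermitian_mat_index:
  assumes "hermitian_mat n A" "i < n" "j < n"
  shows "A $$ (i, j) = cnj (A $$ (j, i))"
  using assms unfolding hermitian_mat_def by (metis carrier_matD mat_adjoint_index)

lemma hermitian_conj:
  assumes "hermitian_mat n A" "U \<in> carrier_mat m n"
  shows "hermitian_mat m (U * A * mat_adjoint U)"
proof -
  note A = hermitian_matD[OF assms(1)]
  have "mat_adjoint (U * A * mat_adjoint U) = U * (mat_adjoint A * mat_adjoint U)"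
    using A assms by (subst mat_adjoint_mult[of _ m n _ m]) (auto simp: mat_adjoint_mult[of _ m n _ n])
  then show ?thesis
    using A assms unfolding hermitian_mat_def by (auto simp: assoc_mult_mat[of _ m n _ n _ m])
qed

text \<open>\<open>W\<close> is the Householder reflection that exchanges the first unit vector
  \<open>e\<close> and the normalised vector \<open>u = c v\<close>, namely
  \<open>1 - 2 w w\<^sup>H / (w\<^sup>H w)\<close> with \<open>w = e - u\<close>. Being Hermitian,
  it is its own inverse.\<close>

lemma eigenvector_unitary_completion:
  fixes v :: "complex vec"
  assumes v: "v \<in> carrier_vec (Suc n)" "v \<noteq> 0\<^sub>v (Suc n)"
  obtains W c where "W \<in> carrier_mat (Suc n) (Suc n)" "mat_adjoint W = W" "W * W = 1\<^sub>m (Suc n)"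
    "col W 0 = c \<cdot>\<^sub>v v"
proof -
  define N where "N = sqrt (\<Sum>i<Suc n. (cmod (v $ i))\<^sup>2)"
  obtain i0 where i0: "i0 < Suc n" "v $ i0 \<noteq> 0"
    using v by (auto simp: vec_eq_iff)
  have "(\<Sum>i<Suc n. (cmod (v $ i))\<^sup>2) > 0"
    by (rule sum_pos2[OF _ _ _ zero_le_power2, of _ i0]) (use i0 in auto)
  then have N: "N > 0" and N2: "N\<^sup>2 = (\<Sum>i<Suc n. (cmod (v $ i))\<^sup>2)"
    unfolding N_def by (simp_all only: real_sqrt_gt_0_iff real_sqrt_pow2 less_imp_le)
  \<comment> \<open>Besides normalising \<open>v\<close>, the factor turns the phase of its first
    entry so that \<open>u 0\<close> is real and nonpositive. A complex reflection can send
    \<open>e\<close> to \<open>u\<close> only if \<open>u 0\<close> is real, and the sign keeps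
    \<open>w\<close> away from 0.\<close>
  define c where "c = (if v $ 0 = 0 then 1 / N else - cnj (v $ 0) / (N * cmod (v $ 0)))"
  have nc: "cmod c = 1 / N" using N by (cases "v $ 0 = 0") (simp_all add: c_def norm_divide norm_mult)
  have c0: "c * v $ 0 = - complex_of_real (cmod (v $ 0) / N)"
  proof (cases "v $ 0 = 0")
    case False
    define z where "z = complex_of_real (cmod (v $ 0))"
    have z: "z \<noteq> 0" using False by (simp add: z_def)
    have "c * v $ 0 = - (cnj (v $ 0) * v $ 0) / (complex_of_real N * z)"
      using False by (simp add: c_def z_def)
    also have "cnj (v $ 0) * v $ 0 = z * z"
      using complex_norm_square[of "v $ 0"] unfolding z_def power2_eq_square of_real_mult
      by (simp only: mult.commute)
    also have "- (z * z) / (complex_of_real N * z) = - z / complex_of_real N"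
      unfolding minus_divide_left[symmetric] nonzero_mult_divide_mult_cancel_right[OF z] ..
    finally show ?thesis by (simp add: z_def)
  qed simp
  define u where "u = (\<lambda>i. c * v $ i)"
  define t where "t = cmod (v $ 0) / N"
  have t: "t \<ge> 0" using N by (auto simp: t_def)
  have u0: "u 0 = - complex_of_real t" unfolding u_def t_def by (rule c0)
  have su: "(\<Sum>i<Suc n. u i * cnj (u i)) = 1"
  proof -
    have "(\<Sum>i<Suc n. u i * cnj (u i)) = of_real (\<Sum>i<Suc n. (cmod (u i))\<^sup>2)"
      by (simp only: complex_norm_square of_real_sum)
    also have "(\<Sum>i<Suc n. (cmod (u i))\<^sup>2) = (1/N)\<^sup>2 * (\<Sum>i<Suc n. (cmod (v $ i))\<^sup>2)"
      unfolding u_def by (simp only: norm_mult nc power_mult_distrib sum_distrib_left)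
    also have "\<dots> = 1" unfolding N2[symmetric] using N by (simp add: power_divide)
    finally show ?thesis by simp
  qed
  define w where "w = (\<lambda>i. (if i = 0 then 1 else 0) - u i)"
  have sw: "(\<Sum>i<Suc n. w i * cnj (w i)) = 2 + 2 * of_real t"
  proof -
    have "w i * cnj (w i) = (if i = 0 then 1 - u 0 - cnj (u 0) else 0) + u i * cnj (u i)" for i
      by (simp add: w_def algebra_simps)
    then have "(\<Sum>i<Suc n. w i * cnj (w i)) = (1 - u 0 - cnj (u 0)) + (\<Sum>i<Suc n. u i * cnj (u i))"
      by (simp only: sum.distrib) simp
    then show ?thesis unfolding su by (simp add: u0)
  qed
  \<comment> \<open>Half of the squared norm of \<open>w\<close>, and at the same time its first
    entry; this coincidence makes the first column of \<open>W\<close> equal to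
    \<open>e - w = u\<close>.\<close>
  define s where "s = complex_of_real (1 + t)"
  have s: "s \<noteq> 0" "cnj s = s" using t unfolding s_def of_real_eq_0_iff by simp_all
  have sw: "(\<Sum>i<Suc n. w i * cnj (w i)) = 2 * s" unfolding sw s_def by simp
  define W where "W = mat (Suc n) (Suc n) (\<lambda>(i, j). (if i = j then 1 else 0) - w i * cnj (w j) / s)"
  show ?thesis
  proof
    show W: "W \<in> carrier_mat (Suc n) (Suc n)" by (simp add: W_def)
    show "mat_adjoint W = W" by (rule eq_matI) (auto simp: W_def s)
    show "W * W = 1\<^sub>m (Suc n)"
    proof (rule eq_matI)
      fix i j assume "i < dim_row (1\<^sub>m (Suc n) :: complex mat)" "j < dim_col (1\<^sub>m (Suc n) :: complex mat)"
      then have ij: "i < Suc n" "j < Suc n" by auto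
      have "(W * W) $$ (i, j) = (\<Sum>k<Suc n. ((if i = k then 1 else 0) - w i * cnj (w k) / s) *
          ((if k = j then 1 else 0) - w k * cnj (w j) / s))"
        using ij by (auto simp: W_def scalar_prod_def lessThan_atLeast0 intro!: sum.cong)
      also have "\<dots> = (\<Sum>k<Suc n. (if k = i then (if i = j then 1 else 0) - w i * cnj (w j) / s else 0)
          - (if k = j then w i * cnj (w j) / s else 0) + w i * cnj (w j) / (s * s) * (w k * cnj (w k)))"
        by (intro sum.cong) (auto simp: algebra_simps)
      also have "\<dots> = (if i = j then 1 else 0) - 2 * (w i * cnj (w j) / s) + w i * cnj (w j) / (s * s) * (2 * s)"
        using ij by (simp only: sum.distrib sum_subtractf sum_distrib_left[symmetric] sw) simp
      also have "\<dots> = (if i = j then 1 else 0)" using s by (simp add: field_simps)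
      finally show "(W * W) $$ (i, j) = 1\<^sub>m (Suc n) $$ (i, j)" using ij by simp
    qed (auto simp: W_def)
    show "col W 0 = c \<cdot>\<^sub>v v"
    proof (rule eq_vecI)
      fix i assume "i < dim_vec (c \<cdot>\<^sub>v v)"
      then have i: "i < Suc n" using v by auto
      have "cnj (w 0) = s" by (simp add: w_def u0 s_def)
      then show "col W 0 $ i = (c \<cdot>\<^sub>v v) $ i"
        using i v s by (auto simp: W_def w_def u_def)
    qed (use v in \<open>auto simp: W_def\<close>)
  qed
qed

text \<open>Deflation: conjugating with a reflection that takes the first unit vector to a multiple
  of an eigenvector clears the first column, hence by symmetry the first row, and the induction
  hypothesis diagonalises the remaining block.\<close>

theorem hermitian_spectral:
  assumes "hermitian_mat n A"
  obtains U d where "U \<in> carrier_mat n n" "mat_adjoint U * U = 1\<^sub>m n" "U * mat_adjoint U = 1\<^sub>m n"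
    "A = U * mat_diag n (\<lambda>i. complex_of_real (d i)) * mat_adjoint U"
proof -
  have "\<exists>U d. U \<in> carrier_mat n n \<and> mat_adjoint U * U = 1\<^sub>m n \<and>
      A = U * mat_diag n (\<lambda>i. complex_of_real (d i)) * mat_adjoint U"
    using assms
  proof (induction n arbitrary: A)
    case 0
    then show ?case by (intro exI[of _ "1\<^sub>m 0"]) (auto simp: hermitian_mat_def intro!: eq_matI)
  next
    case (Suc n)
    let ?n = "Suc n"
    note A = hermitian_matD[OF Suc.prems]
    obtain e where "e \<in> spectrum A" using spectrum_non_empty[OF A(1)] by auto
    then obtain v where ev: "eigenvector A v e" unfolding spectrum_def eigenvalue_def by auto
    then have v: "v \<in> carrier_vec ?n" "v \<noteq> 0\<^sub>v ?n" "A *\<^sub>v v = e \<cdot>\<^sub>v v"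
      using A(1) unfolding eigenvector_def by auto
    obtain W c where W: "W \<in> carrier_mat ?n ?n" "mat_adjoint W = W" "W * W = 1\<^sub>m ?n" "col W 0 = c \<cdot>\<^sub>v v"
      using eigenvector_unitary_completion[OF v(1,2)] by blast
    define B where "B = W * A * W"
    have herB: "hermitian_mat ?n B" using hermitian_conj[OF Suc.prems W(1)] by (simp add: W(2) B_def)
    note B = hermitian_matD[OF herB]
    note assoc = square_mult_assoc[where n = ?n] and closed = square_mult_carrier[where n = ?n]
    have cW: "W * (W * X) = X" if "X \<in> carrier_mat ?n ?n" for X
      using square_inverse_cancel[OF W(3) W(1) W(1) that] .
    have "col B 0 = W *\<^sub>v (A *\<^sub>v col W 0)"
      using W(1) A(1) unfolding B_def assoc[OF W(1) A(1) W(1)]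
      by (simp only: col_mult2[OF W(1) mult_carrier_mat[OF A(1) W(1)] zero_less_Suc] col_mult2[OF A(1) W(1) zero_less_Suc])
    also have "\<dots> = e \<cdot>\<^sub>v (W *\<^sub>v col W 0)"
      unfolding W(4) using A(1) v W(1)
      by (simp add: mult_mat_vec[of _ ?n ?n] smult_smult_assoc mult.commute)
    also have "W *\<^sub>v col W 0 = col (W * W) 0" using col_mult2[OF W(1) W(1)] by simp
    also have "\<dots> = unit_vec ?n 0" unfolding W(3) by simp
    finally have colB: "col B 0 = e \<cdot>\<^sub>v unit_vec ?n 0" .
    have Bi0: "B $$ (i, 0) = (if i = 0 then e else 0)" if "i < ?n" for i
      using arg_cong[OF colB, of "\<lambda>x. x $ i"] that B(1) by (auto simp: col_def)
    have B0i: "B $$ (0, i) = (if i = 0 then cnj e else 0)" if "i < ?n" for i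
      using hermitian_mat_index[OF herB, of 0 i] Bi0[OF that] that by simp
    \<comment> \<open>The corner entry of the Hermitian \<open>B\<close> is \<open>e\<close> by its
      column and \<open>cnj e\<close> by its row, so the eigenvalue is real.\<close>
    have e: "complex_of_real (Re e) = e" "cnj e = e"
      using Bi0[of 0] B0i[of 0] by (simp_all add: complex_eq_iff)
    define B' where "B' = mat n n (\<lambda>(i, j). B $$ (Suc i, Suc j))"
    have "mat_adjoint B' = B'"
      by (rule eq_matI) (auto simp: B'_def intro: hermitian_mat_index[OF herB, symmetric])
    then have "hermitian_mat n B'" by (auto simp: hermitian_mat_def B'_def)
    then obtain U' d' where U': "U' \<in> carrier_mat n n" "mat_adjoint U' * U' = 1\<^sub>m n"
      "B' = U' * mat_diag n (\<lambda>i. complex_of_real (d' i)) * mat_adjoint U'"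
      using Suc.IH by blast
    define d where "d = (\<lambda>i. case i of 0 \<Rightarrow> Re e | Suc k \<Rightarrow> d' k)"
    define U1 where "U1 = mat ?n ?n (\<lambda>(i, j). case (i, j) of (0, 0) \<Rightarrow> 1 | (Suc i, Suc j) \<Rightarrow> U' $$ (i, j) | _ \<Rightarrow> 0)"
    have U1: "U1 \<in> carrier_mat ?n ?n" by (simp add: U1_def)
    have U1U1: "mat_adjoint U1 * U1 = 1\<^sub>m ?n"
    proof (rule eq_matI)
      fix i j assume "i < dim_row (1\<^sub>m ?n :: complex mat)" "j < dim_col (1\<^sub>m ?n :: complex mat)"
      then have ij: "i < ?n" "j < ?n" by auto
      have *: "(mat_adjoint U1 * U1) $$ (i, j) = cnj (U1 $$ (0, i)) * U1 $$ (0, j) +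
          (\<Sum>k<n. cnj (U1 $$ (Suc k, i)) * U1 $$ (Suc k, j))"
        using ij U1 by (simp add: scalar_prod_def lessThan_atLeast0[symmetric] sum.lessThan_Suc_shift
            del: sum.lessThan_Suc sum.op_ivl_Suc)
      have **: "(\<Sum>k<n. cnj (U' $$ (k, a)) * U' $$ (k, b)) = (if a = b then 1 else 0)" if "a < n" "b < n" for a b
        using arg_cong[OF U'(2), of "\<lambda>M. M $$ (a, b)"] that U'(1)
        by (simp add: scalar_prod_def lessThan_atLeast0)
      show "(mat_adjoint U1 * U1) $$ (i, j) = 1\<^sub>m ?n $$ (i, j)"
        unfolding * using ij ** by (cases i; cases j) (auto simp: U1_def)
    qed (use U1 in auto)
    let ?D = "mat_diag ?n (\<lambda>i. complex_of_real (d i))"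
    have diagB: "B = U1 * ?D * mat_adjoint U1"
    proof (rule eq_matI)
      fix i j assume "i < dim_row (U1 * ?D * mat_adjoint U1)" "j < dim_col (U1 * ?D * mat_adjoint U1)"
      then have ij: "i < ?n" "j < ?n" using U1 by auto
      have *: "(U1 * ?D * mat_adjoint U1) $$ (i, j) = U1 $$ (i, 0) * d 0 * cnj (U1 $$ (j, 0)) +
          (\<Sum>k<n. U1 $$ (i, Suc k) * d (Suc k) * cnj (U1 $$ (j, Suc k)))"
        using ij U1 unfolding mat_diag_mult_right[OF U1]
        by (simp add: scalar_prod_def lessThan_atLeast0[symmetric] sum.lessThan_Suc_shift
            del: sum.lessThan_Suc sum.op_ivl_Suc)
      have **: "B $$ (Suc a, Suc b) = (\<Sum>k<n. U' $$ (a, k) * d' k * cnj (U' $$ (b, k)))" if "a < n" "b < n" for a b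
      proof -
        have "B $$ (Suc a, Suc b) = B' $$ (a, b)" using that by (simp add: B'_def)
        also have "\<dots> = (\<Sum>k<n. U' $$ (a, k) * d' k * cnj (U' $$ (b, k)))"
          unfolding U'(3) mat_diag_mult_right[OF U'(1)] using that U'(1)
          by (simp add: scalar_prod_def lessThan_atLeast0)
        finally show ?thesis .
      qed
      show "B $$ (i, j) = (U1 * ?D * mat_adjoint U1) $$ (i, j)"
        unfolding * using ij ** Bi0 B0i e
        by (cases i; cases j) (auto simp: U1_def d_def)
    qed (use U1 B in auto)
    have "A = W * B * W"
      unfolding B_def using A(1) W(1) by (simp add: assoc closed cW W(3))
    also have "\<dots> = (W * U1) * ?D * mat_adjoint (W * U1)"
      unfolding diagB mat_adjoint_mult[OF W(1) U1] W(2) using W(1) U1 by (simp add: assoc closed)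
    finally have "A = (W * U1) * ?D * mat_adjoint (W * U1)" .
    moreover have "mat_adjoint (W * U1) * (W * U1) = 1\<^sub>m ?n"
      unfolding mat_adjoint_mult[OF W(1) U1] W(2) using W(1) U1 U1U1 by (simp add: assoc closed cW)
    moreover have "W * U1 \<in> carrier_mat ?n ?n" using W U1 by auto
    ultimately show ?case by blast
  qed
  then obtain U d where *: "U \<in> carrier_mat n n" "mat_adjoint U * U = 1\<^sub>m n"
      "A = U * mat_diag n (\<lambda>i. complex_of_real (d i)) * mat_adjoint U" by blast
  moreover have "U * mat_adjoint U = 1\<^sub>m n"
    using mat_mult_left_right_inverse[of "mat_adjoint U" n U] * by auto
  ultimately show ?thesis using that by blast
qed

section \<open>Trace, Frobenius inner product and Frobenius norm\<close>

lemma mat_tr_mult_comm: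
  assumes "A \<in> carrier_mat n m" "B \<in> carrier_mat m n"
  shows "mat_tr (A * B) = mat_tr (B * A)"
  using assms unfolding mat_tr_def
  by (auto simp: scalar_prod_def mult.commute lessThan_atLeast0 sum.swap[of _ "{0..<n}"] intro!: sum.cong)

lemma mat_tr_unitary_conj:
  assumes "U \<in> carrier_mat n n" "A \<in> carrier_mat n n" "U * U' = 1\<^sub>m n" "U' \<in> carrier_mat n n"
  shows "mat_tr (U' * A * U) = mat_tr A"
proof -
  have "mat_tr (U' * A * U) = mat_tr (U * (U' * A))"
    using assms by (intro mat_tr_mult_comm[of _ n n]) auto
  then show ?thesis using square_inverse_cancel[OF assms(3,1,4,2)] by simp
qed

text \<open>The real part gives the inner product of the underlying real Euclidean space, in which
  the variational inequality of a projection is stated.\<close>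

definition frob_inner :: "complex mat \<Rightarrow> complex mat \<Rightarrow> real" where
  "frob_inner A B = (\<Sum>i<dim_row A. \<Sum>j<dim_col A. Re (A $$ (i, j) * cnj (B $$ (i, j))))"

lemma frob_inner_eq_tr:
  assumes "A \<in> carrier_mat n m" "B \<in> carrier_mat n m"
  shows "frob_inner A B = Re (mat_tr (A * mat_adjoint B))"
  using assms unfolding frob_inner_def mat_tr_def
  by (auto simp: scalar_prod_def lessThan_atLeast0 intro!: sum.cong)

lemma frob_norm_nonneg [simp]: "0 \<le> frob_norm A"
  by (simp add: frob_norm_def sum_nonneg)

lemma frob_norm_square: "(frob_norm A)\<^sup>2 = frob_inner A A"
  by (simp add: frob_norm_def frob_inner_def sum_nonneg cmod_power2)
    (simp add: power2_eq_square)

lemma frob_inner_commute: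
  assumes "A \<in> carrier_mat n m" "B \<in> carrier_mat n m"
  shows "frob_inner A B = frob_inner B A"
  using assms unfolding frob_inner_def by (simp add: mult.commute)

lemma frob_inner_add_left:
  assumes "A \<in> carrier_mat n m" "B \<in> carrier_mat n m"
  shows "frob_inner (A + B) C = frob_inner A C + frob_inner B C"
  using assms unfolding frob_inner_def sum.distrib[symmetric]
  by (auto intro!: sum.cong simp: algebra_simps)

lemma frob_inner_diff_left:
  assumes "A \<in> carrier_mat n m" "B \<in> carrier_mat n m"
  shows "frob_inner (A - B) C = frob_inner A C - frob_inner B C"
  using assms unfolding frob_inner_def
  by (simp add: ring_distribs sum.distrib sum_subtractf)

lemma frob_inner_diff_right:
  assumes "A \<in> carrier_mat n m" "B \<in> carrier_mat n m" "C \<in> carrier_mat n m"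
  shows "frob_inner C (A - B) = frob_inner C A - frob_inner C B"
  using assms unfolding frob_inner_def
  by (simp add: ring_distribs sum.distrib sum_subtractf)

lemma frob_norm_eq_0:
  assumes "A \<in> carrier_mat n m" "frob_norm A = 0"
  shows "A = 0\<^sub>m n m"
proof (rule eq_matI)
  fix i j assume ij: "i < dim_row (0\<^sub>m n m :: complex mat)" "j < dim_col (0\<^sub>m n m :: complex mat)"
  have "(\<Sum>i<n. \<Sum>j<m. (cmod (A $$ (i, j)))\<^sup>2) = 0"
    using assms by (simp add: frob_norm_def)
  then have "\<forall>i<n. \<forall>j<m. (cmod (A $$ (i, j)))\<^sup>2 = 0"
    by (subst (asm) sum_nonneg_eq_0_iff) (auto simp: sum_nonneg sum_nonneg_eq_0_iff)
  then show "A $$ (i, j) = 0\<^sub>m n m $$ (i, j)" using ij by simp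
qed (use assms in auto)

section \<open>Positive semidefinite and positive definite matrices, determinants\<close>

lemma hermitian_add:
  "hermitian_mat n A \<Longrightarrow> hermitian_mat n B \<Longrightarrow> hermitian_mat n (A + B)"
  by (auto simp: hermitian_mat_def mat_adjoint_add[of _ n n])

lemma hermitian_uminus: "hermitian_mat n A \<Longrightarrow> hermitian_mat n (- A)"
  by (auto simp: hermitian_mat_def mat_adjoint_uminus)

lemma quadratic_form_conj:
  fixes A U :: "complex mat"
  assumes "A \<in> carrier_mat n n" "U \<in> carrier_mat m n" "v \<in> carrier_vec m"
  shows "((U * A * mat_adjoint U) *\<^sub>v v) \<bullet>c v = (A *\<^sub>v (mat_adjoint U *\<^sub>v v)) \<bullet>c (mat_adjoint U *\<^sub>v v)"
proof -
  have w: "mat_adjoint U *\<^sub>v v \<in> carrier_vec n"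
    using assms by (auto intro!: mult_mat_vec_carrier[of _ n m])
  have "(U * A * mat_adjoint U) *\<^sub>v v = U *\<^sub>v (A *\<^sub>v (mat_adjoint U *\<^sub>v v))"
    using assms w by (simp add: assoc_mult_mat_vec[of _ m n _ m] assoc_mult_mat_vec[of _ m n _ n])
  then show ?thesis
    using cscalar_prod_mult_mat_vec[of U m n "A *\<^sub>v (mat_adjoint U *\<^sub>v v)" v] assms w by simp
qed

lemma pos_semidef_conj:
  assumes "pos_semidef n A" "U \<in> carrier_mat m n"
  shows "pos_semidef m (U * A * mat_adjoint U)"
proof -
  have "A \<in> carrier_mat n n" using assms by (auto simp: pos_semidef_def hermitian_mat_def)
  then show ?thesis
    using assms hermitian_conj[of n A U m] unfolding pos_semidef_def
    by (auto simp: quadratic_form_conj mult_mat_vec_carrier[of _ n m])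
qed

text \<open>Injectivity of \<open>mat_adjoint U\<close> keeps the form strict. In this shape the
  rule covers unitary changes of basis, invertible diagonal scalings and the rectangular
  pseudoinverse in the effective covariance.\<close>

lemma pos_def_conj:
  assumes "pos_def n A" "U \<in> carrier_mat m n"
    and "\<And>v. v \<in> carrier_vec m \<Longrightarrow> mat_adjoint U *\<^sub>v v = 0\<^sub>v n \<Longrightarrow> v = 0\<^sub>v m"
  shows "pos_def m (U * A * mat_adjoint U)"
proof -
  have "A \<in> carrier_mat n n" using assms by (auto simp: pos_def_def hermitian_mat_def)
  then show ?thesis
    using assms hermitian_conj[of n A U m] unfolding pos_def_def
    by (metis mat_adjoint_carrier mult_mat_vec_carrier quadratic_form_conj)
qed

lemma pos_semidef_add_pos_def:
  assumes "pos_semidef n A" "pos_def n B"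
  shows "pos_def n (A + B)"
  using assms hermitian_add[of n A B] unfolding pos_def_def pos_semidef_def
  by (auto simp: hermitian_mat_def add_mult_distrib_mat_vec[of _ n n] add_scalar_prod_distrib[of _ n]
      intro!: add_nonneg_pos)

lemma quadratic_form_unit_vec:
  fixes A :: "complex mat"
  assumes "A \<in> carrier_mat n n" "i < n"
  shows "(A *\<^sub>v unit_vec n i) \<bullet>c unit_vec n i = A $$ (i, i)"
proof -
  have "conjugate (unit_vec n i) = (unit_vec n i :: complex vec)"
    by (rule eq_vecI) (auto simp: unit_vec_def)
  then show ?thesis using assms by simp
qed

lemma pos_semidef_diag_nonneg:
  assumes "pos_semidef n A" "i < n"
  shows "0 \<le> Re (A $$ (i, i))"
  using assms quadratic_form_unit_vec[of A n i]
  unfolding pos_semidef_def hermitian_mat_def by (metis unit_vec_carrier)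

lemma pos_def_diag_pos:
  assumes "pos_def n A" "i < n"
  shows "0 < Re (A $$ (i, i))"
  using assms quadratic_form_unit_vec[of A n i]
  unfolding pos_def_def hermitian_mat_def by (metis unit_vec_carrier unit_vec_nonzero)

lemma hermitian_diag_real:
  assumes "hermitian_mat n A" "i < n"
  shows "A $$ (i, i) = of_real (Re (A $$ (i, i)))"
  using hermitian_mat_index[OF assms assms(2)] by (simp add: complex_eq_iff)

lemma hermitian_tr_real:
  assumes "hermitian_mat n A"
  shows "mat_tr A = of_real (\<Sum>i<n. Re (A $$ (i, i)))"
  unfolding mat_tr_def of_real_sum
  by (intro sum.cong) (use assms hermitian_diag_real[OF assms] in \<open>auto simp: hermitian_mat_def\<close>)

lemma hermitian_mat_diag: "hermitian_mat n (mat_diag n (\<lambda>i. complex_of_real (d i)))"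
  by (auto simp: hermitian_mat_def mat_diag_def intro!: eq_matI)

lemma mat_diag_mult_vec:
  fixes d :: "nat \<Rightarrow> complex"
  assumes "v \<in> carrier_vec n"
  shows "mat_diag n d *\<^sub>v v = vec n (\<lambda>i. d i * v $ i)"
  using assms
  by (intro eq_vecI) (auto simp: mat_diag_def scalar_prod_def if_distrib if_distribR sum.delta cong: if_cong)

lemma quadratic_form_mat_diag:
  assumes "v \<in> carrier_vec n"
  shows "Re ((mat_diag n (\<lambda>i. complex_of_real (d i)) *\<^sub>v v) \<bullet>c v) = (\<Sum>i<n. d i * (cmod (v $ i))\<^sup>2)"
  unfolding mat_diag_mult_vec[OF assms]
  using assms by (simp add: scalar_prod_def cmod_power2 lessThan_atLeast0)
    (simp add: power2_eq_square algebra_simps)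

lemma pos_semidef_mat_diag:
  assumes "\<And>i. i < n \<Longrightarrow> 0 \<le> d i"
  shows "pos_semidef n (mat_diag n (\<lambda>i. complex_of_real (d i)))"
  unfolding pos_semidef_def
  by (auto simp: hermitian_mat_diag quadratic_form_mat_diag assms intro!: sum_nonneg)

lemma unitary_conj_cancel:
  fixes A B U V :: "complex mat"
  assumes "U \<in> carrier_mat n n" "V \<in> carrier_mat n n" "V * U = 1\<^sub>m n" "A \<in> carrier_mat n n"
  shows "V * (U * A * V) * U = A"
  using assms
  by (simp add: square_mult_assoc[where n = n] square_mult_carrier[where n = n]
      square_inverse_cancel[OF assms(3)])

lemma det_mat_diag: "det (mat_diag n f) = (\<Prod>i<n. f i :: complex)"
proof -
  have "upper_triangular (mat_diag n f)" by (auto simp: mat_diag_def upper_triangular_def)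
  then have "det (mat_diag n f) = prod_list (diag_mat (mat_diag n f))"
    by (intro det_upper_triangular[of _ n]) auto
  also have "diag_mat (mat_diag n f) = map f [0..<n]" by (auto simp: diag_mat_def mat_diag_def)
  finally show ?thesis by (simp add: prod.list_conv_set_nth lessThan_atLeast0)
qed

lemma det_unitary_conj:
  fixes A U V :: "complex mat"
  assumes "U \<in> carrier_mat n n" "V \<in> carrier_mat n n" "U * V = 1\<^sub>m n" "A \<in> carrier_mat n n"
  shows "det (U * A * V) = det A"
proof -
  have "det U * det V = 1" using det_mult[OF assms(1,2)] assms(3) by simp
  then show ?thesis
    using assms by (simp add: det_mult[of _ n] square_mult_carrier[of _ n])
qed

lemma pos_def_spectral:
  assumes "pos_def n A"
  obtains U d where "U \<in> carrier_mat n n" "mat_adjoint U * U = 1\<^sub>m n" "U * mat_adjoint U = 1\<^sub>m n"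
    "A = U * mat_diag n (\<lambda>i. complex_of_real (d i)) * mat_adjoint U" "\<And>i. i < n \<Longrightarrow> d i > 0"
proof -
  have "hermitian_mat n A" using assms by (simp add: pos_def_def)
  from hermitian_spectral[OF this] obtain U d where U: "U \<in> carrier_mat n n" "mat_adjoint U * U = 1\<^sub>m n"
    "U * mat_adjoint U = 1\<^sub>m n" and A: "A = U * mat_diag n (\<lambda>i. complex_of_real (d i)) * mat_adjoint U" .
  have "mat_adjoint U * A * U = mat_diag n (\<lambda>i. complex_of_real (d i))"
    unfolding A using U by (intro unitary_conj_cancel) auto
  moreover have "pos_def n (mat_adjoint U * A * mat_adjoint (mat_adjoint U))"
  proof (rule pos_def_conj[OF assms])
    fix v assume v: "v \<in> carrier_vec n" "mat_adjoint (mat_adjoint U) *\<^sub>v v = 0\<^sub>v n"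
    then have "mat_adjoint U *\<^sub>v (U *\<^sub>v v) = 0\<^sub>v n" using U by auto
    then show "v = 0\<^sub>v n" using U v by (simp flip: assoc_mult_mat_vec[of _ n n _ n])
  qed (use U in auto)
  ultimately have pd: "pos_def n (mat_diag n (\<lambda>i. complex_of_real (d i)))" by simp
  have "d i > 0" if "i < n" for i
    using pos_def_diag_pos[OF pd that] that by (simp add: mat_diag_def)
  then show ?thesis using that U A by blast
qed

lemma pos_def_det:
  assumes "pos_def n A"
  shows "Im (det A) = 0" "Re (det A) > 0"
proof -
  obtain U d where U: "U \<in> carrier_mat n n" "U * mat_adjoint U = 1\<^sub>m n"
    and A: "A = U * mat_diag n (\<lambda>i. complex_of_real (d i)) * mat_adjoint U" and d: "\<And>i. i < n \<Longrightarrow> d i > 0"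
    using pos_def_spectral[OF assms] by metis
  have "det A = (\<Prod>i<n. complex_of_real (d i))"
    unfolding A using U by (simp add: det_unitary_conj[of _ n] det_mat_diag)
  then have "det A = of_real (\<Prod>i<n. d i)" unfolding of_real_prod .
  moreover have "(\<Prod>i<n. d i) > 0" by (rule prod_pos) (use d in auto)
  ultimately show "Im (det A) = 0" "Re (det A) > 0" by (simp_all del: of_real_prod)
qed

text \<open>\<open>ln \<lambda> \<le> \<lambda> - 1\<close> applied to the eigenvalues.\<close>

lemma pos_def_det_le_1:
  assumes E: "pos_def n E" and tr: "(\<Sum>i<n. Re (E $$ (i, i))) \<le> n"
  shows "Re (det E) \<le> 1" "Re (det E) = 1 \<Longrightarrow> E = 1\<^sub>m n"
proof -
  obtain U d where U: "U \<in> carrier_mat n n" "mat_adjoint U * U = 1\<^sub>m n" "U * mat_adjoint U = 1\<^sub>m n"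
    and A: "E = U * mat_diag n (\<lambda>i. complex_of_real (d i)) * mat_adjoint U" and d: "\<And>i. i < n \<Longrightarrow> d i > 0"
    using pos_def_spectral[OF E] by metis
  have "det E = (\<Prod>i<n. complex_of_real (d i))"
    unfolding A using U by (simp add: det_unitary_conj[of _ n] det_mat_diag)
  then have det: "Re (det E) = (\<Prod>i<n. d i)" by (metis Re_complex_of_real of_real_prod)
  have "mat_tr E = mat_tr (mat_diag n (\<lambda>i. complex_of_real (d i)))"
    unfolding A using U by (intro mat_tr_unitary_conj[of _ n]) auto
  also have "\<dots> = of_real (\<Sum>i<n. d i)" by (simp add: mat_tr_def mat_diag_def)
  also have "mat_tr E = of_real (\<Sum>i<n. Re (E $$ (i, i)))"
    using E by (intro hermitian_tr_real) (simp add: pos_def_def)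
  finally have sum: "(\<Sum>i<n. d i) \<le> n" using tr of_real_eq_iff by metis
  have pos: "(\<Prod>i<n. d i) > 0" by (rule prod_pos) (use d in auto)
  have lnp: "ln (\<Prod>i<n. d i) = (\<Sum>i<n. ln (d i))" by (rule ln_prod) (use d in \<open>force+\<close>)
  have le: "(\<Sum>i<n. ln (d i)) \<le> (\<Sum>i<n. d i - 1)"
    by (intro sum_mono ln_le_minus_one) (use d in auto)
  also have le0: "\<dots> \<le> 0" using sum by (simp add: sum_subtractf)
  finally have "ln (\<Prod>i<n. d i) \<le> 0" using lnp by simp
  then show "Re (det E) \<le> 1" unfolding det using pos by simp
  assume "Re (det E) = 1"
  then have ln0: "(\<Sum>i<n. ln (d i)) = 0" using lnp det by simp
  \<comment> \<open>Equality case: \<open>0 = \<Sum> ln d \<le> \<Sum> (d - 1) \<le> 0\<close>, so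
    the nonnegative gaps \<open>d - 1 - ln d\<close> all vanish, which happens only at
    \<open>d = 1\<close>.\<close>
  have "(\<Sum>i<n. d i - 1 - ln (d i)) = 0"
    using le le0 ln0 unfolding sum_subtractf[of _ "\<lambda>i. ln (d i)"] by linarith
  then have "\<forall>i\<in>{..<n}. d i - 1 - ln (d i) = 0"
    by (subst (asm) sum_nonneg_eq_0_iff) (use d ln_le_minus_one in auto)
  then have "d i = 1" if "i < n" for i
    using ln_eq_minus_one[of "d i"] d that by force
  then have "mat_diag n (\<lambda>i. complex_of_real (d i)) = 1\<^sub>m n"
    by (intro eq_matI) (auto simp: mat_diag_def)
  then show "E = 1\<^sub>m n" unfolding A using U by simp
qed

text \<open>The strategy set with dimension and power as plain parameters, which keeps the
  projection theory free of channels; \<open>strategy_set_eq\<close> makes the link.\<close>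

definition cov_set :: "nat \<Rightarrow> real \<Rightarrow> complex mat set" where
  "cov_set n p = {X. pos_semidef n X \<and> mat_tr X = complex_of_real p}"

lemma cov_set_carrier: "X \<in> cov_set n p \<Longrightarrow> X \<in> carrier_mat n n"
  by (simp add: cov_set_def pos_semidef_def hermitian_mat_def)

lemma water_level_exists:
  fixes a :: "nat \<Rightarrow> real"
  assumes "n > 0" "p > 0"
  obtains \<mu> where "(\<Sum>i<n. max 0 (\<mu> + a i)) = p"
proof -
  define B where "B = (\<Sum>i<n. \<bar>a i\<bar>)"
  have B: "\<bar>a i\<bar> \<le> B" if "i < n" for i
    unfolding B_def by (rule member_le_sum) (use that in auto)
  then have "B \<ge> 0" using assms(1) by force
  \<comment> \<open>At level \<open>- B\<close> every term is 0, and at level \<open>p + B\<close>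
    the term of index 0 alone reaches \<open>p\<close>.\<close>
  have "\<exists>\<mu>\<ge>-B. \<mu> \<le> p + B \<and> (\<Sum>i<n. max 0 (\<mu> + a i)) = p"
  proof (rule IVT')
    have "(\<Sum>i<n. max 0 (- B + a i)) = 0" by (intro sum.neutral) (use B in force)
    then show "(\<Sum>i<n. max 0 (- B + a i)) \<le> p" using assms by simp
    have "p \<le> max 0 (p + B + a 0)" using B[OF assms(1)] by auto
    also have "\<dots> \<le> (\<Sum>i<n. max 0 (p + B + a i))"
      using assms(1) by (intro member_le_sum[of 0 _ "\<lambda>i. max 0 (p + B + a i)"]) auto
    finally show "p \<le> (\<Sum>i<n. max 0 (p + B + a i))" .
  qed (use \<open>B \<ge> 0\<close> assms in \<open>auto intro!: continuous_intros\<close>)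
  then show ?thesis using that by blast
qed

section \<open>Water-filling\<close>

lemma mult_mat_zero_vec:
  fixes A :: "complex mat"
  assumes "A \<in> carrier_mat n m"
  shows "A *\<^sub>v 0\<^sub>v m = 0\<^sub>v n"
  using assms by (intro eq_vecI) (auto simp: scalar_prod_def)

lemma cov_set_unitary_conj:
  assumes "W \<in> cov_set n p" "U \<in> carrier_mat n n" "mat_adjoint U * U = 1\<^sub>m n"
  shows "U * W * mat_adjoint U \<in> cov_set n p"
proof -
  have "mat_tr (U * W * mat_adjoint U) = mat_tr W"
    using mat_tr_unitary_conj[of "mat_adjoint U" n W U] assms cov_set_carrier[OF assms(1)] by auto
  then show ?thesis
    using assms pos_semidef_conj[of n W U n] by (simp add: cov_set_def)
qed

lemma frob_inner_unitary_conj: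
  assumes "U \<in> carrier_mat n n" "mat_adjoint U * U = 1\<^sub>m n" "A \<in> carrier_mat n n" "B \<in> carrier_mat n n"
  shows "frob_inner (U * A * mat_adjoint U) (U * B * mat_adjoint U) = frob_inner A B"
proof -
  have "(U * A * mat_adjoint U) * mat_adjoint (U * B * mat_adjoint U) = U * (A * mat_adjoint B) * mat_adjoint U"
    using assms
    by (simp add: mat_adjoint_mult[of _ n n _ n] square_mult_assoc[where n = n]
        square_mult_carrier[where n = n] square_inverse_cancel[OF assms(2)])
  moreover have "mat_tr (U * (A * mat_adjoint B) * mat_adjoint U) = mat_tr (A * mat_adjoint B)"
    using mat_tr_unitary_conj[of "mat_adjoint U" n "A * mat_adjoint B" U] assms
    by (auto simp: square_mult_carrier[where n = n])
  ultimately show ?thesis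
    using assms by (simp add: frob_inner_eq_tr[of _ n n] square_mult_carrier[where n = n])
qed

lemma frob_inner_mat_diag_left:
  assumes "B \<in> carrier_mat n n"
  shows "frob_inner (mat_diag n (\<lambda>i. complex_of_real (d i))) B = (\<Sum>i<n. d i * Re (B $$ (i, i)))"
proof -
  have "frob_inner (mat_diag n (\<lambda>i. complex_of_real (d i))) B
      = (\<Sum>i<n. \<Sum>j<n. if i = j then d i * Re (B $$ (i, i)) else 0)"
    unfolding frob_inner_def using assms by (intro sum.cong refl) (auto simp: mat_diag_def)
  then show ?thesis by simp
qed

text \<open>
  With \<open>A = U diag(a) U\<^sup>H\<close> the water-filling solution is \<open>Z = U diag(max(0, \<mu> + a)) U\<^sup>H\<close>. In the
  eigenbasis of \<open>A\<close> only the diagonals of the competing matrices enter the two optimality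
  conditions, the second of which is reduced to \<open>pos_def_det_le_1\<close> by normalising \<open>Z - A\<close>
  to the identity.
\<close>

theorem water_filling:
  assumes A: "hermitian_mat n A" and n: "n > 0" and p: "p > 0"
  obtains Z where "Z \<in> cov_set n p"
    and "\<And>W. W \<in> cov_set n p \<Longrightarrow> 0 \<le> frob_inner (Z - A) (W - Z)"
    and "\<And>W. W \<in> cov_set n p \<Longrightarrow> pos_def n (- A) \<Longrightarrow> Re (det (W - A)) \<le> Re (det (Z - A))"
    and "\<And>W. W \<in> cov_set n p \<Longrightarrow> pos_def n (- A) \<Longrightarrow> Re (det (W - A)) = Re (det (Z - A)) \<Longrightarrow> W = Z"
proof -
  obtain U a where U: "U \<in> carrier_mat n n" and U1: "mat_adjoint U * U = 1\<^sub>m n" and U2: "U * mat_adjoint U = 1\<^sub>m n"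
    and Aeq: "A = U * mat_diag n (\<lambda>i. complex_of_real (a i)) * mat_adjoint U"
    using hermitian_spectral[OF A] .
  obtain \<mu> where \<mu>: "(\<Sum>i<n. max 0 (\<mu> + a i)) = p" using water_level_exists[OF n p] .
  let ?D = "\<lambda>d. mat_diag n (\<lambda>i. complex_of_real (d i))"
  define z where "z = (\<lambda>i. max 0 (\<mu> + a i))"
  define y where "y = (\<lambda>i. z i - a i)"
  have z: "z i \<ge> 0" for i by (simp add: z_def)
  have sz: "(\<Sum>i<n. z i) = p" using \<mu> by (simp add: z_def)
  \<comment> \<open>The optimality conditions for the eigenvalues \<open>y\<close> of
    \<open>Z - A\<close>, with \<open>\<mu>\<close> as multiplier of the trace constraint: the
    multiplier is a lower bound, attained wherever power is allocated. The fact \<open>slack\<close>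
    below is the complementary slackness form.\<close>
  have y: "y i \<ge> \<mu>" "z i > 0 \<Longrightarrow> y i = \<mu>" for i by (auto simp: y_def z_def)
  have DC: "?D d \<in> carrier_mat n n" for d by simp
  have DC_minus: "X - ?D d \<in> carrier_mat n n" for X d using DC by (rule minus_carrier_mat)
  have UH: "mat_adjoint U \<in> carrier_mat n n" using U by simp
  note assoc = square_mult_assoc[where n = n] and closed = square_mult_carrier[where n = n]
  have distr: "U * (X - Y) * mat_adjoint U = U * X * mat_adjoint U - U * Y * mat_adjoint U"
    if "X \<in> carrier_mat n n" "Y \<in> carrier_mat n n" for X Y
    using that U UH by (simp add: mult_minus_distrib_mat[of _ n n _ n] minus_mult_distrib_mat[of _ n n _ _ n] closed)
  define Z where "Z = U * ?D z * mat_adjoint U"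
  have "mat_tr (?D z) = p" using sz by (simp add: mat_tr_def mat_diag_def flip: of_real_sum)
  then have dz: "?D z \<in> cov_set n p" using z by (simp add: cov_set_def pos_semidef_mat_diag)
  have ZS: "Z \<in> cov_set n p" unfolding Z_def by (rule cov_set_unitary_conj[OF dz U U1])
  have "?D z - ?D a = ?D y" by (rule eq_matI) (auto simp: mat_diag_def y_def)
  then have ZA: "Z - A = U * ?D y * mat_adjoint U"
    unfolding Z_def Aeq using distr[OF DC DC, of z a] by simp
  have red: "\<exists>W'. W' \<in> cov_set n p \<and> W = U * W' * mat_adjoint U" if W: "W \<in> cov_set n p" for W
  proof -
    have Wc: "W \<in> carrier_mat n n" by (rule cov_set_carrier[OF W])
    have "mat_adjoint U * W * U \<in> cov_set n p"
      using cov_set_unitary_conj[OF W UH] U2 by simp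
    moreover have "W = U * (mat_adjoint U * W * U) * mat_adjoint U"
      using unitary_conj_cancel[OF UH U U2 Wc] by simp
    ultimately show ?thesis by blast
  qed
  have cov_diag: "Re (W $$ (i, i)) \<ge> 0" if "W \<in> cov_set n p" "i < n" for W i
    using that by (intro pos_semidef_diag_nonneg[of n]) (simp_all add: cov_set_def)
  have cov_sum: "(\<Sum>i<n. Re (W $$ (i, i))) = p" if "W \<in> cov_set n p" for W
    using that cov_set_carrier[OF that] by (simp add: cov_set_def mat_tr_def del: Re_sum flip: Re_sum)
  have slack: "(y i - \<mu>) * z i = 0" for i using y(2)[of i] z[of i] by (cases "z i = 0") auto
  show ?thesis
  proof
    show "Z \<in> cov_set n p" by (rule ZS)
  next
    fix W assume "W \<in> cov_set n p"
    then obtain W' where W': "W' \<in> cov_set n p" and W: "W = U * W' * mat_adjoint U" using red by blast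
    have cW': "W' \<in> carrier_mat n n" by (rule cov_set_carrier[OF W'])
    have WZ: "W - Z = U * (W' - ?D z) * mat_adjoint U"
      unfolding W Z_def using distr[OF cW' DC] by simp
    have "frob_inner (Z - A) (W - Z) = frob_inner (?D y) (W' - ?D z)"
      unfolding ZA WZ by (rule frob_inner_unitary_conj[OF U U1 DC DC_minus])
    also have "\<dots> = (\<Sum>i<n. y i * (Re (W' $$ (i, i)) - z i))"
      unfolding frob_inner_mat_diag_left[OF DC_minus] using cW' by (simp add: mat_diag_def)
    \<comment> \<open>Splitting off the constant \<open>\<mu>\<close> isolates three parts: the last
      is 0 because both traces equal \<open>p\<close>, the middle one by complementary slackness,
      and the first has nonnegative terms.\<close>
    also have "\<dots> = (\<Sum>i<n. (y i - \<mu>) * Re (W' $$ (i, i))) - (\<Sum>i<n. (y i - \<mu>) * z i)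
        + \<mu> * ((\<Sum>i<n. Re (W' $$ (i, i))) - (\<Sum>i<n. z i))"
      by (simp add: sum_distrib_left sum_subtractf[symmetric] sum.distrib[symmetric] algebra_simps)
    also have "\<dots> = (\<Sum>i<n. (y i - \<mu>) * Re (W' $$ (i, i)))"
      unfolding cov_sum[OF W'] sz using slack by simp
    also have "\<dots> \<ge> 0" using y(1) cov_diag[OF W'] by (intro sum_nonneg) simp
    finally show "0 \<le> frob_inner (Z - A) (W - Z)" .
  next
    have main: "Re (det (W - A)) \<le> Re (det (Z - A)) \<and> (Re (det (W - A)) = Re (det (Z - A)) \<longrightarrow> W = Z)"
      if WS: "W \<in> cov_set n p" and pd: "pos_def n (- A)" for W
    proof -
      obtain W' where W': "W' \<in> cov_set n p" and W: "W = U * W' * mat_adjoint U" using red[OF WS] by blast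
      have cW': "W' \<in> carrier_mat n n" by (rule cov_set_carrier[OF W'])
      have cA: "A \<in> carrier_mat n n" using A by (simp add: hermitian_mat_def)
      have cW: "W \<in> carrier_mat n n" by (rule cov_set_carrier[OF WS])
      have "- A = U * ?D (\<lambda>i. - a i) * mat_adjoint U"
      proof -
        have "?D (\<lambda>i. - a i) = 0\<^sub>m n n - ?D a" by (rule eq_matI) (auto simp: mat_diag_def)
        moreover have "- A = 0\<^sub>m n n - A" using cA by (intro eq_matI) auto
        ultimately show ?thesis
          using distr[OF zero_carrier_mat DC, of a] U UH unfolding Aeq by simp
      qed
      then have "mat_adjoint U * (- A) * U = ?D (\<lambda>i. - a i)"
        by (simp only: unitary_conj_cancel[OF U UH U1 DC])
      moreover have "pos_def n (mat_adjoint U * (- A) * mat_adjoint (mat_adjoint U))"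
      proof (rule pos_def_conj[OF pd UH])
        fix v :: "complex vec" assume "v \<in> carrier_vec n" "mat_adjoint (mat_adjoint U) *\<^sub>v v = 0\<^sub>v n"
        then have v: "v \<in> carrier_vec n" "U *\<^sub>v v = 0\<^sub>v n" by auto
        have "v = (mat_adjoint U * U) *\<^sub>v v" unfolding U1 using v by simp
        also have "\<dots> = mat_adjoint U *\<^sub>v 0\<^sub>v n" using assoc_mult_mat_vec[OF UH U v(1)] v by simp
        also have "\<dots> = 0\<^sub>v n" using UH by (rule mult_mat_zero_vec)
        finally show "v = 0\<^sub>v n" .
      qed
      ultimately have pda: "pos_def n (?D (\<lambda>i. - a i))" by (simp only: mat_adjoint_adjoint)
      have y_pos: "y i > 0" if "i < n" for i
        using pos_def_diag_pos[OF pda that] z[of i] that by (simp add: mat_diag_def y_def)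
      \<comment> \<open>Since \<open>p > 0\<close>, some \<open>z i\<close> is positive, and there
        \<open>\<mu>\<close> equals \<open>y i\<close>, which is positive because \<open>- A\<close>
        is positive definite.\<close>
      have \<mu>_pos: "\<mu> > 0"
      proof -
        obtain i where "i < n" "z i > 0"
          using sz p z by (metis lessThan_iff less_le sum_nonpos not_le)
        then show ?thesis using y(2) y_pos by metis
      qed
      \<comment> \<open>The diagonal of \<open>(Z - A)\<^sup>-\<^sup>1\<^sup>/\<^sup>2\<close> in
        the eigenbasis. Thus \<open>E\<close> is \<open>W - A\<close> normalised by
        \<open>Z - A\<close>, its determinant is the quotient of the two determinants, and
        \<open>E = 1\<close> means \<open>W = Z\<close>.\<close>
      define t where "t = (\<lambda>i. 1 / sqrt (y i))"
      have tt: "t i * t i = 1 / y i" if "i < n" for i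
        using y_pos[OF that] by (simp add: t_def)
      define E where "E = ?D t * (W' - ?D a) * ?D t"
      have cE: "E \<in> carrier_mat n n" by (simp add: E_def closed DC_minus)
      have Eij: "E $$ (i, j) = t i * (W' - ?D a) $$ (i, j) * t j" if "i < n" "j < n" for i j
      proof -
        have "?D t * (W' - ?D a) \<in> carrier_mat n n" by (intro closed DC DC_minus)
        then show ?thesis unfolding E_def using that cW'
          by (simp add: mat_diag_mult_right[of _ n n] mat_diag_mult_left[OF DC_minus])
      qed
      have adjD: "mat_adjoint (?D t) = ?D t" using hermitian_mat_diag by (simp add: hermitian_mat_def)
      have "W' - ?D a = W' + ?D (\<lambda>i. - a i)"
        using cW' by (intro eq_matI) (auto simp: mat_diag_def)
      moreover have "pos_def n (W' + ?D (\<lambda>i. - a i))"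
        using W' pda by (intro pos_semidef_add_pos_def) (auto simp: cov_set_def)
      ultimately have pdW: "pos_def n (W' - ?D a)" by simp
      have "pos_def n (?D t * (W' - ?D a) * mat_adjoint (?D t))"
      proof (rule pos_def_conj[OF pdW])
        fix v :: "complex vec" assume v: "v \<in> carrier_vec n" "mat_adjoint (?D t) *\<^sub>v v = 0\<^sub>v n"
        have "complex_of_real (t i) * v $ i = 0" if "i < n" for i
          using arg_cong[OF v(2), of "\<lambda>x. x $ i"] that unfolding adjD mat_diag_mult_vec[OF v(1)] by simp
        then show "v = 0\<^sub>v n" using v(1) y_pos by (intro eq_vecI) (force simp: t_def)+
      qed simp
      then have pdE: "pos_def n E" unfolding E_def adjD .
      have "(\<Sum>i<n. Re (E $$ (i, i))) = (\<Sum>i<n. 1 + (Re (W' $$ (i, i)) / y i - z i / y i))"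
      proof (rule sum.cong[OF refl])
        fix i assume "i \<in> {..<n}"
        then have i: "i < n" by simp
        have "E $$ (i, i) = of_real (t i * t i) * (W' $$ (i, i) - a i)"
          using Eij[OF i i] i cW' by (simp add: mat_diag_def)
        then have "Re (E $$ (i, i)) = (Re (W' $$ (i, i)) - a i) / y i"
          unfolding tt[OF i] by simp
        also have "\<dots> = 1 + (Re (W' $$ (i, i)) / y i - z i / y i)"
          using y_pos[OF i] by (simp add: y_def divide_simps)
        finally show "Re (E $$ (i, i)) = 1 + (Re (W' $$ (i, i)) / y i - z i / y i)" .
      qed
      \<comment> \<open>Replacing \<open>y i\<close> by the smaller \<open>\<mu>\<close> enlarges
        the term of \<open>W'\<close>, whose diagonal is nonnegative, and leaves the term of
        \<open>z\<close> unchanged, as \<open>y i = \<mu>\<close> unless \<open>z i = 0\<close>.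
        With a common denominator the two traces cancel.\<close>
      also have "\<dots> \<le> (\<Sum>i<n. 1 + (Re (W' $$ (i, i)) / \<mu> - z i / \<mu>))"
      proof (rule sum_mono)
        fix i assume "i \<in> {..<n}"
        then have i: "i < n" by simp
        have "Re (W' $$ (i, i)) / y i \<le> Re (W' $$ (i, i)) / \<mu>"
          using y(1)[of i] \<mu>_pos cov_diag[OF W' i] by (intro divide_left_mono) auto
        moreover have "z i / y i = z i / \<mu>" using y(2)[of i] z[of i] by (cases "z i = 0") auto
        ultimately show "1 + (Re (W' $$ (i, i)) / y i - z i / y i) \<le> 1 + (Re (W' $$ (i, i)) / \<mu> - z i / \<mu>)"
          by linarith
      qed
      also have "\<dots> = n"
        by (simp add: sum.distrib sum_subtractf sum_divide_distrib[symmetric] cov_sum[OF W'] sz)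
      finally have trE: "(\<Sum>i<n. Re (E $$ (i, i))) \<le> n" .
      have WA: "W - A = U * (W' - ?D a) * mat_adjoint U"
        unfolding W Aeq using distr[OF cW' DC] by simp
      have detW: "det (W - A) = det (W' - ?D a)"
        unfolding WA by (rule det_unitary_conj[OF U UH U2 DC_minus])
      have detZ: "det (Z - A) = of_real (\<Prod>i<n. y i)"
        unfolding ZA using U UH U2 det_unitary_conj[of U n "mat_adjoint U" "?D y"] by (simp add: det_mat_diag)
      have py: "(\<Prod>i<n. y i) > 0" by (rule prod_pos) (use y_pos in auto)
      have "det E = det (?D t) * det (W' - ?D a) * det (?D t)"
        unfolding E_def by (simp only: det_mult[OF DC DC_minus] det_mult[OF square_mult_carrier[OF DC DC_minus] DC])
      also have "\<dots> = of_real (\<Prod>i<n. t i * t i) * det (W - A)"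
        by (simp add: det_mat_diag detW prod.distrib)
      also have "(\<Prod>i<n. t i * t i) = (\<Prod>i<n. 1 / y i)" by (rule prod.cong) (auto simp: tt)
      also have "\<dots> = 1 / (\<Prod>i<n. y i)" by (simp add: prod_dividef)
      finally have "Re (det E) = Re (det (W - A)) / (\<Prod>i<n. y i)"
        by (simp del: of_real_divide of_real_prod)
      then have detE: "Re (det (W - A)) = Re (det E) * Re (det (Z - A))" and dZ: "Re (det (Z - A)) > 0"
        using less_imp_neq[OF py] py unfolding detZ Re_complex_of_real by simp_all
      have "W = Z" if "Re (det E) = 1"
      proof -
        have E1: "E = 1\<^sub>m n" by (rule pos_def_det_le_1(2)[OF pdE trE that])
        have "W' = ?D z"
        proof (rule eq_matI)
          fix i j assume "i < dim_row (?D z)" "j < dim_col (?D z)"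
          then have ij: "i < n" "j < n" by (auto simp: mat_diag_def)
          have ne: "complex_of_real (y i) \<noteq> 0" "t i \<noteq> 0" "t j \<noteq> 0"
            using y_pos[OF ij(1)] y_pos[OF ij(2)] by (auto simp: t_def)
          show "W' $$ (i, j) = ?D z $$ (i, j)"
          proof (cases "i = j")
            case True
            have "of_real (t i * t i) * (W' - ?D a) $$ (i, i) = 1"
              using Eij[OF ij(1,1)] ij unfolding E1 by (simp add: mult_ac)
            then have "(W' - ?D a) $$ (i, i) = of_real (y i)"
              unfolding tt[OF ij(1)] using ne by (simp add: field_simps)
            then show ?thesis using True ij cW' by (simp add: mat_diag_def y_def)
          next
            case False
            have "(W' - ?D a) $$ (i, j) = 0"
              using Eij[OF ij] ij ne False unfolding E1 by simp
            then show ?thesis using False ij cW' by (simp add: mat_diag_def)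
          qed
        qed (use cW' in \<open>auto simp: mat_diag_def\<close>)
        then show ?thesis unfolding W Z_def by simp
      qed
      then show ?thesis
        using detE dZ pos_def_det_le_1(1)[OF pdE trE]
        by (auto simp: mult_le_cancel_right1)
    qed
    fix W assume "W \<in> cov_set n p" "pos_def n (- A)"
    from main[OF this] show "Re (det (W - A)) \<le> Re (det (Z - A))"
      "Re (det (W - A)) = Re (det (Z - A)) \<Longrightarrow> W = Z" by auto
  qed
qed

section \<open>Frobenius projection and operator norms\<close>

lemma frob_norm_square_add:
  assumes A: "A \<in> carrier_mat n m" and B: "B \<in> carrier_mat n m"
  shows "(frob_norm (A + B))\<^sup>2 = (frob_norm A)\<^sup>2 + 2 * frob_inner A B + (frob_norm B)\<^sup>2"
proof -
  have S: "A + B \<in> carrier_mat n m" using A B by simp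
  show ?thesis
    unfolding frob_norm_square frob_inner_add_left[OF A B] frob_inner_commute[OF A S] frob_inner_commute[OF B S]
    using frob_inner_commute[OF A B] by simp
qed

lemma frob_norm_square_diff:
  assumes A: "A \<in> carrier_mat n m" and B: "B \<in> carrier_mat n m"
  shows "(frob_norm (A - B))\<^sup>2 = (frob_norm A)\<^sup>2 - 2 * frob_inner A B + (frob_norm B)\<^sup>2"
proof -
  have S: "A - B \<in> carrier_mat n m" using B by (rule minus_carrier_mat)
  show ?thesis
    unfolding frob_norm_square frob_inner_diff_left[OF A B] frob_inner_commute[OF A S] frob_inner_commute[OF B S]
    using frob_inner_commute[OF A B] by simp
qed

lemma cscalar_prod_commute:
  fixes v w :: "complex vec"
  assumes "v \<in> carrier_vec n" "w \<in> carrier_vec n"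
  shows "cnj (v \<bullet>c w) = w \<bullet>c v"
  using assms by (simp add: scalar_prod_def mult.commute)

lemma cscalar_prod_diff_diff:
  fixes v w :: "complex vec"
  assumes "v \<in> carrier_vec n" "w \<in> carrier_vec n"
  shows "(v - w) \<bullet>c (v - w) = v \<bullet>c v - v \<bullet>c w - (w \<bullet>c v - w \<bullet>c w)"
  using assms by (simp add: scalar_prod_def sum_subtractf[symmetric] algebra_simps)

text \<open>The variational inequality yields \<open>\<parallel>W - A\<parallel>\<^sup>2 \<ge>
  \<parallel>Z - A\<parallel>\<^sup>2 + \<parallel>W - Z\<parallel>\<^sup>2\<close>, hence that
  \<open>Z\<close> is a minimiser and the only one. Uniqueness matters because
  \<open>arg_min_on\<close> merely chooses some minimiser.\<close>

lemma frob_proj_eqI: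
  assumes K: "K \<subseteq> carrier_mat n m" and A: "A \<in> carrier_mat n m" and Z: "Z \<in> K"
    and vi: "\<And>W. W \<in> K \<Longrightarrow> 0 \<le> frob_inner (Z - A) (W - Z)"
  shows "frob_proj K A = Z"
proof -
  have Zc: "Z \<in> carrier_mat n m" using K Z by auto
  have sq: "(frob_norm (W - A))\<^sup>2 \<ge> (frob_norm (Z - A))\<^sup>2 + (frob_norm (W - Z))\<^sup>2" if W: "W \<in> K" for W
  proof -
    have Wc: "W \<in> carrier_mat n m" using K W by auto
    have "W - A = (Z - A) + (W - Z)" using A Zc Wc by (intro eq_matI) auto
    moreover have "Z - A \<in> carrier_mat n m" "W - Z \<in> carrier_mat n m"
      using A Zc by (auto intro: minus_carrier_mat)
    ultimately show ?thesis using vi[OF W] frob_norm_square_add by simp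
  qed
  have "is_arg_min (\<lambda>W. frob_norm (W - A)) (\<lambda>W. W \<in> K) Z"
    unfolding is_arg_min_def
  proof (intro conjI notI, rule Z, elim exE conjE)
    fix W assume "W \<in> K" "frob_norm (W - A) < frob_norm (Z - A)"
    then show False using sq[of W] power_strict_mono[of "frob_norm (W - A)" "frob_norm (Z - A)" 2]
      by (simp add: sum_power2_gt_zero_iff) (smt (verit) zero_le_power2)
  qed
  moreover have "W = Z" if "is_arg_min (\<lambda>W. frob_norm (W - A)) (\<lambda>W. W \<in> K) W" for W
  proof -
    have W: "W \<in> K" "frob_norm (W - A) \<le> frob_norm (Z - A)"
      using that Z unfolding is_arg_min_def by force+
    then have "(frob_norm (W - Z))\<^sup>2 \<le> 0"
      using sq[OF W(1)] power_mono[OF W(2) frob_norm_nonneg, of 2] by linarith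
    then have "W - Z = 0\<^sub>m n m" using W K Zc by (intro frob_norm_eq_0) auto
    then have "(W - Z) $$ (i, j) = 0" if "i < n" "j < m" for i j using that by simp
    then show "W = Z" using W(1) K Zc by (intro eq_matI) force+
  qed
  ultimately show ?thesis
    unfolding frob_proj_def arg_min_on_def arg_min_def by (rule some_equality)
qed

text \<open>Here projection and determinant maximisation meet: the water-filling matrix satisfies
  both optimality conditions, and the first one identifies it with the projection. In the game
  \<open>A\<close> is minus the effective covariance, so \<open>W - A\<close> is the sum of
  \<open>W\<close> and that covariance.\<close>

lemma frob_proj_cov_set:
  assumes "hermitian_mat n A" "n > 0" "p > 0"
  shows "frob_proj (cov_set n p) A \<in> cov_set n p"
    and "W \<in> cov_set n p \<Longrightarrow> 0 \<le> frob_inner (frob_proj (cov_set n p) A - A) (W - frob_proj (cov_set n p) A)"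
    and "W \<in> cov_set n p \<Longrightarrow> pos_def n (- A) \<Longrightarrow>
      Re (det (W - A)) \<le> Re (det (frob_proj (cov_set n p) A - A))"
    and "W \<in> cov_set n p \<Longrightarrow> pos_def n (- A) \<Longrightarrow>
      Re (det (W - A)) = Re (det (frob_proj (cov_set n p) A - A)) \<Longrightarrow> W = frob_proj (cov_set n p) A"
proof -
  obtain Z where Z: "Z \<in> cov_set n p"
    and vi: "\<And>W. W \<in> cov_set n p \<Longrightarrow> 0 \<le> frob_inner (Z - A) (W - Z)"
    and rest: "\<And>W. W \<in> cov_set n p \<Longrightarrow> pos_def n (- A) \<Longrightarrow> Re (det (W - A)) \<le> Re (det (Z - A))"
      "\<And>W. W \<in> cov_set n p \<Longrightarrow> pos_def n (- A) \<Longrightarrow> Re (det (W - A)) = Re (det (Z - A)) \<Longrightarrow> W = Z"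
    using water_filling[OF assms] by blast
  have eq: "frob_proj (cov_set n p) A = Z"
    using assms(1) Z vi by (intro frob_proj_eqI[of _ n n]) (auto simp: cov_set_carrier hermitian_mat_def)
  show "frob_proj (cov_set n p) A \<in> cov_set n p"
    "W \<in> cov_set n p \<Longrightarrow> 0 \<le> frob_inner (frob_proj (cov_set n p) A - A) (W - frob_proj (cov_set n p) A)"
    "W \<in> cov_set n p \<Longrightarrow> pos_def n (- A) \<Longrightarrow> Re (det (W - A)) \<le> Re (det (frob_proj (cov_set n p) A - A))"
    "W \<in> cov_set n p \<Longrightarrow> pos_def n (- A) \<Longrightarrow>
      Re (det (W - A)) = Re (det (frob_proj (cov_set n p) A - A)) \<Longrightarrow> W = frob_proj (cov_set n p) A"
    unfolding eq using Z vi rest by blast+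
qed

lemma frob_proj_self:
  assumes "A \<in> cov_set n p"
  shows "frob_proj (cov_set n p) A = A"
proof (rule frob_proj_eqI[of _ n n])
  fix W assume "W \<in> cov_set n p"
  show "0 \<le> frob_inner (A - A) (W - A)"
    using cov_set_carrier[OF assms] by (simp add: frob_inner_def)
qed (use assms cov_set_carrier in auto)

lemma frob_proj_nonexpansive:
  assumes A: "hermitian_mat n A" and B: "hermitian_mat n B" and np: "n > 0" "p > 0"
  shows "frob_norm (frob_proj (cov_set n p) A - frob_proj (cov_set n p) B) \<le> frob_norm (A - B)"
proof -
  define X where "X = frob_proj (cov_set n p) A"
  define Y where "Y = frob_proj (cov_set n p) B"
  have XY: "X \<in> cov_set n p" "Y \<in> cov_set n p"
    unfolding X_def Y_def using frob_proj_cov_set(1) A B np by auto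
  have "0 \<le> frob_inner (X - A) (Y - X)" "0 \<le> frob_inner (Y - B) (X - Y)"
    using frob_proj_cov_set(2)[OF A np] frob_proj_cov_set(2)[OF B np] XY unfolding X_def Y_def by auto
  moreover have c: "X \<in> carrier_mat n n" "Y \<in> carrier_mat n n" "A \<in> carrier_mat n n" "B \<in> carrier_mat n n"
    using XY cov_set_carrier A B by (auto simp: hermitian_mat_def)
  ultimately have "(frob_norm (X - Y))\<^sup>2 \<le> frob_inner (A - B) (X - Y)"
    by (simp add: frob_norm_square frob_inner_diff_left[of _ n n] frob_inner_diff_right[of _ n n])
  \<comment> \<open>Takes the place of the Cauchy-Schwarz inequality: expanding this square and
    inserting the lower bound on the inner product leaves \<open>\<parallel>X - Y\<parallel>\<^sup>2
    \<le> \<parallel>A - B\<parallel>\<^sup>2\<close>.\<close>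
  moreover have "0 \<le> (frob_norm ((A - B) - (X - Y)))\<^sup>2" by simp
  moreover have "(frob_norm ((A - B) - (X - Y)))\<^sup>2
      = (frob_norm (A - B))\<^sup>2 - 2 * frob_inner (A - B) (X - Y) + (frob_norm (X - Y))\<^sup>2"
    using c by (intro frob_norm_square_diff[of _ n n]) (auto intro: minus_carrier_mat)
  ultimately have "(frob_norm (X - Y))\<^sup>2 \<le> (frob_norm (A - B))\<^sup>2" by linarith
  then show ?thesis unfolding X_def Y_def by (rule power2_le_imp_le) simp
qed

section \<open>Operator bounds through squared Euclidean norms\<close>

definition vec_sq :: "complex vec \<Rightarrow> real" where
  "vec_sq v = (\<Sum>i<dim_vec v. (cmod (v $ i))\<^sup>2)"

lemma vec_sq_nonneg [simp]: "0 \<le> vec_sq v"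
  by (simp add: vec_sq_def sum_nonneg)

lemma vec_sq_eq_cscalar: "complex_of_real (vec_sq v) = v \<bullet>c v"
  unfolding vec_sq_def of_real_sum complex_norm_square
  by (simp add: scalar_prod_def lessThan_atLeast0)

lemma vec_sq_mult_mat_vec:
  assumes "A \<in> carrier_mat n m" "v \<in> carrier_vec m"
  shows "complex_of_real (vec_sq (A *\<^sub>v v)) = ((mat_adjoint A * A) *\<^sub>v v) \<bullet>c v"
proof -
  have w: "A *\<^sub>v v \<in> carrier_vec n" "mat_adjoint A *\<^sub>v (A *\<^sub>v v) \<in> carrier_vec m"
    using assms by (auto intro!: mult_mat_vec_carrier[of _ m n] mult_mat_vec_carrier[of _ n m])
  have "complex_of_real (vec_sq (A *\<^sub>v v)) = cnj (complex_of_real (vec_sq (A *\<^sub>v v)))" by simp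
  also have "\<dots> = cnj (v \<bullet>c (mat_adjoint A *\<^sub>v (A *\<^sub>v v)))"
    unfolding vec_sq_eq_cscalar cscalar_prod_mult_mat_vec[OF assms w(1)] ..
  also have "\<dots> = (mat_adjoint A *\<^sub>v (A *\<^sub>v v)) \<bullet>c v"
    by (rule cscalar_prod_commute[OF assms(2) w(2)])
  also have "mat_adjoint A *\<^sub>v (A *\<^sub>v v) = (mat_adjoint A * A) *\<^sub>v v"
    using assms by (simp add: assoc_mult_mat_vec[of _ m n _ m])
  finally show ?thesis .
qed

lemma vec_sq_isometry:
  assumes "U \<in> carrier_mat n m" "mat_adjoint U * U = 1\<^sub>m m" "v \<in> carrier_vec m"
  shows "vec_sq (U *\<^sub>v v) = vec_sq v"
  using vec_sq_mult_mat_vec[OF assms(1,3)] assms by (simp flip: vec_sq_eq_cscalar)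

text \<open>\<open>V V\<^sup>H\<close> is an orthogonal projection, and by Pythagoras the deficit is
  the squared norm of \<open>v - V V\<^sup>H v\<close>.\<close>

lemma vec_sq_adjoint_isometry_le:
  assumes V: "V \<in> carrier_mat n m" "mat_adjoint V * V = 1\<^sub>m m" and v: "v \<in> carrier_vec n"
  shows "vec_sq (mat_adjoint V *\<^sub>v v) \<le> vec_sq v"
proof -
  define w where "w = mat_adjoint V *\<^sub>v v"
  have w: "w \<in> carrier_vec m" unfolding w_def using V v by (auto intro: mult_mat_vec_carrier)
  have Vw: "V *\<^sub>v w \<in> carrier_vec n" using V w by auto
  have *: "(V *\<^sub>v w) \<bullet>c v = vec_sq w"
    using cscalar_prod_mult_mat_vec[OF V(1) w v] by (simp add: vec_sq_eq_cscalar w_def)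
  then have **: "v \<bullet>c (V *\<^sub>v w) = vec_sq w"
    using cscalar_prod_commute[OF Vw v] by simp
  have "complex_of_real (vec_sq (v - V *\<^sub>v w)) = v \<bullet>c v - v \<bullet>c (V *\<^sub>v w) - ((V *\<^sub>v w) \<bullet>c v - (V *\<^sub>v w) \<bullet>c (V *\<^sub>v w))"
    unfolding vec_sq_eq_cscalar by (rule cscalar_prod_diff_diff[OF v Vw])
  also have "\<dots> = of_real (vec_sq v - vec_sq w - (vec_sq w - vec_sq (V *\<^sub>v w)))"
    unfolding * ** of_real_diff vec_sq_eq_cscalar ..
  finally have "vec_sq (v - V *\<^sub>v w) = vec_sq v - vec_sq w"
    using vec_sq_isometry[OF V w] unfolding of_real_eq_iff by simp
  then show ?thesis using vec_sq_nonneg[of "v - V *\<^sub>v w"] unfolding w_def by linarith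
qed

lemma frob_norm_adjoint: "frob_norm (mat_adjoint A) = frob_norm A"
  unfolding frob_norm_def by (simp add: sum.swap[of _ "{..<dim_col A}"])

lemma frob_norm_square_cols:
  "(frob_norm A)\<^sup>2 = (\<Sum>j<dim_col A. vec_sq (col A j))"
  unfolding frob_norm_def vec_sq_def
  by (simp add: sum_nonneg sum.swap[of _ "{..<dim_row A}"])

lemma frob_norm_mult_le:
  assumes A: "A \<in> carrier_mat k n" and D: "D \<in> carrier_mat n m"
    and s: "\<And>v. v \<in> carrier_vec n \<Longrightarrow> vec_sq (A *\<^sub>v v) \<le> s * vec_sq v"
  shows "(frob_norm (A * D))\<^sup>2 \<le> s * (frob_norm D)\<^sup>2"
proof -
  have "(frob_norm (A * D))\<^sup>2 = (\<Sum>j<m. vec_sq (A *\<^sub>v col D j))"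
    unfolding frob_norm_square_cols using D by (simp add: col_mult2[OF A D] del: col_mult2)
  also have "\<dots> \<le> (\<Sum>j<m. s * vec_sq (col D j))"
    using D by (intro sum_mono s) auto
  finally show ?thesis using D by (simp add: frob_norm_square_cols sum_distrib_left)
qed

text \<open>\<open>s\<close> bounds the square of the operator norm of \<open>A\<close>. As
  \<open>A\<close> acts twice, on the left and, after passing to adjoints, on the right, the
  Frobenius norm itself grows by at most \<open>s\<close>.\<close>

lemma frob_norm_conj_le:
  assumes A: "A \<in> carrier_mat k n" and D: "D \<in> carrier_mat n n" and "s \<ge> 0"
    and s: "\<And>v. v \<in> carrier_vec n \<Longrightarrow> vec_sq (A *\<^sub>v v) \<le> s * vec_sq v"
  shows "frob_norm (A * D * mat_adjoint A) \<le> s * frob_norm D"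
proof -
  have "(frob_norm (A * D * mat_adjoint A))\<^sup>2 = (frob_norm (A * (D * mat_adjoint A)))\<^sup>2"
    using A D by (simp add: assoc_mult_mat[of _ k n _ n _ k])
  also have "\<dots> \<le> s * (frob_norm (D * mat_adjoint A))\<^sup>2"
    using A D by (intro frob_norm_mult_le[of A k n _ k] s) auto
  also have "frob_norm (D * mat_adjoint A) = frob_norm (A * mat_adjoint D)"
    using A D by (subst frob_norm_adjoint[symmetric]) (simp add: mat_adjoint_mult[of _ n n _ k])
  also have "s * (frob_norm (A * mat_adjoint D))\<^sup>2 \<le> s * (s * (frob_norm (mat_adjoint D))\<^sup>2)"
    using A D \<open>s \<ge> 0\<close> by (intro mult_left_mono frob_norm_mult_le[of A k n _ n] s) auto
  also have "\<dots> = (s * frob_norm D)\<^sup>2" by (simp add: frob_norm_adjoint power2_eq_square)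
  finally show ?thesis by (rule power2_le_imp_le) (use \<open>s \<ge> 0\<close> in simp)
qed

lemma spectral_radius_nonneg:
  assumes "A \<in> carrier_mat n n" "n > 0"
  shows "0 \<le> spectral_radius A"
  using spectral_radius_mem_max(1)[OF assms] by auto

text \<open>Rayleigh quotient of \<open>C\<^sup>H C\<close>: in an orthonormal eigenbasis the
  quadratic form is a sum of squares weighted by eigenvalues, each at most the spectral
  radius.\<close>

lemma vec_sq_mult_le_spectral_radius:
  assumes C: "C \<in> carrier_mat k n" and v: "v \<in> carrier_vec n"
  shows "vec_sq (C *\<^sub>v v) \<le> spectral_radius (mat_adjoint C * C) * vec_sq v"
proof -
  let ?A = "mat_adjoint C * C"
  have cA: "?A \<in> carrier_mat n n" using C by auto
  have "hermitian_mat n ?A"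
    using C cA by (auto simp: hermitian_mat_def mat_adjoint_mult[of _ n k _ n])
  then obtain U d where U: "U \<in> carrier_mat n n" and U1: "mat_adjoint U * U = 1\<^sub>m n" and U2: "U * mat_adjoint U = 1\<^sub>m n"
    and A: "?A = U * mat_diag n (\<lambda>i. complex_of_real (d i)) * mat_adjoint U"
    using hermitian_spectral by metis
  let ?D = "mat_diag n (\<lambda>i. complex_of_real (d i))"
  define w where "w = mat_adjoint U *\<^sub>v v"
  have w: "w \<in> carrier_vec n" unfolding w_def using U v by (auto intro!: mult_mat_vec_carrier)
  have ev: "d i \<le> spectral_radius ?A" if i: "i < n" for i
  proof -
    have AU: "?A * U = U * ?D"
      unfolding A using U U1 right_mult_one_mat[of ?D n n]
      by (simp add: square_mult_assoc[where n = n] square_mult_carrier[where n = n] del: right_mult_one_mat)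
    have "?A *\<^sub>v col U i = col (?A * U) i" using col_mult2[OF cA U i] by simp
    also have "\<dots> = complex_of_real (d i) \<cdot>\<^sub>v col U i"
      unfolding AU mat_diag_mult_right[OF U] using i U by (intro eq_vecI) auto
    finally have "?A *\<^sub>v col U i = complex_of_real (d i) \<cdot>\<^sub>v col U i" .
    moreover have "col U i \<noteq> 0\<^sub>v n"
    proof
      assume 0: "col U i = 0\<^sub>v n"
      have "mat_adjoint U *\<^sub>v col U i = col (mat_adjoint U * U) i"
        using col_mult2[OF mat_adjoint_carrier[OF U] U i] by simp
      then have "0\<^sub>v n = (unit_vec n i :: complex vec)"
        unfolding 0 U1 using U i mult_mat_zero_vec[of "mat_adjoint U" n n] by simp
      then show False using i by (metis unit_vec_nonzero)
    qed
    ultimately have "eigenvector ?A (col U i) (complex_of_real (d i))"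
      using U i cA C by (simp add: eigenvector_def)
    then have "complex_of_real (d i) \<in> spectrum ?A" by (auto simp: spectrum_def eigenvalue_def)
    then have "norm (complex_of_real (d i)) \<le> spectral_radius ?A"
      using i by (intro spectral_radius_mem_max(2)[OF cA] imageI) auto
    then show ?thesis by simp
  qed
  have "vec_sq (C *\<^sub>v v) = Re ((?A *\<^sub>v v) \<bullet>c v)"
    unfolding vec_sq_mult_mat_vec[OF C v, symmetric] by simp
  also have "\<dots> = (\<Sum>i<n. d i * (cmod (w $ i))\<^sup>2)"
    unfolding A using quadratic_form_conj[of ?D n U n v] quadratic_form_mat_diag[OF w] U v
    by (simp add: w_def)
  also have "\<dots> \<le> (\<Sum>i<n. spectral_radius ?A * (cmod (w $ i))\<^sup>2)"
    by (intro sum_mono mult_right_mono) (use ev in auto)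
  also have "\<dots> = spectral_radius ?A * vec_sq w" using w by (simp add: vec_sq_def sum_distrib_left)
  also have "vec_sq w = vec_sq v"
    unfolding w_def using U U2 v by (intro vec_sq_isometry[of _ n n]) auto
  finally show ?thesis .
qed

text \<open>Gives access to the triangle inequality and the entry bounds of
  \<open>L2_set\<close>.\<close>

lemma frob_norm_eq_L2_set:
  "frob_norm A = L2_set (\<lambda>(i, j). cmod (A $$ (i, j))) ({..<dim_row A} \<times> {..<dim_col A})"
  unfolding frob_norm_def L2_set_def by (simp add: sum.cartesian_product case_prod_unfold)

lemma frob_norm_sum_le:
  assumes "finite R" "\<And>r. r \<in> R \<Longrightarrow> F r \<in> carrier_mat n m"
  shows "frob_norm (mat n m (\<lambda>(i, j). \<Sum>r\<in>R. F r $$ (i, j))) \<le> (\<Sum>r\<in>R. frob_norm (F r))"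
  using assms
proof (induction rule: finite_induct)
  case empty
  show ?case by (simp add: frob_norm_def)
next
  case (insert r R)
  let ?S = "{..<n} \<times> {..<m}"
  have "frob_norm (mat n m (\<lambda>(i, j). \<Sum>r\<in>insert r R. F r $$ (i, j)))
      = L2_set (\<lambda>(i, j). cmod (F r $$ (i, j) + (\<Sum>r\<in>R. F r $$ (i, j)))) ?S"
    unfolding frob_norm_eq_L2_set using insert by (intro L2_set_cong) auto
  also have "\<dots> \<le> L2_set (\<lambda>x. (case x of (i, j) \<Rightarrow> cmod (F r $$ (i, j))) +
      (case x of (i, j) \<Rightarrow> cmod (\<Sum>r\<in>R. F r $$ (i, j)))) ?S"
    by (intro L2_set_mono) (auto intro: norm_triangle_ineq)
  also have "\<dots> \<le> L2_set (\<lambda>(i, j). cmod (F r $$ (i, j))) ?S + L2_set (\<lambda>(i, j). cmod (\<Sum>r\<in>R. F r $$ (i, j))) ?S"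
    by (rule L2_set_triangle_ineq)
  also have "L2_set (\<lambda>(i, j). cmod (F r $$ (i, j))) ?S = frob_norm (F r)"
    unfolding frob_norm_eq_L2_set using insert.prems[of r] by (intro L2_set_cong) auto
  also have "L2_set (\<lambda>(i, j). cmod (\<Sum>r\<in>R. F r $$ (i, j))) ?S
      = frob_norm (mat n m (\<lambda>(i, j). \<Sum>r\<in>R. F r $$ (i, j)))"
    unfolding frob_norm_eq_L2_set by (intro L2_set_cong) auto
  finally show ?case using insert.IH insert.prems insert.hyps by (fastforce intro: order_trans)
qed

section \<open>Pseudoinverse of the reduced channel\<close>

text \<open>\<open>A * B\<close> and \<open>A * C\<close> are both the orthogonal projection onto
  the range of \<open>A\<close>, and \<open>B * A\<close> and \<open>C * A\<close> both the one onto
  the range of \<open>A\<^sup>H\<close>. Hence \<open>B = B A B = C A B = C A C = C\<close>.\<close>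

lemma is_pinv_unique:
  assumes AB: "is_pinv A B" and AC: "is_pinv A C"
  shows "B = C"
proof -
  let ?m = "dim_row A" and ?k = "dim_col A"
  have c: "A \<in> carrier_mat ?m ?k" "B \<in> carrier_mat ?k ?m" "C \<in> carrier_mat ?k ?m"
    using AB AC by (auto simp: is_pinv_def)
  have as1: "X * Y * Z = X * (Y * Z)"
    if "X \<in> carrier_mat a b" "Y \<in> carrier_mat b d" "Z \<in> carrier_mat d e" for X Y Z :: "complex mat" and a b d e
    using that by (rule assoc_mult_mat)
  have cc: "A * B \<in> carrier_mat ?m ?m" "A * C \<in> carrier_mat ?m ?m" "B * A \<in> carrier_mat ?k ?k" "C * A \<in> carrier_mat ?k ?k"
    using c by auto
  have b: "A * B * A = A" "B * A * B = B" "mat_adjoint (A * B) = A * B" "mat_adjoint (B * A) = B * A"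
    and d: "A * C * A = A" "C * A * C = C" "mat_adjoint (A * C) = A * C" "mat_adjoint (C * A) = C * A"
    using AB AC by (auto simp: is_pinv_def)
  have 1: "A * B = (A * C) * (A * B)"
    using d(1) as1[OF cc(2) c(1,2)] by simp
  have 2: "A * C = (A * B) * (A * C)"
    using b(1) as1[OF cc(1) c(1,3)] by simp
  have AA: "A * B = A * C"
    using arg_cong[OF 1, of mat_adjoint] 2 unfolding mat_adjoint_mult[OF cc(2,1)] b d by simp
  have 3: "B * A = (B * A) * (C * A)"
    using d(1) as1[OF c(2,1) cc(4)] as1[OF c(1,3,1)] by simp
  have 4: "C * A = (C * A) * (B * A)"
    using b(1) as1[OF c(3,1) cc(3)] as1[OF c(1,2,1)] by simp
  have BB: "B * A = C * A"
    using arg_cong[OF 3, of mat_adjoint] 4 unfolding mat_adjoint_mult[OF cc(3,4)] b d by simp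
  have "B = B * A * B" using b by simp
  also have "\<dots> = C * (A * B)" unfolding BB by (rule as1[OF c(3,1,2)])
  also have "\<dots> = C * A * C" unfolding AA by (rule as1[OF c(3,1,3), symmetric])
  finally show ?thesis using d by simp
qed

lemma pinv_eqI: "is_pinv A B \<Longrightarrow> pinv A = B"
  unfolding pinv_def by (rule the_equality) (auto intro: is_pinv_unique)

lemma pos_def_mat_inverse:
  assumes "pos_def n K"
  obtains B where "mat_inverse K = Some B" "K * B = 1\<^sub>m n" "B * K = 1\<^sub>m n" "B \<in> carrier_mat n n"
proof -
  have K: "K \<in> carrier_mat n n" using assms by (simp add: pos_def_def hermitian_mat_def)
  have "det K \<noteq> 0" using pos_def_det(2)[OF assms] by auto
  then have "K \<in> Units (ring_mat TYPE(complex) n n)" by (rule det_non_zero_imp_unit[OF K])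
  then obtain B where "mat_inverse K = Some B"
    using mat_inverse(1)[OF K, of n] by (cases "mat_inverse K") auto
  with mat_inverse(2)[OF K] that show ?thesis by blast
qed

lemma gram_pos_def:
  assumes F: "F \<in> carrier_mat m r"
    and inj: "\<And>x. x \<in> carrier_vec r \<Longrightarrow> F *\<^sub>v x = 0\<^sub>v m \<Longrightarrow> x = 0\<^sub>v r"
  shows "pos_def r (mat_adjoint F * F)"
  unfolding pos_def_def
proof (intro conjI ballI impI)
  show "hermitian_mat r (mat_adjoint F * F)"
    using F by (auto simp: hermitian_mat_def mat_adjoint_mult[of _ r m _ r])
  fix v :: "complex vec" assume v: "v \<in> carrier_vec r" "v \<noteq> 0\<^sub>v r"
  have "F *\<^sub>v v \<noteq> 0\<^sub>v m" using inj v by blast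
  moreover have Fv: "F *\<^sub>v v \<in> carrier_vec m" using F v by auto
  ultimately obtain i where "i < m" "(F *\<^sub>v v) $ i \<noteq> 0"
    by (metis carrier_vecD eq_vecI index_zero_vec)
  then have "vec_sq (F *\<^sub>v v) > 0"
    unfolding vec_sq_def using Fv carrier_vecD[OF Fv] F by (intro sum_pos2[of _ i]) auto
  then show "0 < Re (((mat_adjoint F * F) *\<^sub>v v) \<bullet>c v)"
    unfolding vec_sq_mult_mat_vec[OF F v(1), symmetric] by simp
qed

text \<open>The least squares formula \<open>G = (F\<^sup>H F)\<^sup>-\<^sup>1 F\<^sup>H\<close>. A
  left inverse fulfils the Penrose conditions apart from the symmetry of \<open>F * G\<close>, and
  for that one the inverse Gram matrix \<open>B\<close> has to be Hermitian.\<close>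

lemma full_column_rank_pinv:
  assumes F: "F \<in> carrier_mat m r"
    and inj: "\<And>x. x \<in> carrier_vec r \<Longrightarrow> F *\<^sub>v x = 0\<^sub>v m \<Longrightarrow> x = 0\<^sub>v r"
  obtains G where "is_pinv F G" "G \<in> carrier_mat r m" "G * F = 1\<^sub>m r"
proof -
  define K where "K = mat_adjoint F * F"
  have FH: "mat_adjoint F \<in> carrier_mat r m" using F by simp
  have K: "K \<in> carrier_mat r r" unfolding K_def by (rule mult_carrier_mat[OF FH F])
  obtain B where B: "K * B = 1\<^sub>m r" "B * K = 1\<^sub>m r" "B \<in> carrier_mat r r"
    using pos_def_mat_inverse[OF gram_pos_def[OF F inj]] unfolding K_def by metis
  have Kh: "mat_adjoint K = K" unfolding K_def using F FH by (simp add: mat_adjoint_mult[of _ r m _ r])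
  have Bh: "mat_adjoint B = B"
  proof -
    have "mat_adjoint B * K = 1\<^sub>m r"
      using arg_cong[OF B(1), of mat_adjoint] Kh by (simp add: mat_adjoint_mult[OF K B(3)])
    then have "mat_adjoint B * (K * B) = B"
      using square_mult_assoc[of "mat_adjoint B" r K B] B K by simp
    then show ?thesis using B by simp
  qed
  define G where "G = B * mat_adjoint F"
  have G: "G \<in> carrier_mat r m" using B FH by (simp add: G_def)
  have GF: "G * F = 1\<^sub>m r"
    unfolding G_def using assoc_mult_mat[OF B(3) FH F] B by (simp add: K_def)
  have FG: "F * G \<in> carrier_mat m m" using F G by simp
  have "mat_adjoint (F * G) = F * G"
    using assoc_mult_mat[OF F B(3) FH] mat_adjoint_mult[OF F G] mat_adjoint_mult[OF B(3) FH]
    by (simp add: Bh G_def)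
  then have "is_pinv F G"
    using F G GF assoc_mult_mat[OF F G F] by (auto simp: is_pinv_def)
  then show ?thesis using that G GF by blast
qed

text \<open>The columns of \<open>H\<^sup>H\<close> are orthogonal to the kernel of
  \<open>H\<close>, so they lie in the column space of \<open>V\<close>, on which
  \<open>V V\<^sup>H\<close> acts as the identity. The claim is the adjoint of that.\<close>

lemma reduction_basis_absorb:
  assumes H: "H \<in> carrier_mat m k" and red: "reduction_basis H V"
  shows "H * V * mat_adjoint V = H"
proof -
  let ?r = "mat_rank H"
  have V: "V \<in> carrier_mat k ?r" and VV: "mat_adjoint V * V = 1\<^sub>m ?r"
    and sp: "vec_space.col_space k V = {v \<in> carrier_vec k. \<forall>u \<in> mat_kernel H. v \<bullet>c u = 0}"
    using H red by (auto simp: reduction_basis_def)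
  have VH: "mat_adjoint V \<in> carrier_mat ?r k" using V by simp
  have HH: "mat_adjoint H \<in> carrier_mat k m" using H by simp
  have "V * (mat_adjoint V * mat_adjoint H) = mat_adjoint H"
  proof (rule mat_col_eqI)
    fix j assume "j < dim_col (mat_adjoint H)"
    then have j: "j < m" using H by simp
    have cj: "col (mat_adjoint H) j \<in> carrier_vec k" using HH j by simp
    have "col (mat_adjoint H) j \<bullet>c u = 0" if "u \<in> mat_kernel H" for u
    proof -
      have u: "u \<in> carrier_vec k" "H *\<^sub>v u = 0\<^sub>v m" using mat_kernelD[OF H that] by auto
      have "(mat_adjoint H *\<^sub>v unit_vec m j) \<bullet>c u = unit_vec m j \<bullet>c (mat_adjoint (mat_adjoint H) *\<^sub>v u)"
        using HH u by (intro cscalar_prod_mult_mat_vec) auto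
      moreover have "mat_adjoint H *\<^sub>v unit_vec m j = col (mat_adjoint H) j"
        using HH j by (intro eq_vecI) auto
      ultimately show ?thesis using u by (simp add: scalar_prod_def)
    qed
    then have "col (mat_adjoint H) j \<in> vec_space.col_space k V" using cj sp by simp
    then obtain c where c: "c \<in> carrier_vec ?r" "V *\<^sub>v c = col (mat_adjoint H) j"
      using vec_space.col_space_eq[OF V] V by auto
    have "col (V * (mat_adjoint V * mat_adjoint H)) j = V *\<^sub>v (mat_adjoint V *\<^sub>v (V *\<^sub>v c))"
      using col_mult2[OF V mult_carrier_mat[OF VH HH] j] col_mult2[OF VH HH j] c by simp
    also have "\<dots> = V *\<^sub>v c"
      using assoc_mult_mat_vec[OF VH V c(1)] c by (simp add: VV)
    finally show "col (V * (mat_adjoint V * mat_adjoint H)) j = col (mat_adjoint H) j"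
      using c by simp
  qed (use V H in auto)
  from arg_cong[OF this, of mat_adjoint] show ?thesis
    by (simp add: mat_adjoint_mult[OF V mult_carrier_mat[OF VH HH]] mat_adjoint_mult[OF VH HH])
qed

text \<open>With \<open>F = H V\<close> and \<open>G = pinv F\<close>, absorption gives
  \<open>H = F V\<^sup>H\<close>, and \<open>V G\<close> passes the Penrose conditions for
  \<open>H\<close>: the two products are \<open>F G\<close> and \<open>V V\<^sup>H\<close>.
  Multiplying by \<open>V\<^sup>H\<close> recovers \<open>G\<close>.\<close>

lemma reduction_basis_pinv:
  assumes H: "H \<in> carrier_mat m k" and red: "reduction_basis H V"
  defines "r \<equiv> mat_rank H"
  shows "pinv (H * V) \<in> carrier_mat r m" and "pinv (H * V) * (H * V) = 1\<^sub>m r"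
    and "pinv H \<in> carrier_mat k m" and "pinv (H * V) = mat_adjoint V * pinv H"
proof -
  have V: "V \<in> carrier_mat k r" and VV: "mat_adjoint V * V = 1\<^sub>m r"
    and sp: "vec_space.col_space k V = {v \<in> carrier_vec k. \<forall>u \<in> mat_kernel H. v \<bullet>c u = 0}"
    using H red by (auto simp: reduction_basis_def r_def)
  have VH: "mat_adjoint V \<in> carrier_mat r k" using V by simp
  note absorb = reduction_basis_absorb[OF H red]
  define F where "F = H * V"
  have F: "F \<in> carrier_mat m r" using H V by (simp add: F_def)
  have FV: "F * mat_adjoint V = H" unfolding F_def by (rule absorb)
  \<comment> \<open>If \<open>F\<close> kills \<open>x\<close>, then \<open>V x\<close> lies in the
    kernel of \<open>H\<close> and in its orthogonal complement, so it is 0.\<close>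
  have inj: "x = 0\<^sub>v r" if x: "x \<in> carrier_vec r" "F *\<^sub>v x = 0\<^sub>v m" for x
  proof -
    have Vx: "V *\<^sub>v x \<in> carrier_vec k" using V x by auto
    have "H *\<^sub>v (V *\<^sub>v x) = 0\<^sub>v m" using x assoc_mult_mat_vec[OF H V x(1)] by (simp add: F_def)
    then have "V *\<^sub>v x \<in> mat_kernel H" using H Vx by (auto intro: mat_kernelI)
    moreover have "V *\<^sub>v x \<in> vec_space.col_space k V"
      using vec_space.col_space_eq[OF V] V x Vx by auto
    ultimately have "(V *\<^sub>v x) \<bullet>c (V *\<^sub>v x) = 0" using sp by blast
    then have "V *\<^sub>v x = 0\<^sub>v k" using conjugate_square_eq_0_vec[OF Vx] by simp
    then have "mat_adjoint V *\<^sub>v (V *\<^sub>v x) = 0\<^sub>v r" using mult_mat_zero_vec[OF VH] by simp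
    then show ?thesis using assoc_mult_mat_vec[OF VH V x(1)] x by (simp add: VV)
  qed
  obtain G where pG: "is_pinv F G" and G: "G \<in> carrier_mat r m" and GF: "G * F = 1\<^sub>m r"
    using full_column_rank_pinv[OF F inj] by blast
  have HG: "H * (V * G) = F * G" unfolding F_def using assoc_mult_mat[OF H V G] by simp
  have "(V * G) * H = V * (G * (F * mat_adjoint V))" unfolding FV by (rule assoc_mult_mat[OF V G H])
  also have "G * (F * mat_adjoint V) = mat_adjoint V"
    using assoc_mult_mat[OF G F VH] unfolding GF left_mult_one_mat[OF VH] by (rule sym)
  finally have GH: "(V * G) * H = V * mat_adjoint V" .
  have VG: "V * G \<in> carrier_mat k m" using V G by simp
  have "is_pinv H (V * G)"
    unfolding is_pinv_def HG GH
  proof (intro conjI)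
    show "V * G \<in> carrier_mat (dim_col H) (dim_row H)" using VG H by simp
    have "F * G * F = F" using pG by (simp add: is_pinv_def)
    then show "F * G * H = H"
      using assoc_mult_mat[OF mult_carrier_mat[OF F G] F VH] unfolding FV by (simp add: FV)
    have "V * mat_adjoint V * (V * G) = V * (mat_adjoint V * (V * G))" by (rule assoc_mult_mat[OF V VH VG])
    also have "mat_adjoint V * (V * G) = G" using assoc_mult_mat[OF VH V G] G by (simp add: VV)
    finally show "V * mat_adjoint V * (V * G) = V * G" .
    show "mat_adjoint (F * G) = F * G" using pG by (simp add: is_pinv_def)
    show "mat_adjoint (V * mat_adjoint V) = V * mat_adjoint V" by (simp add: mat_adjoint_mult[OF V VH])
  qed
  then have pH: "pinv H = V * G" by (rule pinv_eqI)
  have pF: "pinv F = G" by (rule pinv_eqI[OF pG])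
  show "pinv (H * V) \<in> carrier_mat r m" "pinv (H * V) * (H * V) = 1\<^sub>m r" "pinv H \<in> carrier_mat k m"
    using pH pF G GF VG unfolding F_def by auto
  show "pinv (H * V) = mat_adjoint V * pinv H"
    using pH pF assoc_mult_mat[OF VH V G] G unfolding F_def by (simp add: VV)
qed

text \<open>If \<open>V\<close> had no columns, absorption would give \<open>H = 0\<close>. A
  positive rank is what allows a strategy to have positive trace.\<close>

lemma mat_rank_pos:
  assumes H: "H \<in> carrier_mat m k" and red: "reduction_basis H V" and "H \<noteq> 0\<^sub>m m k"
  shows "mat_rank H > 0"
proof (rule ccontr)
  assume "\<not> mat_rank H > 0"
  then have V: "V \<in> carrier_mat k 0" using H red by (auto simp: reduction_basis_def)
  have "H * V * mat_adjoint V = 0\<^sub>m m k"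
    using H V by (intro eq_matI) (auto simp: scalar_prod_def)
  with reduction_basis_absorb[OF H red] assms(3) show False by simp
qed

section \<open>Weighted contractions and asynchronous iterations\<close>

lemma spectral_radius_less_1_imp_weights:
  fixes s :: "nat \<Rightarrow> nat \<Rightarrow> real"
  assumes s: "\<And>q r. q < Q \<Longrightarrow> r < Q \<Longrightarrow> 0 \<le> s q r"
    and rho: "spectral_radius (mat Q Q (\<lambda>(q, r). complex_of_real (s q r))) < 1"
  obtains w where "\<And>q. 0 < w q" "\<And>q. q < Q \<Longrightarrow> (\<Sum>r<Q. s q r * w r) < w q"
proof (cases "Q = 0")
  case True
  then show ?thesis using that[of "\<lambda>_. 1"] by simp
next
  case False
  define A where "A = mat Q Q (\<lambda>(q, r). complex_of_real (s q r))"
  have A: "A \<in> carrier_mat Q Q" by (simp add: A_def)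
  define \<rho> where "\<rho> = spectral_radius A"
  have \<rho>: "0 \<le> \<rho>" "\<rho> < 1" using spectral_radius_nonneg[OF A] False rho by (auto simp: \<rho>_def A_def)
  \<comment> \<open>Any number above 1 whose product with \<open>\<rho>\<close> is below 1 would do;
    this one also covers \<open>\<rho> = 0\<close>. The powers of \<open>\<theta> S\<close> are then
    bounded, so \<open>S\<^sup>k\<close> decays like
    \<open>\<theta>\<^sup>-\<^sup>k\<close>.\<close>
  define \<theta> where "\<theta> = 2 / (1 + \<rho>)"
  have \<theta>: "\<theta> > 1" "\<theta> * \<rho> < 1" using \<rho> by (auto simp: \<theta>_def field_simps)
  define B where "B = complex_of_real \<theta> \<cdot>\<^sub>m A"
  have B: "B \<in> carrier_mat Q Q" using A by (simp add: B_def)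
  have "norm e < 1" if e: "e \<in> spectrum B" for e
  proof -
    obtain v where v: "v \<in> carrier_vec Q" "v \<noteq> 0\<^sub>v Q" "B *\<^sub>v v = e \<cdot>\<^sub>v v"
      using e B by (auto simp: spectrum_def eigenvalue_def eigenvector_def)
    have "complex_of_real \<theta> \<cdot>\<^sub>v (A *\<^sub>v v) = e \<cdot>\<^sub>v v"
      using v A unfolding v(3)[symmetric] B_def
      by (intro eq_vecI) (auto simp: scalar_prod_def sum_distrib_left mult_ac)
    then have "A *\<^sub>v v = (e / complex_of_real \<theta>) \<cdot>\<^sub>v v"
      using \<theta>(1) v(1) A by (intro eq_vecI) (auto simp: vec_eq_iff field_simps)
    then have "e / complex_of_real \<theta> \<in> spectrum A"
      using v A by (auto simp: spectrum_def eigenvalue_def eigenvector_def)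
    then have "norm (e / complex_of_real \<theta>) \<le> \<rho>"
      unfolding \<rho>_def using False by (intro spectral_radius_mem_max(2)[OF A] imageI) auto
    then have "norm e \<le> \<theta> * \<rho>" using \<theta>(1) by (simp add: norm_divide field_simps)
    then show ?thesis using \<theta>(2) by simp
  qed
  then have "spectral_radius B < 1"
    using spectral_radius_mem_max(1)[OF B] False by auto
  then obtain c where c: "\<And>k. norm_bound (B ^\<^sub>m k) c"
    using spectral_radius_jnf_norm_bound_less_1_upper_triangular[OF B] by blast
  \<comment> \<open>\<open>T\<close> is \<open>\<theta> S\<close> acting on real functions. The
    weights must be real, while the norm bound is available for complex matrix powers;
    \<open>Bk\<close> connects the two.\<close>
  define T where "T = (\<lambda>x q. \<Sum>r<Q. \<theta> * s q r * x r)"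
  have Bv: "B *\<^sub>v vec Q (\<lambda>q. complex_of_real (x q)) = vec Q (\<lambda>q. complex_of_real (T x q))" for x
    unfolding B_def A_def T_def
    by (intro eq_vecI) (auto simp: scalar_prod_def lessThan_atLeast0 intro!: sum.cong)
  have Bk: "(B ^\<^sub>m k) *\<^sub>v vec Q (\<lambda>q. complex_of_real (x q)) = vec Q (\<lambda>q. complex_of_real ((T ^^ k) x q))" for k x
  proof (induction k arbitrary: x)
    case 0
    then show ?case using B by auto
  next
    case (Suc k)
    have "(B ^\<^sub>m Suc k) *\<^sub>v vec Q (\<lambda>q. complex_of_real (x q)) = (B ^\<^sub>m k) *\<^sub>v (B *\<^sub>v vec Q (\<lambda>q. complex_of_real (x q)))"
      using B by (simp add: assoc_mult_mat_vec[of _ Q Q _ Q] pow_carrier_mat)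
    also have "\<dots> = vec Q (\<lambda>q. complex_of_real ((T ^^ k) (T x) q))" unfolding Bv by (rule Suc)
    finally show ?case by (simp add: funpow_swap1)
  qed
  define u where "u = (\<lambda>k. (T ^^ k) (\<lambda>_. 1))"
  have u0: "u 0 q = 1" for q by (simp add: u_def)
  have uSuc: "u (Suc k) q = (\<Sum>r<Q. \<theta> * s q r * u k r)" for k q by (simp add: u_def T_def)
  have u_nonneg: "0 \<le> u k q" if "q < Q" for k q
    using that by (induction k arbitrary: q) (use s \<theta> in \<open>auto simp: u0 uSuc intro!: sum_nonneg mult_nonneg_nonneg\<close>)
  have u_bound: "u k q \<le> Q * c" if "q < Q" for k q
  proof -
    have "complex_of_real (u k q) = ((B ^\<^sub>m k) *\<^sub>v vec Q (\<lambda>q. complex_of_real 1)) $ q"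
      unfolding Bk using that by (simp add: u_def)
    also have "\<dots> = (\<Sum>r<Q. (B ^\<^sub>m k) $$ (q, r))"
      using B that pow_carrier_mat[OF B, of k] by (simp add: scalar_prod_def lessThan_atLeast0)
    finally have "norm (complex_of_real (u k q)) \<le> (\<Sum>r<Q. norm ((B ^\<^sub>m k) $$ (q, r)))"
      by (simp only: norm_sum)
    also have "\<dots> \<le> (\<Sum>r<Q. c)"
      using c[of k] that B by (intro sum_mono) (auto simp: norm_bound_def split: if_splits)
    finally show ?thesis using u_nonneg[OF that] by simp
  qed
  obtain N where N: "Q * c < \<theta> ^ N" using real_arch_pow[OF \<theta>(1)] by blast
  have "\<theta> ^ N > 0" using \<theta> by simp
  \<comment> \<open>As \<open>u k\<close> is \<open>(\<theta> S)\<^sup>k 1\<close>, the division by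
    \<open>\<theta>\<^sup>k\<close> leaves the truncated series of \<open>S\<^sup>k 1\<close>.
    \<open>N\<close> was chosen so that the first omitted term is below 1; the value 1 outside the
    range makes \<open>w\<close> positive everywhere.\<close>
  define w where "w = (\<lambda>q. if q < Q then \<Sum>k<N. u k q / \<theta> ^ k else 1)"
  have "N > 0"
  proof (rule ccontr)
    assume "\<not> N > 0"
    then have "Q * c < 1" using N by simp
    then show False using u_bound[of 0 0] False by (simp add: u0)
  qed
  have w_pos: "0 < w q" for q
  proof (cases "q < Q")
    case True
    have "0 < (\<Sum>k<N. u k q / \<theta> ^ k)"
      by (rule sum_pos2[of _ 0]) (use True \<open>N > 0\<close> \<theta> u_nonneg u0 in auto)
    then show ?thesis using True by (simp add: w_def)
  qed (simp add: w_def)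
  have "(\<Sum>r<Q. s q r * w r) < w q" if q: "q < Q" for q
  proof -
    have "(\<Sum>r<Q. s q r * w r) = (\<Sum>k<N. (\<Sum>r<Q. \<theta> * s q r * u k r) / \<theta> ^ Suc k)"
      using \<theta> unfolding w_def
      by (simp add: sum_distrib_left sum_divide_distrib) (subst sum.swap, simp)
    also have "\<dots> = (\<Sum>k<N. u (Suc k) q / \<theta> ^ Suc k)" by (simp add: uSuc)
    \<comment> \<open>Applying \<open>S\<close> shifts the series by one index: the constant term 1
      is lost and the term of index \<open>N\<close> is gained.\<close>
    also have "\<dots> = (\<Sum>k<Suc N. u k q / \<theta> ^ k) - 1"
      by (subst sum.lessThan_Suc_shift) (simp add: u0)
    also have "\<dots> = w q + u N q / \<theta> ^ N - 1" using q by (simp add: w_def)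
    also have "u N q / \<theta> ^ N < 1"
      using u_bound[OF q, of N] N \<open>\<theta> ^ N > 0\<close> by (simp add: field_simps)
    finally show ?thesis by simp
  qed
  then show ?thesis using that w_pos by blast
qed

text \<open>Turns the sequential condition into a threshold. If it failed, infinitely many update
  times would perceive data older than \<open>M\<close>, and their enumeration would be a sequence
  in \<open>T q\<close> tending to infinity with bounded \<open>\<tau>\<close>.\<close>

lemma updating_schedule_delay:
  assumes "updating_schedule Q T \<tau>" "q < Q" "r < Q" "r \<noteq> q"
  shows "\<exists>N. \<forall>n\<ge>N. n \<in> T q \<longrightarrow> M \<le> \<tau> q r n"
proof (rule ccontr)
  assume *: "\<nexists>N. \<forall>n\<ge>N. n \<in> T q \<longrightarrow> M \<le> \<tau> q r n"
  define E where "E = {n \<in> T q. \<tau> q r n < M}"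
  have "infinite E"
    unfolding infinite_nat_iff_unbounded_le E_def using * by (force simp: not_le)
  then have "strict_mono (enumerate E)" and inE: "\<And>k. enumerate E k \<in> E"
    by (auto simp: strict_mono_enumerate enumerate_in_set)
  then have "filterlim (enumerate E) at_top sequentially" by (simp add: filterlim_subseq)
  then have "filterlim (\<lambda>k. \<tau> q r (enumerate E k)) at_top sequentially"
    using assms inE unfolding updating_schedule_def E_def by blast
  then have "\<forall>\<^sub>F k in sequentially. M \<le> \<tau> q r (enumerate E k)" by (simp add: filterlim_at_top)
  then obtain k where "M \<le> \<tau> q r (enumerate E k)" by (auto simp: eventually_sequentially)
  then show False using inE[of k] by (simp add: E_def)
qed

text \<open>
  The box argument for totally asynchronous iterations: in the weighted maximum norm every box
  \<open>d q \<le> \<beta>\<^sup>k c w\<^sub>q\<close> is eventually entered by all users and never left again.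
\<close>

lemma async_contraction_tendsto_0:
  fixes d :: "nat \<Rightarrow> nat \<Rightarrow> real" and s :: "nat \<Rightarrow> nat \<Rightarrow> real"
  assumes sched: "updating_schedule Q T \<tau>"
    and s: "\<And>q r. q < Q \<Longrightarrow> r < Q \<Longrightarrow> 0 \<le> s q r"
    and w: "\<And>q. 0 < w q" "\<And>q. q < Q \<Longrightarrow> (\<Sum>r\<in>{..<Q} - {q}. s q r * w r) < w q"
    and d: "\<And>n q. q < Q \<Longrightarrow> 0 \<le> d n q"
    and upd: "\<And>n q. q < Q \<Longrightarrow> n \<in> T q \<Longrightarrow> d (Suc n) q \<le> (\<Sum>r\<in>{..<Q} - {q}. s q r * d (\<tau> q r n) r)"
    and keep: "\<And>n q. q < Q \<Longrightarrow> n \<notin> T q \<Longrightarrow> d (Suc n) q = d n q"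
    and q: "q < Q"
  shows "(\<lambda>n. d n q) \<longlonglongrightarrow> 0"
proof -
  let ?R = "\<lambda>q. {..<Q} - {q}"
  \<comment> \<open>The contraction factor in the weighted maximum norm. Strictness survives because
    the maximum is over finitely many users, and the inserted 0 ensures
    \<open>\<beta> \<ge> 0\<close>.\<close>
  define \<beta> where "\<beta> = Max (insert 0 ((\<lambda>q. (\<Sum>r\<in>?R q. s q r * w r) / w q) ` {..<Q}))"
  have \<beta>0: "0 \<le> \<beta>" unfolding \<beta>_def by (intro Max_ge) auto
  have \<beta>1: "\<beta> < 1"
    unfolding \<beta>_def by (subst Max_less_iff) (use w in \<open>auto simp: divide_simps\<close>)
  have \<beta>: "(\<Sum>r\<in>?R q. s q r * w r) \<le> \<beta> * w q" if "q < Q" for q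
  proof -
    have "(\<Sum>r\<in>?R q. s q r * w r) / w q \<le> \<beta>" unfolding \<beta>_def by (intro Max_ge) (use that in auto)
    then show ?thesis using w(1)[of q] by (simp add: pos_divide_le_eq)
  qed
  have step: "d (Suc n) q \<le> \<beta> * (b * w q)"
    if q: "q < Q" and n: "n \<in> T q" and b: "0 \<le> b" and le: "\<And>r. r < Q \<Longrightarrow> r \<noteq> q \<Longrightarrow> d (\<tau> q r n) r \<le> b * w r" for n q b
  proof -
    have "d (Suc n) q \<le> (\<Sum>r\<in>?R q. s q r * d (\<tau> q r n) r)" by (rule upd[OF q n])
    also have "\<dots> \<le> (\<Sum>r\<in>?R q. s q r * (b * w r))"
      by (intro sum_mono mult_left_mono) (use s le q in auto)
    also have "\<dots> = b * (\<Sum>r\<in>?R q. s q r * w r)" by (simp add: sum_distrib_left mult_ac)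
    also have "\<dots> \<le> b * (\<beta> * w q)" by (intro mult_left_mono \<beta> q b)
    finally show ?thesis by (simp add: mult_ac)
  qed
  define c where "c = (\<Sum>q<Q. d 0 q / w q)"
  have c0: "0 \<le> c" unfolding c_def by (intro sum_nonneg divide_nonneg_pos) (use d w in auto)
  \<comment> \<open>Strong induction, because an update may read components from arbitrarily old
    iterations.\<close>
  have box0: "d n q \<le> c * w q" if "q < Q" for n q
    using that
  proof (induction n arbitrary: q rule: less_induct)
    case (less n)
    show ?case
    proof (cases n)
      case 0
      have "d 0 q / w q \<le> c"
        unfolding c_def using less.prems d w(1) by (intro member_le_sum) (auto intro: divide_nonneg_pos)
      then show ?thesis using 0 w(1)[of q] by (simp add: pos_divide_le_eq)
    next
      case (Suc m)
      show ?thesis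
      proof (cases "m \<in> T q")
        case True
        have "d (Suc m) q \<le> \<beta> * (c * w q)"
        proof (rule step[OF less.prems True c0])
          fix r assume "r < Q" "r \<noteq> q"
          then have "\<tau> q r m < n" using sched less.prems Suc
            unfolding updating_schedule_def by (auto simp: less_Suc_eq_le)
          then show "d (\<tau> q r m) r \<le> c * w r" using less.IH \<open>r < Q\<close> by blast
        qed
        also have "\<dots> \<le> 1 * (c * w q)"
          using \<beta>1 c0 w(1)[of q] by (intro mult_right_mono) auto
        finally show ?thesis using Suc by simp
      next
        case False
        then show ?thesis using less Suc keep by simp
      qed
    qed
  qed
  have box: "\<exists>N. \<forall>n\<ge>N. \<forall>q<Q. d n q \<le> \<beta> ^ k * c * w q" for k
  proof (induction k)
    case 0
    then show ?case using box0 by auto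
  next
    case (Suc k)
    then obtain N where N: "\<And>n q. n \<ge> N \<Longrightarrow> q < Q \<Longrightarrow> d n q \<le> \<beta> ^ k * c * w q" by blast
    have b: "0 \<le> \<beta> ^ k * c" using \<beta>0 c0 by simp
    have "\<exists>N'. \<forall>n\<ge>N'. d n q \<le> \<beta> ^ Suc k * c * w q" if q: "q < Q" for q
    proof -
      have "\<exists>M. \<forall>n\<ge>M. n \<in> T q \<longrightarrow> N \<le> \<tau> q r n" if "r \<in> ?R q" for r
        using updating_schedule_delay[OF sched q] that by auto
      then obtain M where M: "\<And>r n. r \<in> ?R q \<Longrightarrow> n \<ge> M r \<Longrightarrow> n \<in> T q \<Longrightarrow> N \<le> \<tau> q r n" by metis
      define K where "K = Max (insert 0 (M ` ?R q))"
      have K: "M r \<le> K" if "r \<in> ?R q" for r unfolding K_def by (intro Max_ge) (use that in auto)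
      have enter: "d (Suc n) q \<le> \<beta> ^ Suc k * c * w q" if "n \<ge> K" "n \<in> T q" for n
      proof -
        have "d (Suc n) q \<le> \<beta> * (\<beta> ^ k * c * w q)"
        proof (rule step[OF q that(2) b])
          fix r assume "r < Q" "r \<noteq> q"
          then show "d (\<tau> q r n) r \<le> \<beta> ^ k * c * w r"
            using M[of r n] K[of r] that by (intro N) auto
        qed
        then show ?thesis by (simp add: mult_ac)
      qed
      \<comment> \<open>From \<open>K\<close> on, every update reads data from the current box. User
        \<open>q\<close> may still hold a value outside the smaller box until its first such update,
        which exists because \<open>T q\<close> is infinite; afterwards each step either keeps the
        value or enters the smaller box again.\<close>
      obtain n0 where n0: "n0 \<ge> K" "n0 \<in> T q"
        using sched q unfolding updating_schedule_def infinite_nat_iff_unbounded_le by blast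
      have "d n q \<le> \<beta> ^ Suc k * c * w q" if "n \<ge> Suc n0" for n
        using that
      proof (induction n rule: dec_induct)
        case base
        then show ?case by (rule enter[OF n0])
      next
        case (step n)
        then show ?case using enter[of n] n0 keep[OF q, of n] by (cases "n \<in> T q") auto
      qed
      then show ?thesis by blast
    qed
    then obtain N' where N': "\<And>q n. q < Q \<Longrightarrow> n \<ge> N' q \<Longrightarrow> d n q \<le> \<beta> ^ Suc k * c * w q" by metis
    show ?case
    proof (intro exI allI impI)
      fix n q assume n: "n \<ge> Max (insert 0 (N' ` {..<Q}))" and q: "q < Q"
      have "N' q \<le> Max (insert 0 (N' ` {..<Q}))" using q by (intro Max_ge) auto
      then show "d n q \<le> \<beta> ^ Suc k * c * w q" using n q by (intro N') auto
    qed
  qed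
  have lim: "(\<lambda>k. \<beta> ^ k * c * w q) \<longlonglongrightarrow> 0"
    by (intro tendsto_mult_left_zero LIMSEQ_realpow_zero \<beta>0 \<beta>1)
  show ?thesis
  proof (rule LIMSEQ_I)
    fix e :: real assume "e > 0"
    from LIMSEQ_D[OF lim this] obtain k where "norm (\<beta> ^ k * c * w q - 0) < e" by blast
    then have k: "\<beta> ^ k * c * w q < e" by (simp add: abs_less_iff)
    obtain N where "\<forall>n\<ge>N. d n q \<le> \<beta> ^ k * c * w q" using box[of k] q by blast
    then have "\<forall>n\<ge>N. norm (d n q - 0) < e" using k d[OF q] by force
    then show "\<exists>N. \<forall>n\<ge>N. norm (d n q - 0) < e" by blast
  qed
qed

section \<open>Fixed points in a box of variable dimension\<close>

text \<open>Bolzano-Weierstrass one coordinate at a time: each refinement preserves the limits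
  already obtained.\<close>

lemma bounded_coords_convergent_subsequence:
  fixes X :: "nat \<Rightarrow> nat \<Rightarrow> real"
  assumes "\<And>p i. i < n \<Longrightarrow> \<bar>X p i\<bar> \<le> C"
  obtains \<phi> l where "strict_mono (\<phi> :: nat \<Rightarrow> nat)" "\<And>i. i < n \<Longrightarrow> (\<lambda>p. X (\<phi> p) i) \<longlonglongrightarrow> l i"
proof -
  have "\<exists>\<phi> l. strict_mono (\<phi> :: nat \<Rightarrow> nat) \<and> (\<forall>i<m. (\<lambda>p. X (\<phi> p) i) \<longlonglongrightarrow> l i)" if "m \<le> n" for m
    using that
  proof (induction m)
    case 0
    show ?case by (intro exI[of _ id]) (auto simp: strict_mono_def)
  next
    case (Suc m)
    then obtain \<phi> l where \<phi>: "strict_mono (\<phi> :: nat \<Rightarrow> nat)" "\<And>i. i < m \<Longrightarrow> (\<lambda>p. X (\<phi> p) i) \<longlonglongrightarrow> l i" by auto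
    have "bounded (range (\<lambda>p. X (\<phi> p) m))"
      unfolding bounded_iff using assms[of m] Suc.prems by (intro exI[of _ C]) auto
    then obtain a \<psi> where \<psi>: "strict_mono \<psi>" "((\<lambda>p. X (\<phi> p) m) \<circ> \<psi>) \<longlonglongrightarrow> a"
      using bounded_imp_convergent_subsequence by blast
    have "(\<lambda>p. X ((\<phi> \<circ> \<psi>) p) i) \<longlonglongrightarrow> (l(m := a)) i" if "i < Suc m" for i
    proof (cases "i = m")
      case False
      then show ?thesis using LIMSEQ_subseq_LIMSEQ[OF \<phi>(2)[of i] \<psi>(1)] that by (simp add: o_def)
    qed (use \<psi> in \<open>simp add: o_def\<close>)
    then show ?case using strict_mono_o[OF \<phi>(1) \<psi>(1)] by blast
  qed
  then show ?thesis using that by blast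
qed

text \<open>
  The dimension \<open>n\<close> is a value, not a type, so the library version of Brouwer's theorem for
  Euclidean spaces does not apply; Kuhn's combinatorial lemma, from which that version is derived,
  does.
\<close>

lemma approximate_fixpoint_unit_cube:
  fixes f :: "(nat \<Rightarrow> real) \<Rightarrow> nat \<Rightarrow> real" and n :: nat
  defines "cube \<equiv> {x. \<forall>i<n. 0 \<le> x i \<and> x i \<le> 1}"
  assumes lip: "\<And>x y i. x \<in> cube \<Longrightarrow> y \<in> cube \<Longrightarrow> i < n \<Longrightarrow> \<bar>f x i - f y i\<bar> \<le> L * (\<Sum>j<n. \<bar>x j - y j\<bar>)"
    and maps: "\<And>x. x \<in> cube \<Longrightarrow> f x \<in> cube" and L: "0 \<le> L" and p: "0 < (p :: nat)"
  obtains x where "x \<in> cube" "\<And>i. i < n \<Longrightarrow> \<bar>f x i - x i\<bar> \<le> (L * n + 1) / p"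
proof -
  define g where "g = (\<lambda>(x :: nat \<Rightarrow> nat) i. real (x i) / real p)"
  \<comment> \<open>Label 0 says that \<open>f\<close> does not decrease the coordinate. The clause
    \<open>x i \<noteq> p\<close> enforces label 1 on the upper faces; label 0 on the lower faces is
    automatic since \<open>f\<close> is nonnegative there.\<close>
  define label where "label = (\<lambda>x i. if x i \<noteq> p \<and> g x i \<le> f (g x) i then 0 else 1 :: nat)"
  have g: "g x \<in> cube" if "\<And>i. i < n \<Longrightarrow> x i \<le> p" for x
    using that p by (simp add: cube_def g_def)
  have fcube: "0 \<le> f (g x) i" "f (g x) i \<le> 1" if "\<And>i. i < n \<Longrightarrow> x i \<le> p" "i < n" for x i
    using maps[OF g[of x]] that by (auto simp: cube_def)
  \<comment> \<open>\<open>q\<close> is the lowest corner of a grid cell that has, for every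
    coordinate, two vertices with different labels.\<close>
  obtain q where q: "\<And>i. i < n \<Longrightarrow> q i < p"
    and rs: "\<And>i. i < n \<Longrightarrow> \<exists>r s. (\<forall>j<n. q j \<le> r j \<and> r j \<le> q j + 1) \<and>
        (\<forall>j<n. q j \<le> s j \<and> s j \<le> q j + 1) \<and> label r i \<noteq> label s i"
  proof (rule kuhn_lemma[OF p, of n label])
    show "\<forall>x. (\<forall>i<n. x i \<le> p) \<longrightarrow> (\<forall>i<n. x i = 0 \<longrightarrow> label x i = 0)"
      using p fcube by (auto simp: label_def g_def)
  qed (auto simp: label_def)
  have qc: "g q \<in> cube" using q by (intro g) (auto intro: less_imp_le)
  have near: "g r \<in> cube" "\<bar>f (g q) i - f (g r) i\<bar> \<le> L * n / p" "g q i \<le> g r i" "g r i \<le> g q i + 1 / p"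
    if r: "\<forall>j<n. q j \<le> r j \<and> r j \<le> q j + 1" and i: "i < n" for r i
  proof -
    show rc: "g r \<in> cube" using q r by (intro g) (metis Suc_eq_plus1 Suc_leI le_trans)
    have gj: "g q j \<le> g r j \<and> g r j \<le> g q j + 1 / p" if "j < n" for j
    proof -
      have "real (q j) \<le> real (r j)" "real (r j) \<le> real (q j) + 1" using r that by force+
      then show ?thesis using p by (simp add: g_def divide_right_mono flip: add_divide_distrib)
    qed
    then show "g q i \<le> g r i" "g r i \<le> g q i + 1 / p" using i by auto
    have "(\<Sum>j<n. \<bar>g q j - g r j\<bar>) \<le> (\<Sum>j<n. 1 / p)"
      by (intro sum_mono) (use gj in force)
    then have "L * (\<Sum>j<n. \<bar>g q j - g r j\<bar>) \<le> L * (n / p)" using L by (intro mult_left_mono) auto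
    then show "\<bar>f (g q) i - f (g r) i\<bar> \<le> L * n / p" using lip[OF qc rc i] by simp
  qed
  show ?thesis
  proof (rule that[OF qc])
    fix i assume i: "i < n"
    obtain r s where rs: "\<forall>j<n. q j \<le> r j \<and> r j \<le> q j + 1" "\<forall>j<n. q j \<le> s j \<and> s j \<le> q j + 1"
      "label r i = 0" "label s i = 1"
      using rs[OF i] by (metis label_def)
    have "g r i \<le> f (g r) i" using rs(3) by (auto simp: label_def split: if_splits)
    moreover have "f (g s) i \<le> g s i"
    proof (cases "s i = p")
      case True
      then have "g s i = 1" using p by (simp add: g_def)
      then show ?thesis using maps[OF near(1)[OF rs(2) i]] i by (simp add: cube_def)
    next
      case False
      then show ?thesis using rs(4) by (auto simp: label_def split: if_splits)
    qed
    \<comment> \<open>Moving from a vertex to \<open>q\<close> changes \<open>f\<close> by at most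
      \<open>L * n / p\<close>; the extra \<open>1 / p\<close> is the distance in coordinate
      \<open>i\<close> from \<open>q\<close> to the vertex with label 1.\<close>
    moreover have "(L * n + 1) / p = L * n / p + 1 / p" by (rule add_divide_distrib)
    moreover have "0 < 1 / real p" using p by simp
    ultimately show "\<bar>f (g q) i - g q i\<bar> \<le> (L * n + 1) / p"
      using near(2-4)[OF rs(1) i] near(2-4)[OF rs(2) i] unfolding abs_le_iff by linarith
  qed
qed

text \<open>Approximate fixed points on ever finer grids have a convergent subsequence, and the
  Lipschitz bound carries the vanishing error to its limit.\<close>

lemma lipschitz_fixpoint_unit_cube:
  fixes f :: "(nat \<Rightarrow> real) \<Rightarrow> nat \<Rightarrow> real" and n :: nat
  defines "cube \<equiv> {x. \<forall>i<n. 0 \<le> x i \<and> x i \<le> 1}"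
  assumes lip: "\<And>x y i. x \<in> cube \<Longrightarrow> y \<in> cube \<Longrightarrow> i < n \<Longrightarrow> \<bar>f x i - f y i\<bar> \<le> L * (\<Sum>j<n. \<bar>x j - y j\<bar>)"
    and maps: "\<And>x. x \<in> cube \<Longrightarrow> f x \<in> cube" and L: "0 \<le> L"
  obtains x where "x \<in> cube" "\<And>i. i < n \<Longrightarrow> f x i = x i"
proof -
  have "\<exists>x. x \<in> cube \<and> (\<forall>i<n. \<bar>f x i - x i\<bar> \<le> (L * n + 1) / Suc p)" for p
  proof (rule approximate_fixpoint_unit_cube[of n f L "Suc p", folded cube_def])
    fix x assume "x \<in> cube" "\<And>i. i < n \<Longrightarrow> \<bar>f x i - x i\<bar> \<le> (L * n + 1) / Suc p"
    then show ?thesis by blast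
  qed (use lip maps L in auto)
  then obtain X where X: "\<And>p. X p \<in> cube" "\<And>p i. i < n \<Longrightarrow> \<bar>f (X p) i - X p i\<bar> \<le> (L * n + 1) / Suc p"
    by metis
  obtain \<phi> l where \<phi>: "strict_mono (\<phi> :: nat \<Rightarrow> nat)" "\<And>i. i < n \<Longrightarrow> (\<lambda>p. X (\<phi> p) i) \<longlonglongrightarrow> l i"
    using bounded_coords_convergent_subsequence[of n X 1] X(1) unfolding cube_def by auto
  have lc: "l \<in> cube"
    unfolding cube_def
  proof (intro CollectI allI impI conjI)
    fix i assume i: "i < n"
    show "0 \<le> l i" by (rule LIMSEQ_le_const[OF \<phi>(2)[OF i]]) (use X(1) i in \<open>auto simp: cube_def\<close>)
    show "l i \<le> 1" by (rule LIMSEQ_le_const2[OF \<phi>(2)[OF i]]) (use X(1) i in \<open>auto simp: cube_def\<close>)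
  qed
  have "f l i = l i" if i: "i < n" for i
  proof -
    have "\<bar>f l i - l i\<bar> \<le> 0"
    proof (rule LIMSEQ_le_const)
      let ?b = "\<lambda>p. L * (\<Sum>j<n. \<bar>l j - X (\<phi> p) j\<bar>) + (L * n + 1) / Suc (\<phi> p) + \<bar>X (\<phi> p) i - l i\<bar>"
      have "(\<lambda>p. (L * n + 1) / Suc p) \<longlonglongrightarrow> 0"
        using LIMSEQ_Suc[OF lim_const_over_n[of "L * n + 1"]] by simp
      then have "(\<lambda>p. (L * n + 1) / Suc (\<phi> p)) \<longlonglongrightarrow> 0"
        using LIMSEQ_subseq_LIMSEQ[OF _ \<phi>(1)] by (force simp: o_def)
      then have "?b \<longlonglongrightarrow> L * (\<Sum>j<n. \<bar>l j - l j\<bar>) + 0 + \<bar>l i - l i\<bar>"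
        by (intro tendsto_intros \<phi>(2) i) auto
      then show "?b \<longlonglongrightarrow> 0" by simp
      have "\<bar>f l i - l i\<bar> \<le> ?b p" for p
        using lip[OF lc X(1)[of "\<phi> p"] i] X(2)[OF i, of "\<phi> p"] by linarith
      then show "\<exists>N. \<forall>p\<ge>N. \<bar>f l i - l i\<bar> \<le> ?b p" by blast
    qed
    then show ?thesis by simp
  qed
  then show ?thesis using that lc by blast
qed

text \<open>Transports the result to an arbitrary finite index set and a symmetric box, since the
  coordinates of a profile are tuples whose ranges depend on the user. The affine map
  \<open>E\<close> goes from the cube to the box, and \<open>f\<close> is \<open>F\<close>
  conjugated by it.\<close>

theorem lipschitz_fixpoint_box:
  fixes F :: "('i \<Rightarrow> real) \<Rightarrow> 'i \<Rightarrow> real" and I :: "'i set" and C :: real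
  assumes I: "finite I" and C: "0 < C" and L: "0 \<le> L"
  defines "K \<equiv> {x. \<forall>i\<in>I. \<bar>x i\<bar> \<le> C}"
  assumes lip: "\<And>x y i. x \<in> K \<Longrightarrow> y \<in> K \<Longrightarrow> i \<in> I \<Longrightarrow> \<bar>F x i - F y i\<bar> \<le> L * (\<Sum>j\<in>I. \<bar>x j - y j\<bar>)"
    and maps: "\<And>x. x \<in> K \<Longrightarrow> F x \<in> K"
  obtains x where "x \<in> K" "\<And>i. i \<in> I \<Longrightarrow> F x i = x i"
proof -
  obtain h where h: "bij_betw h {..<card I} I"
    using ex_bij_betw_nat_finite[OF I] by (auto simp: lessThan_atLeast0)
  define n where "n = card I"
  define g where "g = inv_into {..<n} h"
  have g: "bij_betw g I {..<n}" unfolding g_def n_def by (rule bij_betw_inv_into[OF h])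
  have hg: "g (h j) = j" "h j \<in> I" if "j < n" for j
    using h that unfolding g_def n_def by (auto simp: bij_betw_def)
  have gh: "h (g i) = i" "g i < n" if "i \<in> I" for i
    using h g that unfolding g_def n_def by (auto simp: bij_betw_def f_inv_into_f)
  define E where "E = (\<lambda>(y :: nat \<Rightarrow> real) i. C * (2 * y (g i) - 1))"
  define f where "f = (\<lambda>y j. (F (E y) (h j) / C + 1) / 2)"
  let ?cube = "{x. \<forall>i<n. 0 \<le> x i \<and> x i \<le> (1::real)}"
  have E: "E y \<in> K" if "y \<in> ?cube" for y
  proof -
    have "\<bar>2 * y (g i) - 1\<bar> \<le> 1" if "i \<in> I" for i using \<open>y \<in> ?cube\<close> gh(2)[OF that] by (auto simp: abs_le_iff)
    then show ?thesis using C by (simp add: K_def E_def abs_mult mult_left_le)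
  qed
  obtain y where y: "y \<in> ?cube" "\<And>j. j < n \<Longrightarrow> f y j = y j"
  proof (rule lipschitz_fixpoint_unit_cube[of n f L])
    fix y assume y: "y \<in> ?cube"
    show "f y \<in> ?cube"
    proof (intro CollectI allI impI)
      fix j assume "j < n"
      then have "\<bar>F (E y) (h j)\<bar> \<le> C" using maps[OF E[OF y]] hg by (auto simp: K_def)
      then show "0 \<le> f y j \<and> f y j \<le> 1" using C by (auto simp: f_def abs_le_iff field_simps)
    qed
  next
    fix x y j assume xy: "x \<in> ?cube" "y \<in> ?cube" and j: "j < n"
    have "f x j - f y j = (F (E x) (h j) - F (E y) (h j)) / (2 * C)"
      using C by (simp add: f_def field_simps)
    then have "\<bar>f x j - f y j\<bar> = \<bar>F (E x) (h j) - F (E y) (h j)\<bar> / (2 * C)" using C by simp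
    also have "\<dots> \<le> (L * (\<Sum>i\<in>I. \<bar>E x i - E y i\<bar>)) / (2 * C)"
      using C by (intro divide_right_mono lip E xy hg j) auto
    also have "(\<Sum>i\<in>I. \<bar>E x i - E y i\<bar>) = (\<Sum>i\<in>I. 2 * C * \<bar>x (g i) - y (g i)\<bar>)"
    proof (rule sum.cong[OF refl])
      fix i
      have "E x i - E y i = 2 * C * (x (g i) - y (g i))" by (simp add: E_def algebra_simps)
      then show "\<bar>E x i - E y i\<bar> = 2 * C * \<bar>x (g i) - y (g i)\<bar>" using C by (simp add: abs_mult)
    qed
    also have "\<dots> = 2 * C * (\<Sum>j<n. \<bar>x j - y j\<bar>)"
      unfolding sum_distrib_left[symmetric] sum.reindex_bij_betw[OF g, of "\<lambda>j. \<bar>x j - y j\<bar>"] ..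
    finally show "\<bar>f x j - f y j\<bar> \<le> L * (\<Sum>j<n. \<bar>x j - y j\<bar>)" using C by (simp add: field_simps)
  qed (use L in auto)
  show ?thesis
  proof (rule that[OF E[OF y(1)]])
    fix i assume i: "i \<in> I"
    show "F (E y) i = E y i"
      using y(2)[OF gh(2)[OF i]] gh(1)[OF i] C by (simp add: f_def E_def field_simps)
  qed
qed

section \<open>The game\<close>

text \<open>Entrywise for the same reason as in \<open>interference_cov\<close>; the carrier is
  explicit, so the empty sum is a zero matrix of known size and induction over \<open>R\<close>
  works.\<close>

definition mat_sum :: "nat \<Rightarrow> nat \<Rightarrow> 'r set \<Rightarrow> ('r \<Rightarrow> complex mat) \<Rightarrow> complex mat" where
  "mat_sum n m R F = mat n m (\<lambda>(i, j). \<Sum>r\<in>R. F r $$ (i, j))"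

lemma mat_sum_carrier [simp]: "mat_sum n m R F \<in> carrier_mat n m"
  by (simp add: mat_sum_def)

lemma mat_sum_empty: "mat_sum n m {} F = 0\<^sub>m n m"
  by (intro eq_matI) (auto simp: mat_sum_def)

lemma mat_sum_insert:
  assumes "finite R" "r \<notin> R" "F r \<in> carrier_mat n m"
  shows "mat_sum n m (insert r R) F = F r + mat_sum n m R F"
  using assms by (intro eq_matI) (auto simp: mat_sum_def)

lemma mat_sum_conj:
  assumes "finite R" "\<And>r. r \<in> R \<Longrightarrow> F r \<in> carrier_mat m m" and G: "G \<in> carrier_mat n m"
  shows "G * mat_sum m m R F * mat_adjoint G = mat_sum n n R (\<lambda>r. G * F r * mat_adjoint G)"
  using assms(1,2)
proof (induction rule: finite_induct)
  case empty
  then show ?case using G by (simp add: mat_sum_empty)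
next
  case (insert r R)
  have F: "F r \<in> carrier_mat m m" using insert by simp
  have GH: "mat_adjoint G \<in> carrier_mat m n" using G by simp
  have GFG: "G * F r * mat_adjoint G \<in> carrier_mat n n" by (rule mult_carrier_mat[OF mult_carrier_mat[OF G F] GH])
  have "G * mat_sum m m (insert r R) F * mat_adjoint G = (G * F r + G * mat_sum m m R F) * mat_adjoint G"
    by (simp only: mat_sum_insert[where F = F, OF insert.hyps F] mult_add_distrib_mat[OF G F mat_sum_carrier])
  also have "\<dots> = G * F r * mat_adjoint G + G * mat_sum m m R F * mat_adjoint G"
    by (rule add_mult_distrib_mat[OF mult_carrier_mat[OF G F] mult_carrier_mat[OF G mat_sum_carrier] GH])
  also have "\<dots> = mat_sum n n (insert r R) (\<lambda>r. G * F r * mat_adjoint G)"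
    using insert mat_sum_insert[where F = "\<lambda>r. G * F r * mat_adjoint G", OF insert.hyps GFG] by simp
  finally show ?case .
qed

lemma pos_semidef_zero: "pos_semidef n (0\<^sub>m n n)"
proof -
  have "mat_diag n (\<lambda>_. complex_of_real 0) = 0\<^sub>m n n" by (rule eq_matI) (auto simp: mat_diag_def)
  then show ?thesis using pos_semidef_mat_diag[of n "\<lambda>_. 0"] by simp
qed

lemma pos_semidef_add:
  assumes "pos_semidef n A" "pos_semidef n B"
  shows "pos_semidef n (A + B)"
  using assms hermitian_add[of n A B] unfolding pos_semidef_def
  by (auto simp: hermitian_mat_def add_mult_distrib_mat_vec[of _ n n] add_scalar_prod_distrib[of _ n])

lemma pos_semidef_mat_sum:
  assumes "finite R" "\<And>r. r \<in> R \<Longrightarrow> pos_semidef n (F r)"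
  shows "pos_semidef n (mat_sum n n R F)"
  using assms
proof (induction rule: finite_induct)
  case (insert r R)
  then have "F r \<in> carrier_mat n n" by (simp add: pos_semidef_def hermitian_mat_def)
  then show ?case using insert by (simp add: mat_sum_insert pos_semidef_add)
qed (simp add: mat_sum_empty pos_semidef_zero)

lemma cmod_index_le_frob_norm:
  assumes "i < dim_row A" "j < dim_col A"
  shows "cmod (A $$ (i, j)) \<le> frob_norm A"
  using member_le_L2_set[of "{..<dim_row A} \<times> {..<dim_col A}" "(i, j)" "\<lambda>(i, j). cmod (A $$ (i, j))"] assms
  by (simp add: frob_norm_eq_L2_set)

lemma frob_norm_le_of_entries:
  assumes "A \<in> carrier_mat n m" "\<And>i j. i < n \<Longrightarrow> j < m \<Longrightarrow> cmod (A $$ (i, j)) \<le> D"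
  shows "frob_norm A \<le> real n * real m * D"
proof -
  have "frob_norm A \<le> (\<Sum>(i, j)\<in>{..<n} \<times> {..<m}. cmod (A $$ (i, j)))"
    using assms(1) L2_set_le_sum[of "{..<n} \<times> {..<m}" "\<lambda>(i, j). cmod (A $$ (i, j))"]
    by (simp add: frob_norm_eq_L2_set case_prod_unfold)
  also have "\<dots> \<le> (\<Sum>(i, j)\<in>{..<n} \<times> {..<m}. D)"
    by (intro sum_mono) (use assms(2) in auto)
  also have "\<dots> = real n * real m * D" by (simp add: case_prod_unfold)
  finally show ?thesis .
qed

text \<open>The eigenvalues are nonnegative with sum \<open>p\<close>, so each is at most
  \<open>p\<close> and their squares sum to at most \<open>p\<^sup>2\<close>. This fixes the size of
  the box for the fixed point theorem.\<close>

lemma frob_norm_cov_set_le: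
  assumes Z: "Z \<in> cov_set n p" and "p \<ge> 0"
  shows "frob_norm Z \<le> p"
proof -
  have herm: "hermitian_mat n Z" using Z by (simp add: cov_set_def pos_semidef_def)
  obtain U d where U: "U \<in> carrier_mat n n" and U1: "mat_adjoint U * U = 1\<^sub>m n" and U2: "U * mat_adjoint U = 1\<^sub>m n"
    and eq: "Z = U * mat_diag n (\<lambda>i. complex_of_real (d i)) * mat_adjoint U"
    using hermitian_spectral[OF herm] .
  let ?D = "mat_diag n (\<lambda>i. complex_of_real (d i))"
  have "mat_adjoint U * Z * mat_adjoint (mat_adjoint U) = ?D"
    unfolding eq using U U1 by (simp add: unitary_conj_cancel)
  then have DS: "?D \<in> cov_set n p"
    using cov_set_unitary_conj[OF Z mat_adjoint_carrier[OF U]] U2 by simp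
  then have d: "0 \<le> d i" if "i < n" for i
    using pos_semidef_diag_nonneg[of n ?D i] that by (simp add: cov_set_def mat_diag_def)
  have sd: "(\<Sum>i<n. d i) = p"
    using DS by (simp add: cov_set_def mat_tr_def mat_diag_def flip: of_real_sum)
  have "(frob_norm Z)\<^sup>2 = frob_inner ?D ?D"
    unfolding frob_norm_square eq by (rule frob_inner_unitary_conj[OF U U1]) auto
  also have "\<dots> = (\<Sum>i<n. d i * d i)"
    by (simp add: frob_inner_mat_diag_left) (simp add: mat_diag_def)
  also have "\<dots> \<le> (\<Sum>i<n. d i * p)"
    unfolding sd[symmetric] by (intro sum_mono mult_left_mono member_le_sum) (use d in auto)
  also have "\<dots> = p\<^sup>2" by (simp add: sum_distrib_right[symmetric] sd power2_eq_square)
  finally show ?thesis using \<open>p \<ge> 0\<close> by (rule power2_le_imp_le)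
qed

locale mimo_game =
  fixes Q :: nat
    and nR nT :: "nat \<Rightarrow> nat"
    and H :: "nat \<Rightarrow> nat \<Rightarrow> complex mat"
    and Rn V :: "nat \<Rightarrow> complex mat"
    and P :: "nat \<Rightarrow> real"
  assumes H: "\<And>r q. r < Q \<Longrightarrow> q < Q \<Longrightarrow> H r q \<in> carrier_mat (nR q) (nT r)"
    and H_nz: "\<And>q. q < Q \<Longrightarrow> H q q \<noteq> 0\<^sub>m (nR q) (nT q)"
    and Rn: "\<And>q. q < Q \<Longrightarrow> pos_def (nR q) (Rn q)"
    and P: "\<And>q. q < Q \<Longrightarrow> P q > 0"
    and V: "\<And>q. q < Q \<Longrightarrow> reduction_basis (H q q) (V q)"
begin

abbreviation Hb where "Hb \<equiv> reduced_channel H V"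
abbreviation n where "n q \<equiv> mat_rank (H q q)"
abbreviation G where "G q \<equiv> pinv (Hb q q)"
abbreviation K where "K q \<equiv> cov_set (n q) (P q)"
abbreviation M where "M q X \<equiv> effective_cov Q Hb Rn q X"
abbreviation BR where "BR q X \<equiv> best_response Q Hb Rn P q X"
abbreviation s where "s q r \<equiv> interference_matrix Q H $$ (q, r)"
abbreviation others where "others q \<equiv> {..<Q} - {q}"

definition feasible :: "(nat \<Rightarrow> complex mat) \<Rightarrow> bool" where
  "feasible X \<longleftrightarrow> (\<forall>r<Q. X r \<in> K r)"

text \<open>The profile perceived in an asynchronous run mixes iterations, and the schedule
  constrains \<open>\<tau> q r\<close> only for \<open>r \<noteq> q\<close>; hence only the
  opponents' components are known to be feasible.\<close>

definition feasible_against :: "nat \<Rightarrow> (nat \<Rightarrow> complex mat) \<Rightarrow> bool" where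
  "feasible_against q X \<longleftrightarrow> (\<forall>r\<in>others q. X r \<in> K r)"

lemma feasible_against_carrier:
  "feasible_against q X \<Longrightarrow> r \<in> others q \<Longrightarrow> X r \<in> carrier_mat (n r) (n r)"
  unfolding feasible_against_def by (blast intro: cov_set_carrier)

lemma feasible_imp_against: "feasible X \<Longrightarrow> feasible_against q X"
  by (auto simp: feasible_def feasible_against_def)

lemma V_carrier: "q < Q \<Longrightarrow> V q \<in> carrier_mat (nT q) (n q)"
  using V[of q] H[of q q] by (auto simp: reduction_basis_def)

lemma V_isometry: "q < Q \<Longrightarrow> mat_adjoint (V q) * V q = 1\<^sub>m (n q)"
  using V[of q] by (auto simp: reduction_basis_def)

lemma Hb_carrier: "q < Q \<Longrightarrow> r < Q \<Longrightarrow> Hb r q \<in> carrier_mat (nR q) (n r)"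
  using H[of r q] V_carrier[of r] by (simp add: reduced_channel_def)

lemma dim_col_Hb: "q < Q \<Longrightarrow> dim_col (Hb q q) = n q"
  using Hb_carrier[of q q] by simp

lemma n_pos: "q < Q \<Longrightarrow> n q > 0"
  using mat_rank_pos[OF H V H_nz] by blast

lemma strategy_set_eq: "q < Q \<Longrightarrow> strategy_set Hb P q = K q"
  by (simp add: strategy_set_def cov_set_def dim_col_Hb)

lemma G_carrier: "q < Q \<Longrightarrow> G q \<in> carrier_mat (n q) (nR q)"
  and G_left_inverse: "q < Q \<Longrightarrow> G q * Hb q q = 1\<^sub>m (n q)"
  and pinv_H_carrier: "q < Q \<Longrightarrow> pinv (H q q) \<in> carrier_mat (nT q) (nR q)"
  and G_eq: "q < Q \<Longrightarrow> G q = mat_adjoint (V q) * pinv (H q q)"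
  using reduction_basis_pinv[OF H V, of q] by (simp_all add: reduced_channel_def)

lemma s_nonneg:
  assumes "q < Q" "r < Q"
  shows "0 \<le> s q r"
proof (cases "r = q")
  case False
  \<comment> \<open>The spectral radius is a maximum over the spectrum, which is empty in dimension
    0; a nonzero direct channel excludes that case.\<close>
  have "nT r > 0"
  proof (rule ccontr)
    assume "\<not> nT r > 0"
    then have "H r r = 0\<^sub>m (nR r) (nT r)" using H[OF assms(2,2)] by (intro eq_matI) auto
    then show False using H_nz[OF assms(2)] by simp
  qed
  then show ?thesis
    using assms False H[OF assms(2,1)] pinv_H_carrier[OF assms(1)]
    by (auto simp: interference_matrix_def intro!: spectral_radius_nonneg[of _ "nT r"])
qed (use assms in \<open>simp add: interference_matrix_def\<close>)

text \<open>Factor \<open>G q * Hb r q\<close> as \<open>V\<^sub>q\<^sup>H C V\<^sub>r\<close> with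
  \<open>C = pinv H\<^sub>q\<^sub>q * H\<^sub>r\<^sub>q\<close>. The outer factors do not increase
  norms, and \<open>C\<^sup>H C\<close> is exactly the matrix whose spectral radius enters
  \<open>S\<close>.\<close>

lemma vec_sq_cross_channel_le:
  assumes q: "q < Q" and r: "r < Q" "r \<noteq> q" and v: "v \<in> carrier_vec (n r)"
  shows "vec_sq ((G q * Hb r q) *\<^sub>v v) \<le> s q r * vec_sq v"
proof -
  define C where "C = pinv (H q q) * H r q"
  have pc: "pinv (H q q) \<in> carrier_mat (nT q) (nR q)" by (rule pinv_H_carrier[OF q])
  have hc: "H r q \<in> carrier_mat (nR q) (nT r)" by (rule H[OF r(1) q])
  have C: "C \<in> carrier_mat (nT q) (nT r)" unfolding C_def using pc hc by simp
  have VHq: "mat_adjoint (V q) \<in> carrier_mat (n q) (nT q)" using V_carrier[OF q] by simp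
  have CV: "C * V r \<in> carrier_mat (nT q) (n r)" using C V_carrier[OF r(1)] by simp
  have Vv: "V r *\<^sub>v v \<in> carrier_vec (nT r)" using V_carrier[OF r(1)] v by auto
  have "G q * Hb r q = mat_adjoint (V q) * (pinv (H q q) * (H r q * V r))"
    unfolding G_eq[OF q] reduced_channel_def[of H V r q]
    by (rule assoc_mult_mat[OF VHq pc mult_carrier_mat[OF hc V_carrier[OF r(1)]]])
  also have "pinv (H q q) * (H r q * V r) = C * V r"
    unfolding C_def by (rule assoc_mult_mat[OF pc hc V_carrier[OF r(1)], symmetric])
  finally have "(G q * Hb r q) *\<^sub>v v = mat_adjoint (V q) *\<^sub>v (C *\<^sub>v (V r *\<^sub>v v))"
    using assoc_mult_mat_vec[OF VHq CV v] assoc_mult_mat_vec[OF C V_carrier[OF r(1)] v] by simp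
  then have "vec_sq ((G q * Hb r q) *\<^sub>v v) \<le> vec_sq (C *\<^sub>v (V r *\<^sub>v v))"
    using vec_sq_adjoint_isometry_le[OF V_carrier[OF q] V_isometry[OF q] mult_mat_vec_carrier[OF C Vv]] by simp
  also have "\<dots> \<le> spectral_radius (mat_adjoint C * C) * vec_sq (V r *\<^sub>v v)"
    by (rule vec_sq_mult_le_spectral_radius[OF C Vv])
  also have "vec_sq (V r *\<^sub>v v) = vec_sq v"
    by (rule vec_sq_isometry[OF V_carrier[OF r(1)] V_isometry[OF r(1)] v])
  also have "mat_adjoint C * C = mat_adjoint (H r q) * mat_adjoint (pinv (H q q)) * pinv (H q q) * H r q"
    unfolding C_def mat_adjoint_mult[OF pc hc]
    by (rule assoc_mult_mat[of _ "nT r" "nT q" _ "nR q" _ "nT r", symmetric]) (use pc hc in auto)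
  finally show ?thesis using q r by (simp add: interference_matrix_def)
qed

lemma interference_cov_eq:
  assumes q: "q < Q"
  shows "interference_cov Q Hb Rn q X
    = mat_sum (nR q) (nR q) (others q) (\<lambda>r. Hb r q * X r * mat_adjoint (Hb r q)) + Rn q"
proof -
  have "Rn q \<in> carrier_mat (nR q) (nR q)" using Rn[OF q] by (simp add: pos_def_def hermitian_mat_def)
  then show ?thesis
    by (intro eq_matI) (auto simp: interference_cov_def mat_sum_def add.commute)
qed

lemma interference_cov_pos_def:
  assumes q: "q < Q" and X: "feasible_against q X"
  shows "pos_def (nR q) (interference_cov Q Hb Rn q X)"
  unfolding interference_cov_eq[OF q]
proof (intro pos_semidef_add_pos_def pos_semidef_mat_sum Rn q)
  fix r assume "r \<in> others q"
  then show "pos_semidef (nR q) (Hb r q * X r * mat_adjoint (Hb r q))"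
    using X Hb_carrier[OF q, of r] by (intro pos_semidef_conj) (auto simp: feasible_against_def cov_set_def)
qed simp

text \<open>Taking adjoints in \<open>G q * Hb q q = 1\<close> gives a left inverse of
  \<open>mat_adjoint (G q)\<close>, which is therefore injective, and conjugation keeps the noise
  floor strictly positive.\<close>

lemma M_pos_def:
  assumes q: "q < Q" and X: "feasible_against q X"
  shows "pos_def (n q) (M q X)"
  unfolding effective_cov_def
proof (rule pos_def_conj[OF interference_cov_pos_def[OF q X] G_carrier[OF q]])
  fix v assume v: "v \<in> carrier_vec (n q)" "mat_adjoint (G q) *\<^sub>v v = 0\<^sub>v (nR q)"
  have c: "mat_adjoint (Hb q q) \<in> carrier_mat (n q) (nR q)" "mat_adjoint (G q) \<in> carrier_mat (nR q) (n q)"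
    using Hb_carrier[OF q q] G_carrier[OF q] by auto
  have "mat_adjoint (Hb q q) * mat_adjoint (G q) = 1\<^sub>m (n q)"
    using arg_cong[OF G_left_inverse[OF q], of mat_adjoint]
    by (simp add: mat_adjoint_mult[OF G_carrier[OF q] Hb_carrier[OF q q]])
  then have "v = mat_adjoint (Hb q q) *\<^sub>v (mat_adjoint (G q) *\<^sub>v v)"
    using assoc_mult_mat_vec[OF c v(1)] v(1) by simp
  then show "v = 0\<^sub>v (n q)" unfolding v(2) using mult_mat_zero_vec[OF c(1)] by simp
qed

lemma M_hermitian:
  assumes "q < Q" "feasible_against q X"
  shows "hermitian_mat (n q) (M q X)"
  using M_pos_def[OF assms] by (simp add: pos_def_def)

text \<open>Displays the effective covariance as an affine function of the opponents' strategies, so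
  that the noise term cancels in differences.\<close>

lemma M_eq:
  assumes q: "q < Q" and X: "feasible_against q X"
  shows "M q X = mat_sum (n q) (n q) (others q) (\<lambda>r. (G q * Hb r q) * X r * mat_adjoint (G q * Hb r q))
    + G q * Rn q * mat_adjoint (G q)"
proof -
  let ?F = "\<lambda>r. Hb r q * X r * mat_adjoint (Hb r q)"
  have Rc: "Rn q \<in> carrier_mat (nR q) (nR q)" using Rn[OF q] by (simp add: pos_def_def hermitian_mat_def)
  have Gc: "G q \<in> carrier_mat (n q) (nR q)" "mat_adjoint (G q) \<in> carrier_mat (nR q) (n q)"
    using G_carrier[OF q] by auto
  have F: "?F r \<in> carrier_mat (nR q) (nR q)" if "r \<in> others q" for r
  proof -
    have hc: "Hb r q \<in> carrier_mat (nR q) (n r)" and xc: "X r \<in> carrier_mat (n r) (n r)"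
      using that Hb_carrier[OF q, of r] feasible_against_carrier[OF X that] by auto
    show ?thesis by (rule mult_carrier_mat[OF mult_carrier_mat[OF hc xc] mat_adjoint_carrier[OF hc]])
  qed
  have S: "mat_sum (nR q) (nR q) (others q) ?F \<in> carrier_mat (nR q) (nR q)" by simp
  have "M q X = G q * mat_sum (nR q) (nR q) (others q) ?F * mat_adjoint (G q) + G q * Rn q * mat_adjoint (G q)"
    unfolding effective_cov_def interference_cov_eq[OF q]
    by (simp only: mult_add_distrib_mat[OF Gc(1) S Rc]
        add_mult_distrib_mat[OF mult_carrier_mat[OF Gc(1) S] mult_carrier_mat[OF Gc(1) Rc] Gc(2)])
  also have "G q * mat_sum (nR q) (nR q) (others q) ?F * mat_adjoint (G q)
      = mat_sum (n q) (n q) (others q) (\<lambda>r. G q * ?F r * mat_adjoint (G q))"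
    by (rule mat_sum_conj[OF _ F Gc(1)]) auto
  also have "\<dots> = mat_sum (n q) (n q) (others q) (\<lambda>r. (G q * Hb r q) * X r * mat_adjoint (G q * Hb r q))"
  proof -
    have "G q * ?F r * mat_adjoint (G q) = (G q * Hb r q) * X r * mat_adjoint (G q * Hb r q)" if r: "r \<in> others q" for r
    proof -
      have hc: "Hb r q \<in> carrier_mat (nR q) (n r)" "mat_adjoint (Hb r q) \<in> carrier_mat (n r) (nR q)"
        and xc: "X r \<in> carrier_mat (n r) (n r)"
        using Hb_carrier[OF q, of r] r feasible_against_carrier[OF X r] by auto
      have "G q * ?F r = G q * Hb r q * X r * mat_adjoint (Hb r q)"
        using assoc_mult_mat[OF Gc(1) mult_carrier_mat[OF hc(1) xc] hc(2)] assoc_mult_mat[OF Gc(1) hc(1) xc]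
        by simp
      then show ?thesis
        unfolding mat_adjoint_mult[OF Gc(1) hc(1)]
        using assoc_mult_mat[OF mult_carrier_mat[OF mult_carrier_mat[OF Gc(1) hc(1)] xc] hc(2) Gc(2)] by simp
    qed
    then show ?thesis unfolding mat_sum_def by (intro cong_mat refl) auto
  qed
  finally show ?thesis .
qed

lemma BR_eq: "q < Q \<Longrightarrow> BR q X = frob_proj (K q) (- M q X)"
  by (simp add: best_response_def strategy_set_eq)

lemma BR_feasible:
  assumes "q < Q" "feasible_against q X"
  shows "BR q X \<in> K q"
  unfolding BR_eq[OF assms(1)]
  by (intro frob_proj_cov_set(1) hermitian_uminus M_hermitian assms n_pos P)

lemma BR_lipschitz:
  assumes q: "q < Q" and X: "feasible_against q X" and Y: "feasible_against q Y"
  shows "frob_norm (BR q X - BR q Y) \<le> (\<Sum>r\<in>others q. s q r * frob_norm (X r - Y r))"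
proof -
  define A where "A = (\<lambda>r. G q * Hb r q)"
  have A: "A r \<in> carrier_mat (n q) (n r)" if "r \<in> others q" for r
    using that G_carrier[OF q] Hb_carrier[OF q, of r] by (auto simp: A_def)
  have c: "X r \<in> carrier_mat (n r) (n r)" "Y r \<in> carrier_mat (n r) (n r)" "Y r - X r \<in> carrier_mat (n r) (n r)"
    if "r \<in> others q" for r
    using feasible_against_carrier[OF X that] feasible_against_carrier[OF Y that]
    by (auto intro: minus_carrier_mat)
  have Mc: "M q X \<in> carrier_mat (n q) (n q)" "M q Y \<in> carrier_mat (n q) (n q)"
    using M_hermitian[OF q] X Y by (auto simp: hermitian_mat_def)
  have "frob_norm (BR q X - BR q Y) \<le> frob_norm (- M q X - - M q Y)"
    unfolding BR_eq[OF q]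
    by (intro frob_proj_nonexpansive hermitian_uminus M_hermitian q X Y n_pos P)
  \<comment> \<open>The projected matrices carry a minus sign, which reverses the difference to
    \<open>Y r - X r\<close>; the norm undoes this at the end.\<close>
  also have "- M q X - - M q Y = mat_sum (n q) (n q) (others q) (\<lambda>r. A r * (Y r - X r) * mat_adjoint (A r))"
  proof (rule eq_matI)
    let ?S = "mat_sum (n q) (n q) (others q) (\<lambda>r. A r * (Y r - X r) * mat_adjoint (A r))"
    fix i j assume "i < dim_row ?S" "j < dim_col ?S"
    then have ij: "i < n q" "j < n q" by (simp_all add: mat_sum_def)
    have "(A r * (Y r - X r) * mat_adjoint (A r)) $$ (i, j)
        = (A r * Y r * mat_adjoint (A r)) $$ (i, j) - (A r * X r * mat_adjoint (A r)) $$ (i, j)" if r: "r \<in> others q" for r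
    proof -
      have AH: "mat_adjoint (A r) \<in> carrier_mat (n r) (n q)" using A[OF r] by simp
      have "A r * (Y r - X r) * mat_adjoint (A r) = A r * Y r * mat_adjoint (A r) - A r * X r * mat_adjoint (A r)"
        by (simp only: mult_minus_distrib_mat[OF A[OF r] c(2,1)[OF r]]
            minus_mult_distrib_mat[OF mult_carrier_mat[OF A[OF r] c(2)[OF r]] mult_carrier_mat[OF A[OF r] c(1)[OF r]] AH])
      then show ?thesis using ij A[OF r] c[OF r] by simp
    qed
    then have "?S $$ (i, j) = (\<Sum>r\<in>others q. (A r * Y r * mat_adjoint (A r)) $$ (i, j))
        - (\<Sum>r\<in>others q. (A r * X r * mat_adjoint (A r)) $$ (i, j))"
      using ij by (simp add: mat_sum_def sum_subtractf del: index_mult_mat(1))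
    moreover have "M q X' $$ (i, j) = (\<Sum>r\<in>others q. (A r * X' r * mat_adjoint (A r)) $$ (i, j))
        + (G q * Rn q * mat_adjoint (G q)) $$ (i, j)" if "feasible_against q X'" for X'
      unfolding M_eq[OF q that] A_def
      using ij G_carrier[OF q] by (subst index_add_mat) (auto simp: mat_sum_def simp del: index_mult_mat(1))
    ultimately show "(- M q X - - M q Y) $$ (i, j) = ?S $$ (i, j)"
      using ij Mc X Y by simp
  qed (use Mc in \<open>auto simp: mat_sum_def\<close>)
  also have "frob_norm \<dots> \<le> (\<Sum>r\<in>others q. frob_norm (A r * (Y r - X r) * mat_adjoint (A r)))"
    unfolding mat_sum_def
    by (intro frob_norm_sum_le mult_carrier_mat[OF mult_carrier_mat[OF A c(3)] mat_adjoint_carrier[OF A]]) auto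
  also have "\<dots> \<le> (\<Sum>r\<in>others q. s q r * frob_norm (Y r - X r))"
  proof (rule sum_mono)
    fix r assume r: "r \<in> others q"
    show "frob_norm (A r * (Y r - X r) * mat_adjoint (A r)) \<le> s q r * frob_norm (Y r - X r)"
      using r q vec_sq_cross_channel_le[OF q, of r]
      by (intro frob_norm_conj_le[OF A[OF r] c(3)[OF r]] s_nonneg) (auto simp: A_def)
  qed
  also have "\<dots> = (\<Sum>r\<in>others q. s q r * frob_norm (X r - Y r))"
  proof (rule sum.cong[OF refl])
    fix r assume "r \<in> others q"
    from c[OF this] show "s q r * frob_norm (Y r - X r) = s q r * frob_norm (X r - Y r)"
      by (simp add: frob_norm_def norm_minus_commute)
  qed
  finally show ?thesis .
qed

text \<open>\<open>det (1 + M\<^sup>-\<^sup>1 Z) = det M\<^sup>-\<^sup>1 * det (M + Z)\<close>, so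
  \<open>\<kappa> = 1 / det M\<close> is independent of \<open>Z\<close> and maximising the rate
  means maximising \<open>det (M + Z)\<close>.\<close>

lemma rate_eq:
  assumes q: "q < Q" and X: "feasible_against q X"
  obtains \<kappa> where "\<kappa> > 0"
    "\<And>Z. Z \<in> K q \<Longrightarrow> rate Q Hb Rn q Z X = ln (\<kappa> * Re (det (Z - (- M q X))))"
    "\<And>Z. Z \<in> K q \<Longrightarrow> Re (det (Z - (- M q X))) > 0"
proof -
  have pd: "pos_def (n q) (M q X)" by (rule M_pos_def[OF q X])
  have Mc: "M q X \<in> carrier_mat (n q) (n q)" using pd by (simp add: pos_def_def hermitian_mat_def)
  obtain B where B: "mat_inverse (M q X) = Some B" "M q X * B = 1\<^sub>m (n q)" "B * M q X = 1\<^sub>m (n q)"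
    "B \<in> carrier_mat (n q) (n q)"
    using pos_def_mat_inverse[OF pd] .
  have dM: "det (M q X) = of_real (Re (det (M q X)))" "Re (det (M q X)) > 0"
    using pos_def_det[OF pd] by (simp_all add: complex_eq_iff)
  have "det B * det (M q X) = 1" using det_mult[OF B(4) Mc] B(3) by simp
  then have dB: "det B = of_real (1 / Re (det (M q X)))"
    using dM by (metis mult_not_zero nonzero_eq_divide_eq of_real_1 of_real_divide zero_neq_one)
  have ZM: "Z - (- M q X) = Z + M q X" if "Z \<in> K q" for Z
    using Mc cov_set_carrier[OF that] by (intro eq_matI) auto
  have pdZ: "pos_def (n q) (Z - (- M q X))" if "Z \<in> K q" for Z
    unfolding ZM[OF that] using that pd by (intro pos_semidef_add_pos_def) (auto simp: cov_set_def)
  show ?thesis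
  proof (rule that[of "1 / Re (det (M q X))"])
    fix Z assume Z: "Z \<in> K q"
    have Zc: "Z \<in> carrier_mat (n q) (n q)" by (rule cov_set_carrier[OF Z])
    have "1\<^sub>m (n q) + B * Z = B * (Z + M q X)"
      using mult_add_distrib_mat[OF B(4) Zc Mc] B Zc comm_add_mat[of "1\<^sub>m (n q)" "n q" "n q" "B * Z"] by simp
    then have "det (1\<^sub>m (n q) + B * Z) = det B * det (Z - (- M q X))"
      using det_mult[OF B(4), of "Z + M q X"] Zc Mc ZM[OF Z] by simp
    then show "rate Q Hb Rn q Z X = ln (1 / Re (det (M q X)) * Re (det (Z - (- M q X))))"
      unfolding rate_def dim_col_Hb[OF q] B(1) option.sel dB by (simp del: of_real_divide)
    show "Re (det (Z - (- M q X))) > 0" by (rule pos_def_det(2)[OF pdZ[OF Z]])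
  qed (use dM in simp)
qed

text \<open>The first claim makes fixed points of the best response equilibria; the second,
  uniqueness of the maximiser, makes equilibria fixed points.\<close>

lemma BR_maximizes_rate:
  assumes q: "q < Q" and X: "feasible_against q X" and Z: "Z \<in> K q"
  shows "rate Q Hb Rn q Z X \<le> rate Q Hb Rn q (BR q X) X"
    and "rate Q Hb Rn q (BR q X) X \<le> rate Q Hb Rn q Z X \<Longrightarrow> Z = BR q X"
proof -
  obtain \<kappa> where \<kappa>: "\<kappa> > 0"
    "\<And>Z. Z \<in> K q \<Longrightarrow> rate Q Hb Rn q Z X = ln (\<kappa> * Re (det (Z - (- M q X))))"
    "\<And>Z. Z \<in> K q \<Longrightarrow> Re (det (Z - (- M q X))) > 0"
    using rate_eq[OF q X] by metis
  have B: "BR q X \<in> K q" by (rule BR_feasible[OF q X])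
  have pd: "pos_def (n q) (- (- M q X))" using M_pos_def[OF q X] by simp
  have herm: "hermitian_mat (n q) (- M q X)" by (intro hermitian_uminus M_hermitian q X)
  have opt: "Re (det (Z - (- M q X))) \<le> Re (det (BR q X - (- M q X)))"
    "Re (det (Z - (- M q X))) = Re (det (BR q X - (- M q X))) \<Longrightarrow> Z = BR q X"
    using frob_proj_cov_set(3,4)[OF herm n_pos[OF q] P[OF q] Z pd] unfolding BR_eq[OF q] by auto
  have pos: "\<kappa> * Re (det (Z - (- M q X))) > 0" "\<kappa> * Re (det (BR q X - (- M q X))) > 0"
    using \<kappa> B Z by (auto intro: mult_pos_pos)
  show "rate Q Hb Rn q Z X \<le> rate Q Hb Rn q (BR q X) X"
    unfolding \<kappa>(2)[OF Z] \<kappa>(2)[OF B] ln_le_cancel_iff[OF pos] using opt(1) \<kappa>(1) by simp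
  assume "rate Q Hb Rn q (BR q X) X \<le> rate Q Hb Rn q Z X"
  then have "\<kappa> * Re (det (BR q X - (- M q X))) \<le> \<kappa> * Re (det (Z - (- M q X)))"
    unfolding \<kappa>(2)[OF Z] \<kappa>(2)[OF B] ln_le_cancel_iff[OF pos(2,1)] .
  then show "Z = BR q X" using opt \<kappa>(1) by simp
qed

lemma nash_equilibrium_iff:
  "nash_equilibrium Q Hb Rn P X \<longleftrightarrow> X \<in> extensional {..<Q} \<and> feasible X \<and> (\<forall>q<Q. X q = BR q X)"
proof
  assume ne: "nash_equilibrium Q Hb Rn P X"
  then have "X \<in> (\<Pi>\<^sub>E q \<in> {..<Q}. strategy_set Hb P q)" by (simp add: nash_equilibrium_def)
  then have X: "X \<in> extensional {..<Q}" "feasible X"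
    by (auto simp: PiE_iff feasible_def strategy_set_eq)
  moreover have "X q = BR q X" if q: "q < Q" for q
  proof (rule BR_maximizes_rate(2)[OF q feasible_imp_against[OF X(2)]])
    show "X q \<in> K q" using X q by (simp add: feasible_def)
    show "rate Q Hb Rn q (BR q X) X \<le> rate Q Hb Rn q (X q) X"
      using ne q BR_feasible[OF q feasible_imp_against[OF X(2)]]
      by (simp add: nash_equilibrium_def strategy_set_eq)
  qed
  ultimately show "X \<in> extensional {..<Q} \<and> feasible X \<and> (\<forall>q<Q. X q = BR q X)" by blast
next
  assume X: "X \<in> extensional {..<Q} \<and> feasible X \<and> (\<forall>q<Q. X q = BR q X)"
  then have "X \<in> (\<Pi>\<^sub>E q \<in> {..<Q}. strategy_set Hb P q)"
    by (auto simp: PiE_iff feasible_def strategy_set_eq)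
  moreover have "rate Q Hb Rn q Z X \<le> rate Q Hb Rn q (X q) X" if q: "q < Q" and Z: "Z \<in> strategy_set Hb P q" for q Z
    using BR_maximizes_rate(1)[OF q feasible_imp_against, of X Z] X q Z by (auto simp: strategy_set_eq)
  ultimately show "nash_equilibrium Q Hb Rn P X" by (simp add: nash_equilibrium_def)
qed


text \<open>
  Profiles are encoded by the real and imaginary parts of their entries. An arbitrary vector of
  coordinates is turned into a feasible profile by taking Hermitian parts and projecting, so that
  the best response becomes a self-map of a box; a fixed point of it is Hermitian and feasible
  already, hence unaffected by that correction.
\<close>

definition coords :: "(nat \<times> nat \<times> nat \<times> bool) set" where
  "coords = (SIGMA q:{..<Q}. {..<n q} \<times> {..<n q} \<times> UNIV)"

definition decode :: "(nat \<times> nat \<times> nat \<times> bool \<Rightarrow> real) \<Rightarrow> nat \<Rightarrow> nat \<Rightarrow> nat \<Rightarrow> complex" where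
  "decode x q i j = Complex (x (q, i, j, True)) (x (q, i, j, False))"

definition hermitian_part :: "(nat \<times> nat \<times> nat \<times> bool \<Rightarrow> real) \<Rightarrow> nat \<Rightarrow> complex mat" where
  "hermitian_part x q = mat (n q) (n q) (\<lambda>(i, j). (decode x q i j + cnj (decode x q j i)) / 2)"

definition profile :: "(nat \<times> nat \<times> nat \<times> bool \<Rightarrow> real) \<Rightarrow> nat \<Rightarrow> complex mat" where
  "profile x = restrict (\<lambda>q. frob_proj (K q) (hermitian_part x q)) {..<Q}"

definition encoded_BR :: "(nat \<times> nat \<times> nat \<times> bool \<Rightarrow> real) \<Rightarrow> nat \<times> nat \<times> nat \<times> bool \<Rightarrow> real" where
  "encoded_BR x = (\<lambda>(q, i, j, b). (if b then Re else Im) (BR q (profile x) $$ (i, j)))"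

lemma finite_coords: "finite coords"
  by (simp add: coords_def)

lemma hermitian_part_hermitian: "hermitian_mat (n q) (hermitian_part x q)"
  by (auto simp: hermitian_mat_def hermitian_part_def add.commute intro!: eq_matI)

lemma profile_feasible: "feasible (profile x)"
  unfolding feasible_def profile_def
  by (auto intro!: frob_proj_cov_set(1) hermitian_part_hermitian n_pos P)

lemma profile_feasible_against: "feasible_against q (profile x)"
  by (rule feasible_imp_against[OF profile_feasible])

lemma BR_profile: "q < Q \<Longrightarrow> BR q (profile x) \<in> K q"
  by (rule BR_feasible[OF _ profile_feasible_against])

lemma cmod_decode_diff_le:
  assumes "q < Q" "i < n q" "j < n q"
  shows "cmod (decode x q i j - decode y q i j) \<le> 2 * (\<Sum>k\<in>coords. \<bar>x k - y k\<bar>)"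
proof -
  have le: "\<bar>x (q, i, j, b) - y (q, i, j, b)\<bar> \<le> (\<Sum>k\<in>coords. \<bar>x k - y k\<bar>)" for b
    using assms by (intro member_le_sum[of _ coords "\<lambda>k. \<bar>x k - y k\<bar>"] finite_coords) (auto simp: coords_def)
  have "cmod (decode x q i j - decode y q i j)
      \<le> \<bar>x (q, i, j, True) - y (q, i, j, True)\<bar> + \<bar>x (q, i, j, False) - y (q, i, j, False)\<bar>"
    using cmod_le[of "decode x q i j - decode y q i j"] by (simp add: decode_def)
  then show ?thesis using le[of True] le[of False] by simp
qed

lemma frob_norm_profile_diff_le:
  assumes q: "q < Q"
  shows "frob_norm (profile x q - profile y q) \<le> real (n q) * real (n q) * (2 * (\<Sum>k\<in>coords. \<bar>x k - y k\<bar>))"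
proof -
  have "frob_norm (profile x q - profile y q) \<le> frob_norm (hermitian_part x q - hermitian_part y q)"
    using q by (auto simp: profile_def intro!: frob_proj_nonexpansive hermitian_part_hermitian n_pos P)
  also have "\<dots> \<le> real (n q) * real (n q) * (2 * (\<Sum>k\<in>coords. \<bar>x k - y k\<bar>))"
  proof (rule frob_norm_le_of_entries)
    fix i j assume ij: "i < n q" "j < n q"
    let ?d = "\<lambda>i j. decode x q i j - decode y q i j"
    have "(hermitian_part x q - hermitian_part y q) $$ (i, j) = (?d i j + cnj (?d j i)) / 2"
      using ij by (simp add: hermitian_part_def field_simps)
    then have "cmod ((hermitian_part x q - hermitian_part y q) $$ (i, j)) = cmod (?d i j + cnj (?d j i)) / 2"
      by (simp only: norm_divide norm_numeral)
    also have "\<dots> \<le> (cmod (?d i j) + cmod (?d j i)) / 2"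
      using norm_triangle_ineq[of "?d i j" "cnj (?d j i)"] unfolding complex_mod_cnj by simp
    finally show "cmod ((hermitian_part x q - hermitian_part y q) $$ (i, j)) \<le> 2 * (\<Sum>k\<in>coords. \<bar>x k - y k\<bar>)"
      using cmod_decode_diff_le[OF q ij, of x y] cmod_decode_diff_le[OF q ij(2,1), of x y] by simp
  qed (auto simp: hermitian_part_def)
  finally show ?thesis .
qed

text \<open>Any finite constant suffices for existence, so the estimate is crude:
  \<open>2 * n\<^sub>r\<^sup>2\<close> pays for passing from coordinates to the Frobenius norm, and
  the outer sum over users makes the constant independent of \<open>k\<close>.\<close>

lemma encoded_BR_lipschitz:
  assumes "k \<in> coords"
  shows "\<bar>encoded_BR x k - encoded_BR y k\<bar>
    \<le> (\<Sum>q<Q. \<Sum>r<Q. s q r * (2 * (real (n r) * real (n r)))) * (\<Sum>k\<in>coords. \<bar>x k - y k\<bar>)"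
proof -
  let ?D = "\<Sum>k\<in>coords. \<bar>x k - y k\<bar>"
  obtain q i j b where k: "k = (q, i, j, b)" "q < Q" "i < n q" "j < n q"
    using assms by (auto simp: coords_def)
  note q = k(2)
  have c: "BR q (profile x) \<in> carrier_mat (n q) (n q)" "BR q (profile y) \<in> carrier_mat (n q) (n q)"
    using BR_profile[OF q] cov_set_carrier by blast+
  let ?W = "BR q (profile x) - BR q (profile y)"
  have "\<bar>encoded_BR x k - encoded_BR y k\<bar> = \<bar>(if b then Re else Im) (?W $$ (i, j))\<bar>"
    using k c by (auto simp: encoded_BR_def)
  also have "\<dots> \<le> cmod (?W $$ (i, j))" by (auto simp: abs_Re_le_cmod abs_Im_le_cmod)
  also have "\<dots> \<le> frob_norm ?W" using k c by (intro cmod_index_le_frob_norm) auto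
  also have "\<dots> \<le> (\<Sum>r\<in>others q. s q r * frob_norm (profile x r - profile y r))"
    by (rule BR_lipschitz[OF q profile_feasible_against profile_feasible_against])
  also have "\<dots> \<le> (\<Sum>r\<in>others q. s q r * (real (n r) * real (n r) * (2 * ?D)))"
    by (intro sum_mono mult_left_mono frob_norm_profile_diff_le s_nonneg q) auto
  also have "\<dots> \<le> (\<Sum>r<Q. s q r * (real (n r) * real (n r) * (2 * ?D)))"
    by (intro sum_mono2 mult_nonneg_nonneg s_nonneg q sum_nonneg) auto
  also have "\<dots> = (\<Sum>r<Q. s q r * (2 * (real (n r) * real (n r)))) * ?D"
    by (subst sum_distrib_right) (intro sum.cong refl, simp only: mult_ac)
  also have "\<dots> \<le> (\<Sum>q<Q. \<Sum>r<Q. s q r * (2 * (real (n r) * real (n r)))) * ?D"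
    using q by (intro mult_right_mono member_le_sum[of q "{..<Q}" "\<lambda>q. \<Sum>r<Q. s q r * (2 * (real (n r) * real (n r)))"]
      sum_nonneg mult_nonneg_nonneg s_nonneg) auto
  finally show ?thesis .
qed

theorem nash_equilibrium_exists: "\<exists>X. nash_equilibrium Q Hb Rn P X"
proof -
  \<comment> \<open>Each entry of a best response is bounded by its Frobenius norm and hence by the
    power of its user; the summand 1 keeps the box nondegenerate even for an empty sum.\<close>
  define C where "C = 1 + (\<Sum>q<Q. P q)"
  have PC: "P q \<le> C" if "q < Q" for q
    using member_le_sum[of q "{..<Q}" P] that P by (force simp: C_def)
  have "0 < C" unfolding C_def using P by (intro add_pos_nonneg sum_nonneg) (auto intro: less_imp_le)
  then obtain x where x: "\<And>k. k \<in> coords \<Longrightarrow> encoded_BR x k = x k"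
  proof (rule lipschitz_fixpoint_box[OF finite_coords])
    show "0 \<le> (\<Sum>q<Q. \<Sum>r<Q. s q r * (2 * (real (n r) * real (n r))))"
      by (intro sum_nonneg mult_nonneg_nonneg s_nonneg) auto
    fix x
    show "encoded_BR x \<in> {x. \<forall>i\<in>coords. \<bar>x i\<bar> \<le> C}"
    proof (intro CollectI ballI)
      fix k assume "k \<in> coords"
      then obtain q i j b where k: "k = (q, i, j, b)" "q < Q" "i < n q" "j < n q"
        by (auto simp: coords_def)
      have c: "BR q (profile x) \<in> carrier_mat (n q) (n q)"
        using BR_profile[OF k(2)] cov_set_carrier by blast
      have "\<bar>encoded_BR x k\<bar> \<le> cmod (BR q (profile x) $$ (i, j))"
        unfolding k encoded_BR_def by (auto simp: abs_Re_le_cmod abs_Im_le_cmod)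
      also have "\<dots> \<le> frob_norm (BR q (profile x))" using k c by (intro cmod_index_le_frob_norm) auto
      also have "\<dots> \<le> P q" by (intro frob_norm_cov_set_le[OF BR_profile] k less_imp_le P)
      also have "\<dots> \<le> C" by (rule PC[OF k(2)])
      finally show "\<bar>encoded_BR x k\<bar> \<le> C" .
    qed
  qed (use encoded_BR_lipschitz in auto)
  have "profile x q = BR q (profile x)" if q: "q < Q" for q
  proof -
    have S: "BR q (profile x) \<in> K q" by (rule BR_profile[OF q])
    then have herm: "hermitian_mat (n q) (BR q (profile x))" by (simp add: cov_set_def pos_semidef_def)
    have dec: "decode x q i j = BR q (profile x) $$ (i, j)" if "i < n q" "j < n q" for i j
      using x[of "(q, i, j, True)"] x[of "(q, i, j, False)"] that q
      by (simp add: coords_def encoded_BR_def decode_def complex_eq_iff)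
    have "hermitian_part x q = BR q (profile x)"
    proof (rule eq_matI)
      fix i j assume "i < dim_row (BR q (profile x))" "j < dim_col (BR q (profile x))"
      then have ij: "i < n q" "j < n q" using herm by (auto simp: hermitian_mat_def)
      have "cnj (BR q (profile x) $$ (j, i)) = BR q (profile x) $$ (i, j)"
        using hermitian_mat_index[OF herm ij] by simp
      then show "hermitian_part x q $$ (i, j) = BR q (profile x) $$ (i, j)"
        using ij by (simp add: hermitian_part_def dec)
    qed (use herm in \<open>auto simp: hermitian_part_def hermitian_mat_def\<close>)
    then show ?thesis using q frob_proj_self[OF S] by (simp add: profile_def)
  qed
  then have "nash_equilibrium Q Hb Rn P (profile x)"
    unfolding nash_equilibrium_iff using profile_feasible by (auto simp: profile_def)
  then show ?thesis by blast
qed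

section \<open>Asynchronous convergence and uniqueness of the equilibrium\<close>

lemma async_run_feasible:
  assumes sched: "updating_schedule Q T \<tau>" and run: "async_run Q Hb Rn P T \<tau> X"
  shows "q < Q \<Longrightarrow> X m q \<in> K q"
proof (induction m arbitrary: q rule: less_induct)
  case (less m)
  show ?case
  proof (cases m)
    case 0
    then show ?thesis using run less.prems by (simp add: async_run_def strategy_set_eq)
  next
    case (Suc k)
    have "feasible_against q (\<lambda>r. X (\<tau> q r k) r)"
      unfolding feasible_against_def
    proof
      fix r assume r: "r \<in> others q"
      then have "\<tau> q r k < m"
        using sched less.prems Suc unfolding updating_schedule_def by (auto simp: less_Suc_eq_le)
      then show "X (\<tau> q r k) r \<in> K r" using less.IH r by auto
    qed
    then show ?thesis
      using run less.prems less.IH[of k q] Suc BR_feasible[of q] by (auto simp: async_run_def)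
  qed
qed

text \<open>The distances to the equilibrium obey the update inequality of
  \<open>async_contraction_tendsto_0\<close>: \<open>Y\<close> is its own best response, so each
  update compares two best responses, to the perceived profile and to \<open>Y\<close>.\<close>

lemma async_run_converges:
  assumes rho: "spectral_radius (map_mat complex_of_real (interference_matrix Q H)) < 1"
    and ne: "nash_equilibrium Q Hb Rn P Y"
    and sched: "updating_schedule Q T \<tau>" and run: "async_run Q Hb Rn P T \<tau> X" and q: "q < Q"
  shows "(\<lambda>m. frob_norm (X m q - Y q)) \<longlonglongrightarrow> 0"
proof -
  have Y: "feasible Y" "\<And>q. q < Q \<Longrightarrow> Y q = BR q Y" using ne by (auto simp: nash_equilibrium_iff)
  have "map_mat complex_of_real (interference_matrix Q H) = mat Q Q (\<lambda>(q, r). complex_of_real (s q r))"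
    by (rule eq_matI) (auto simp: interference_matrix_def)
  then obtain w where w: "\<And>q. 0 < w q" "\<And>q. q < Q \<Longrightarrow> (\<Sum>r<Q. s q r * w r) < w q"
    using spectral_radius_less_1_imp_weights[of Q s] s_nonneg rho by metis
  show ?thesis
  proof (rule async_contraction_tendsto_0[OF sched s_nonneg w(1) _ frob_norm_nonneg _ _ q])
    fix q assume q: "q < Q"
    have "(\<Sum>r\<in>others q. s q r * w r) \<le> (\<Sum>r<Q. s q r * w r)"
      by (intro sum_mono2 mult_nonneg_nonneg s_nonneg q) (use w(1) in \<open>auto intro: less_imp_le\<close>)
    then show "(\<Sum>r\<in>others q. s q r * w r) < w q" using w(2)[OF q] by linarith
  next
    fix m q assume q: "q < Q" and m: "m \<in> T q"
    have "feasible_against q (\<lambda>r. X (\<tau> q r m) r)"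
      using async_run_feasible[OF sched run] by (auto simp: feasible_against_def)
    then show "frob_norm (X (Suc m) q - Y q)
        \<le> (\<Sum>r\<in>others q. s q r * frob_norm (X (\<tau> q r m) r - Y r))"
      using BR_lipschitz[OF q _ feasible_imp_against[OF Y(1)]] run q m Y(2)[OF q]
      by (simp add: async_run_def)
  next
    fix m q assume "q < Q" "m \<notin> T q"
    then show "frob_norm (X (Suc m) q - Y q) = frob_norm (X m q - Y q)"
      using run by (simp add: async_run_def)
  qed
qed

text \<open>A second equilibrium is a stationary run of the undelayed iteration.\<close>

lemma nash_equilibrium_unique:
  assumes rho: "spectral_radius (map_mat complex_of_real (interference_matrix Q H)) < 1"
    and X: "nash_equilibrium Q Hb Rn P X" and Y: "nash_equilibrium Q Hb Rn P Y"
  shows "X = Y"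
proof (rule extensionalityI)
  show "X \<in> extensional {..<Q}" "Y \<in> extensional {..<Q}" using X Y by (simp_all add: nash_equilibrium_iff)
  fix q assume "q \<in> {..<Q}"
  then have q: "q < Q" by simp
  have "updating_schedule Q (\<lambda>_. UNIV) (\<lambda>_ _ m. m)" by (simp add: updating_schedule_def)
  moreover have "async_run Q Hb Rn P (\<lambda>_. UNIV) (\<lambda>_ _ m. m) (\<lambda>_. X)"
  proof -
    have "X q \<in> K q" "BR q X = X q" if "q < Q" for q
      using X that unfolding nash_equilibrium_iff feasible_def by metis+
    then show ?thesis by (simp add: async_run_def strategy_set_eq)
  qed
  ultimately have "(\<lambda>m :: nat. frob_norm (X q - Y q)) \<longlonglongrightarrow> 0"
    using async_run_converges[OF rho Y _ _ q] by blast
  then have "frob_norm (X q - Y q) = 0" by (simp add: LIMSEQ_const_iff)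
  moreover have c: "X q \<in> carrier_mat (n q) (n q)" "Y q \<in> carrier_mat (n q) (n q)"
    using X Y q cov_set_carrier unfolding nash_equilibrium_iff feasible_def by blast+
  ultimately have "X q - Y q = 0\<^sub>m (n q) (n q)" by (intro frob_norm_eq_0) (auto intro: minus_carrier_mat)
  then have "(X q - Y q) $$ (i, j) = 0" if "i < n q" "j < n q" for i j using that by simp
  then show "X q = Y q" using c by (intro eq_matI) force+
qed

end

theorem theorem13:
  fixes Q :: nat
    and nR nT :: "nat \<Rightarrow> nat"
    and H :: "nat \<Rightarrow> nat \<Rightarrow> complex mat"
    and Rn V :: "nat \<Rightarrow> complex mat"
    and P :: "nat \<Rightarrow> real"
  assumes "Q \<ge> 1"
    and "\<And>r q. r < Q \<Longrightarrow> q < Q \<Longrightarrow> H r q \<in> carrier_mat (nR q) (nT r)"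
    and "\<And>q. q < Q \<Longrightarrow> H q q \<noteq> 0\<^sub>m (nR q) (nT q)"
    and "\<And>q. q < Q \<Longrightarrow> pos_def (nR q) (Rn q)"
    and "\<And>q. q < Q \<Longrightarrow> P q > 0"
    and "\<And>q. q < Q \<Longrightarrow> reduction_basis (H q q) (V q)"
  shows "(\<exists>X. nash_equilibrium Q (reduced_channel H V) Rn P X) \<and>
    (spectral_radius (map_mat complex_of_real (interference_matrix Q H)) < 1 \<longrightarrow>
      (\<exists>!X. nash_equilibrium Q (reduced_channel H V) Rn P X) \<and>
      (\<forall>Xstar T \<tau> X.
         nash_equilibrium Q (reduced_channel H V) Rn P Xstar \<longrightarrow>
         updating_schedule Q T \<tau> \<longrightarrow>
         async_run Q (reduced_channel H V) Rn P T \<tau> X \<longrightarrow>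
         (\<forall>q < Q. (\<lambda>n. frob_norm (X n q - Xstar q)) \<longlonglongrightarrow> 0)))"
proof -
  interpret mimo_game Q nR nT H Rn V P
    by unfold_locales (use assms in auto)
  show ?thesis
    using nash_equilibrium_exists nash_equilibrium_unique async_run_converges by blast
qed

end
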